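(* Let $1<p<+\infty$ and $p'=p/(p-1)$. Define $$m_{p,1}=\inf\{F_{p,1}(\Omega) : \Omega\subset\mathbb{R}^d\text{ open, convex, bounded}\},\qquad M_{p,1}=\sup\{F_{p,1}(\Omega) : \Omega\subset\mathbb{R}^d\text{ open, convex, bounded}\}.$$ Then $$m_{p,1}\ge\frac1d\Big(\frac{\pi_p}{2}\Big)^p\Big(\frac{1}{d+p'}\Big)^{p-1},\qquad M_{p,1}\le\min\Big\{1,\Big(\frac{1}{p'+1}\Big)^{p-1}\lambda_p(B_1)\Big\}.$$
   Context: The sets $\Omega$ are nonempty; $|\Omega|$ is the Lebesgue measure; $B_1$ is the unit ball of $\mathbb{R}^d$ centered at the origin. For $\Omega\subset\mathbb{R}^d$ open with $0<|\Omega|<\infty$ and $1<p<\infty$, $W^{1,p}_0(\Omega)$ is the completion of $C_c^\infty(\Omega)$ with respect to the norm $\|\nabla u\|_{L^p(\Omega)}$. The $p$-torsional rigidity is $$T_p(\Omega)=\max\Big\{\Big[\int_\Omega|u|\,dx\Big]^p\Big[\int_\Omega|\nabla u|^p\,dx\Big]^{-1} : u\in W^{1,p}_0(\Omega),\ u\neq0\Big\},$$ the $p$-principal eigenvalue is $$\lambda_p(\Omega)=\min\Big\{\Big[\int_\Omega|\nabla u|^p\,dx\Big]\Big[\int_\Omega|u|^p\,dx\Big]^{-1} : u\in W^{1,p}_0(\Omega),\ u\neq0\Big\},$$ and $F_{p,1}(\Omega)=\lambda_p(\Omega)T_p(\Omega)/|\Omega|^{p-1}$. The constant $\pi_p$ is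 $$\pi_p=2\pi\frac{(p-1)^{1/p}}{p\sin(\pi/p)},$$ so that in dimension one $\lambda_p((-1,1))=(\pi_p/2)^p$. *)

theory Defs
  imports "HOL-Analysis.Analysis"
begin

definition grad :: "('a::euclidean_space \<Rightarrow> real) \<Rightarrow> 'a \<Rightarrow> 'a" where
  "grad f x = (THE D. GDERIV f x :> D)"

primrec C_k :: "nat \<Rightarrow> ('a::euclidean_space \<Rightarrow> real) \<Rightarrow> bool" where
  "C_k 0 f \<longleftrightarrow> continuous_on UNIV f"
| "C_k (Suc k) f \<longleftrightarrow>
     (\<exists>g. (\<forall>x. GDERIV f x :> g x) \<and> (\<forall>b\<in>Basis. C_k k (\<lambda>x. g x \<bullet> b)))"

definition Cc_infinity :: "'a::euclidean_space set \<Rightarrow> ('a \<Rightarrow> real) set" where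
  "Cc_infinity \<Omega> =
     {\<phi>. (\<forall>k. C_k k \<phi>) \<and> compact (closure {x. \<phi> x \<noteq> 0}) \<and> closure {x. \<phi> x \<noteq> 0} \<subseteq> \<Omega>}"

definition Lp :: "real \<Rightarrow> 'a::euclidean_space set \<Rightarrow> ('a \<Rightarrow> 'b::euclidean_space) set" where
  "Lp p \<Omega> = {f. f \<in> borel_measurable (lebesgue_on \<Omega>) \<and>
                 integrable (lebesgue_on \<Omega>) (\<lambda>x. norm (f x) powr p)}"

definition Lp_norm :: "real \<Rightarrow> 'a::euclidean_space set \<Rightarrow> ('a \<Rightarrow> 'b::euclidean_space) \<Rightarrow> real" where
  "Lp_norm p \<Omega> f = (LINT x|lebesgue_on \<Omega>. norm (f x) powr p) powr (1 / p)"

text \<open>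
  The completion of \<open>Cc_infinity \<Omega>\<close> for the norm \<open>\<lambda>\<phi>. Lp_norm p \<Omega> (grad \<phi>)\<close>. An element of it is
  represented by a pair \<open>(u, G)\<close> of limits of a sequence of test functions and of their
  gradients. The gradients are Cauchy in \<open>Lp\<close> exactly when the sequence is Cauchy for the
  norm being completed, and the functions then converge in \<open>Lp\<close> as well by the Poincare inequality
  (\<open>\<Omega>\<close> has finite measure). \<open>G\<close> is the weak gradient of \<open>u\<close>, so up to null sets it is determined
  by \<open>u\<close>. Values outside \<open>\<Omega>\<close> are irrelevant.
\<close>

definition W1p_0 :: "real \<Rightarrow> 'a::euclidean_space set \<Rightarrow> (('a \<Rightarrow> real) \<times> ('a \<Rightarrow> 'a)) set" where
  "W1p_0 p \<Omega> = {(u, G). u \<in> Lp p \<Omega> \<and> G \<in> Lp p \<Omega> \<and>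
     (\<exists>\<phi>. (\<forall>n::nat. \<phi> n \<in> Cc_infinity \<Omega>) \<and>
          (\<lambda>n. Lp_norm p \<Omega> (\<lambda>x. \<phi> n x - u x)) \<longlonglongrightarrow> 0 \<and>
          (\<lambda>n. Lp_norm p \<Omega> (\<lambda>x. grad (\<phi> n) x - G x)) \<longlonglongrightarrow> 0)}"

definition W1p_0_nonzero :: "real \<Rightarrow> 'a::euclidean_space set \<Rightarrow> (('a \<Rightarrow> real) \<times> ('a \<Rightarrow> 'a)) set" where
  "W1p_0_nonzero p \<Omega> = {(u, G) \<in> W1p_0 p \<Omega>. \<not> (AE x in lebesgue_on \<Omega>. u x = 0)}"

text \<open>
  The maximum and minimum in the variational definitions are rendered as supremum and infimum in
  \<open>ereal\<close>, which need neither attainment nor boundedness to be meaningful.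
\<close>

definition T_p :: "real \<Rightarrow> 'a::euclidean_space set \<Rightarrow> ereal" where
  "T_p p \<Omega> = (SUP (u, G) \<in> W1p_0_nonzero p \<Omega>.
     ereal ((LINT x|lebesgue_on \<Omega>. \<bar>u x\<bar>) powr p / (LINT x|lebesgue_on \<Omega>. norm (G x) powr p)))"

definition lambda_p :: "real \<Rightarrow> 'a::euclidean_space set \<Rightarrow> ereal" where
  "lambda_p p \<Omega> = (INF (u, G) \<in> W1p_0_nonzero p \<Omega>.
     ereal ((LINT x|lebesgue_on \<Omega>. norm (G x) powr p) / (LINT x|lebesgue_on \<Omega>. \<bar>u x\<bar> powr p)))"

definition F_p1 :: "real \<Rightarrow> 'a::euclidean_space set \<Rightarrow> ereal" where
  "F_p1 p \<Omega> = lambda_p p \<Omega> * T_p p \<Omega> / ereal (measure lebesgue \<Omega> powr (p - 1))"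

definition convex_domains :: "'a::euclidean_space set set" where
  "convex_domains = {\<Omega>. open \<Omega> \<and> convex \<Omega> \<and> bounded \<Omega> \<and> \<Omega> \<noteq> {}}"

definition m_p1 :: "'a::euclidean_space itself \<Rightarrow> real \<Rightarrow> ereal" where
  "m_p1 _ p = (INF \<Omega> \<in> (convex_domains :: 'a set set). F_p1 p \<Omega>)"

definition M_p1 :: "'a::euclidean_space itself \<Rightarrow> real \<Rightarrow> ereal" where
  "M_p1 _ p = (SUP \<Omega> \<in> (convex_domains :: 'a set set). F_p1 p \<Omega>)"

definition pi_p :: "real \<Rightarrow> real" where
  "pi_p p = 2 * pi * ((p - 1) powr (1 / p) / (p * sin (pi / p)))"

end

theory Submission
  imports Defs
begin

text \<open>Smooth test functions suffice for both variational quantities: the inequalities for them pass to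
  the completion. Enclose the support of a test function of a convex \<open>\<Omega>\<close> in a polytope inside \<open>\<Omega>\<close> and divide
  the polytope into cells of points with a common nearest facet. Each cell is a union of segments
  issuing orthogonally from its facet, no longer than the inradius \<open>\<rho>\<close>, and the function vanishes on the facet; the sharp
  one-dimensional inequalities on these segments give \<open>\<lambda> \<ge> (\<pi>\<^sub>p / (2 \<rho>))\<^sup>p\<close> (Hersch--Protter) and
  \<open>T \<le> |\<Omega>|\<^sup>p\<^sup>-\<^sup>1 \<rho>\<^sup>p / (p' + 1)\<^sup>p\<^sup>-\<^sup>1\<close>. Instead of Fubini's theorem, the integration along the
  segments uses only that \<open>\<integral> F (x + h n) - F x\<close> vanishes, in the limit \<open>h \<rightarrow> 0\<close>. Conversely, \<open>1 - J\<^sup>q\<close>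
  with \<open>q = p'\<close> and \<open>J\<close> the gauge of \<open>\<Omega>\<close> centred at an incentre gives \<open>T \<ge> |\<Omega>|\<^sup>p\<^sup>-\<^sup>1 \<rho>\<^sup>p / (d (d + p')\<^sup>p\<^sup>-\<^sup>1)\<close>;
  it is made smooth by approximating the gauge of a polytope by log-sum-exp. The bound by \<open>1\<close> is Jensen's
  inequality, and \<open>\<lambda>\<close> is compared with that of the inscribed ball by inclusion and scaling.\<close>

section \<open>Smooth functions\<close>

text \<open>\<lambda> and T are each compared with a power of the inradius \<rho>; in
  \<open>F_p1\<close> these powers cancel, and what is left are the constants of the theorem. The
  eigenvalue inequality on a segment is used in Picone's form. If w is the first eigenfunction, zero
  at the facet and with zero slope at the far end, then a = (w' / w)^(p-1), as a function of the
  distance to the facet, solves a' = -(\<Lambda> + (p-1) a^q). By Young's inequality \<Lambda>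
  |\<phi>|^p - |\<phi>'|^p is then at most the derivative of -a |\<phi>|^p. The boundary term at the
  far end has the right sign as long as a \<ge> 0 there, so an upper bound on the length of the
  segment suffices: the solution has to stay nonnegative up to distance \<rho>, and it does when
  \<Lambda>^(1/p) \<rho> < \<pi>_p / 2. It blows up at the facet, which is why the polytope is put
  strictly around the support.\<close>

lemma C_k_Suc_imp: "C_k (Suc k) f \<Longrightarrow> C_k k f"
proof (induction k arbitrary: f)
  case 0
  then obtain g where "\<And>x. GDERIV f x :> g x" by auto
  then have "\<And>x. continuous (at x) f"
    unfolding gderiv_def using has_derivative_continuous by blast
  then show ?case by (simp add: continuous_at_imp_continuous_on)
next
  case (Suc k)
  from Suc.prems obtain g where g: "\<And>x. GDERIV f x :> g x"
    and g': "\<forall>b\<in>Basis. C_k (Suc k) (\<lambda>x. g x \<bullet> b)"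
    unfolding C_k.simps(2)[of "Suc k"] by blast
  have "\<forall>b\<in>Basis. C_k k (\<lambda>x. g x \<bullet> b)" using g' Suc.IH by blast
  with g show ?case by auto
qed

lemma C_k_const: "C_k k (\<lambda>x::'a::euclidean_space. c)"
proof (induction k arbitrary: c)
  case (Suc k)
  have "GDERIV (\<lambda>x::'a. c) x :> 0" for x by (rule GDERIV_const)
  with Suc show ?case by (auto intro!: exI[of _ "\<lambda>x. 0"])
qed simp

lemma C_k_add: "C_k k f \<Longrightarrow> C_k k g \<Longrightarrow> C_k k (\<lambda>x. f x + g x)"
proof (induction k arbitrary: f g)
  case (Suc k)
  from Suc.prems obtain f' g' where f: "\<And>x. GDERIV f x :> f' x" "\<forall>b\<in>Basis. C_k k (\<lambda>x. f' x \<bullet> b)"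
    and g: "\<And>x. GDERIV g x :> g' x" "\<forall>b\<in>Basis. C_k k (\<lambda>x. g' x \<bullet> b)"
    by auto
  have "GDERIV (\<lambda>x. f x + g x) x :> f' x + g' x" for x
    using f(1) g(1) by (rule GDERIV_add)
  moreover have "\<forall>b\<in>Basis. C_k k (\<lambda>x. (f' x + g' x) \<bullet> b)"
    using Suc.IH f(2) g(2) by (simp add: inner_add_left)
  ultimately show ?case by (auto intro!: exI[of _ "\<lambda>x. f' x + g' x"])
qed (auto intro: continuous_intros)

lemma C_k_mult: "C_k k f \<Longrightarrow> C_k k g \<Longrightarrow> C_k k (\<lambda>x. f x * g x)"
proof (induction k arbitrary: f g)
  case (Suc k)
  have fk: "C_k k f" "C_k k g" using Suc.prems C_k_Suc_imp by blast+
  from Suc.prems obtain f' g' where f: "\<And>x. GDERIV f x :> f' x" "\<forall>b\<in>Basis. C_k k (\<lambda>x. f' x \<bullet> b)"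
    and g: "\<And>x. GDERIV g x :> g' x" "\<forall>b\<in>Basis. C_k k (\<lambda>x. g' x \<bullet> b)"
    by auto
  have "GDERIV (\<lambda>x. f x * g x) x :> f x *\<^sub>R g' x + g x *\<^sub>R f' x" for x
    using f(1) g(1) by (rule GDERIV_mult)
  moreover have "\<forall>b\<in>Basis. C_k k (\<lambda>x. (f x *\<^sub>R g' x + g x *\<^sub>R f' x) \<bullet> b)"
    using Suc.IH f(2) g(2) fk by (auto simp: inner_add_left intro!: C_k_add)
  ultimately show ?case by (auto intro!: exI[of _ "\<lambda>x. f x *\<^sub>R g' x + g x *\<^sub>R f' x"])
qed (auto intro: continuous_intros)

lemma C_k_sum: "finite A \<Longrightarrow> (\<And>i. i \<in> A \<Longrightarrow> C_k k (f i)) \<Longrightarrow> C_k k (\<lambda>x. \<Sum>i\<in>A. f i x)"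
  by (induction A rule: finite_induct) (auto intro: C_k_const C_k_add)

lemma GDERIV_inner_left: "GDERIV (\<lambda>x. x \<bullet> c) x :> c"
  unfolding gderiv_def by (auto intro!: derivative_eq_intros)

lemma C_k_inner: "C_k k (\<lambda>x. x \<bullet> c)"
proof (cases k)
  case 0 then show ?thesis by (auto intro: continuous_intros)
next
  case (Suc j)
  then show ?thesis
    using GDERIV_inner_left[of c] C_k_const by (auto intro!: exI[of _ "\<lambda>x. c"])
qed

text \<open>Regularity of \<open>g' (f x)\<close> is a hypothesis at level \<open>k\<close>, so that
  a family of outer functions closed under differentiation (powers, \<open>exp\<close>,
  \<open>exp_cutoff\<close>) becomes smooth by induction on \<open>k\<close>.\<close>

lemma C_k_Suc_compose:
  assumes "C_k (Suc k) f" "C_k k (\<lambda>x. g' (f x))"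
    and "\<And>x. (g has_real_derivative g' (f x)) (at (f x))"
  shows "C_k (Suc k) (\<lambda>x. g (f x))"
proof -
  from assms(1) obtain f' where f: "\<And>x. GDERIV f x :> f' x" "\<forall>b\<in>Basis. C_k k (\<lambda>x. f' x \<bullet> b)"
    by auto
  have "GDERIV (\<lambda>x. g (f x)) x :> g' (f x) *\<^sub>R f' x" for x
    using f(1) assms(3) by (rule GDERIV_DERIV_compose)
  moreover have "\<forall>b\<in>Basis. C_k k (\<lambda>x. (g' (f x) *\<^sub>R f' x) \<bullet> b)"
    using f(2) assms(2) by (auto intro!: C_k_mult)
  ultimately show ?thesis by (auto intro!: exI[of _ "\<lambda>x. g' (f x) *\<^sub>R f' x"])
qed

lemma C_k_powr:
  assumes "\<And>k. C_k k f" "\<And>x. f x > 0"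
  shows "C_k k (\<lambda>x. f x powr r)"
proof (induction k arbitrary: r)
  case 0
  have "continuous_on UNIV f" using assms(1)[of 0] by simp
  then show ?case using assms(2) by (auto intro!: continuous_intros simp: less_imp_neq[THEN not_sym])
next
  case (Suc k)
  show ?case
    by (rule C_k_Suc_compose[where g' = "\<lambda>t. r * t powr (r - 1)"])
      (use assms Suc in \<open>auto intro!: C_k_mult C_k_const has_real_derivative_powr\<close>)
qed

lemma C_k_ln:
  assumes "\<And>k. C_k k f" "\<And>x. f x > 0"
  shows "C_k k (\<lambda>x. ln (f x))"
proof -
  have "C_k (Suc k) (\<lambda>x. ln (f x))"
  proof (rule C_k_Suc_compose[where f = f and g = ln and g' = "\<lambda>t. t powr - 1"])
    show "(ln has_real_derivative f x powr - 1) (at (f x))" for x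
      using assms(2)[of x] by (auto intro!: derivative_eq_intros simp: powr_minus divide_simps)
  qed (rule assms(1) C_k_powr[OF assms])+
  then show ?thesis by (rule C_k_Suc_imp)
qed

lemma C_k_exp:
  assumes "\<And>k. C_k k f"
  shows "C_k k (\<lambda>x. exp (f x))"
proof (induction k)
  case 0
  show ?case using assms[of 0] by (auto intro!: continuous_intros)
next
  case (Suc k)
  show ?case by (rule C_k_Suc_compose[where g' = exp]) (use assms Suc in auto)
qed

text \<open>exp(-1/t) is the classical flat function. Its derivatives are combinations of its
  quotients by powers of t, so the family over all \<open>n\<close> is closed under
  differentiation.\<close>

definition exp_cutoff :: "nat \<Rightarrow> real \<Rightarrow> real" where
  "exp_cutoff n t = (if t > 0 then exp (- 1 / t) / t ^ n else 0)"

text \<open>With x = 1/t, the term of order n + 2 of the exponential series is at most exp x. The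
  square on the right makes the difference quotient at 0 tend to 0.\<close>

lemma exp_cutoff_le: "\<bar>exp_cutoff n t\<bar> \<le> fact (n + 2) * t\<^sup>2"
proof (cases "t > 0")
  case True
  define x where "x = 1 / t"
  have x: "x > 0" "t = 1 / x" using True by (auto simp: x_def)
  have "(\<lambda>k. x ^ k /\<^sub>R fact k) sums exp x" by (rule exp_converges)
  then have "x ^ (n + 2) / fact (n + 2) \<le> exp x"
    using sums_le[of "\<lambda>k. if k = n + 2 then x ^ (n + 2) / fact (n + 2) else 0"
        "\<lambda>k. x ^ k /\<^sub>R fact k" _ "exp x"] sums_single[of "n + 2" "\<lambda>k. x ^ (n + 2) / fact (n + 2)"] x
    by (auto simp: divide_inverse mult.commute)
  then have "x ^ n * x\<^sup>2 \<le> fact (n + 2) * exp x" by (simp add: divide_le_eq power2_eq_square mult_ac)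
  then have "x ^ n / exp x \<le> fact (n + 2) / x\<^sup>2"
    using x(1) by (simp add: divide_le_eq le_divide_eq del: fact_Suc)
  then show ?thesis using x by (simp add: exp_cutoff_def exp_minus power_divide divide_inverse power_inverse mult.commute del: fact_Suc)
qed (simp add: exp_cutoff_def)

lemma DERIV_exp_cutoff:
  "(exp_cutoff n has_real_derivative (exp_cutoff (n + 2) t - n * exp_cutoff (n + 1) t)) (at t)"
proof (cases "t = 0")
  case True
  have "((\<lambda>h. exp_cutoff n h / h) \<longlongrightarrow> 0) (at 0)"
  proof (rule Lim_null_comparison)
    show "\<forall>\<^sub>F h in at 0. norm (exp_cutoff n h / h) \<le> fact (n + 2) * \<bar>h\<bar>"
      unfolding eventually_at_filter
    proof (intro always_eventually allI impI)
      fix h :: real assume "h \<noteq> 0"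
      then show "norm (exp_cutoff n h / h) \<le> fact (n + 2) * \<bar>h\<bar>"
        using exp_cutoff_le[of n h] by (simp add: abs_divide divide_le_eq power2_eq_square mult.assoc)
    qed
    have "((\<lambda>h::real. fact (n + 2) * \<bar>h\<bar>) \<longlongrightarrow> fact (n + 2) * \<bar>0\<bar>) (at 0)" by (intro tendsto_intros)
    then show "((\<lambda>h::real. fact (n + 2) * \<bar>h\<bar>) \<longlongrightarrow> 0) (at 0)" by simp
  qed
  then show ?thesis using True by (simp add: DERIV_def exp_cutoff_def)
next
  case False
  show ?thesis
  proof (cases "t > 0")
    case True
    have n: "real n * t ^ (n - Suc 0) = real n * t ^ n / t" using True by (cases n) auto
    have "((\<lambda>t. exp (- 1 / t) / t ^ n) has_real_derivative
        (exp_cutoff (n + 2) t - n * exp_cutoff (n + 1) t)) (at t)"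
      using True by (auto intro!: derivative_eq_intros
        simp: exp_cutoff_def n divide_simps power2_eq_square algebra_simps)
    then show ?thesis
      by (rule has_field_derivative_transform_within_open[where S = "{0<..}"])
        (use True in \<open>auto simp: exp_cutoff_def\<close>)
  next
    case neg: False
    have "((\<lambda>t. 0) has_real_derivative 0) (at t)" by simp
    then have "(exp_cutoff n has_real_derivative 0) (at t)"
      by (rule has_field_derivative_transform_within_open[where S = "{..<0}"])
        (use False neg in \<open>auto simp: exp_cutoff_def\<close>)
    then show ?thesis using neg by (simp add: exp_cutoff_def)
  qed
qed

lemma C_k_exp_cutoff:
  assumes "\<And>k. C_k k f"
  shows "C_k k (\<lambda>x. exp_cutoff n (f x))"
proof (induction k arbitrary: n)
  case 0
  have "continuous_on UNIV (exp_cutoff n)"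
    using DERIV_exp_cutoff by (auto intro!: continuous_at_imp_continuous_on DERIV_isCont)
  then show ?case
    using assms[of 0] by (auto intro: continuous_on_compose2)
next
  case (Suc k)
  have m: "C_k k (\<lambda>x. - 1 * (real n * exp_cutoff (n + 1) (f x)))"
    by (intro C_k_mult C_k_const Suc.IH)
  show ?case
    by (rule C_k_Suc_compose[OF assms _ DERIV_exp_cutoff])
      (use C_k_add[OF Suc.IH m] in simp)
qed

text \<open>A smooth substitute for the positive part whose slope stays in \<open>[0, 1]\<close>, because \<open>1 + s \<le> exp s\<close>.\<close>

definition smooth_pos :: "real \<Rightarrow> real" where
  "smooth_pos t = t * exp_cutoff 0 t"

lemma smooth_pos_eq_0 [simp]: "t \<le> 0 \<Longrightarrow> smooth_pos t = 0"
  by (simp add: smooth_pos_def exp_cutoff_def)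

text \<open>The loss is a constant, hence \<open>smooth_pos (m * t) / m\<close> falls short of the
  positive part of t by at most 1/m.\<close>

lemma smooth_pos_ge: "t - 1 \<le> smooth_pos t"
proof (cases "t > 0")
  case True
  have "t * (1 + (- 1 / t)) \<le> t * exp (- 1 / t)"
    using True by (intro mult_left_mono exp_ge_add_one_self) auto
  with True show ?thesis by (simp add: smooth_pos_def exp_cutoff_def algebra_simps)
qed (simp)

lemma C_k_smooth_pos: "(\<And>k. C_k k f) \<Longrightarrow> C_k k (\<lambda>x. smooth_pos (f x))"
  unfolding smooth_pos_def by (intro C_k_mult C_k_exp_cutoff)

lemma DERIV_smooth_pos:
  obtains D where "(smooth_pos has_real_derivative D) (at t)" "0 \<le> D" "D \<le> 1" "t \<le> 0 \<Longrightarrow> D = 0"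
proof
  \<comment> \<open>For t > 0 this is exp(-1/t) (1 + 1/t).\<close>
  let ?D = "exp_cutoff 0 t + t * exp_cutoff 2 t"
  show "(smooth_pos has_real_derivative ?D) (at t)"
    unfolding smooth_pos_def[abs_def]
    using DERIV_exp_cutoff[of 0 t] by (auto intro!: derivative_eq_intros simp: numeral_2_eq_2)
  show "0 \<le> ?D" "t \<le> 0 \<Longrightarrow> ?D = 0" by (auto simp: exp_cutoff_def)
  show "?D \<le> 1"
  proof (cases "t > 0")
    case True
    have "exp (- 1 / t) * (1 + 1 / t) \<le> exp (- 1 / t) * exp (1 / t)"
      by (intro mult_left_mono exp_ge_add_one_self) auto
    also have "\<dots> = 1" by (simp add: exp_minus)
    finally show ?thesis using True by (simp add: exp_cutoff_def algebra_simps power2_eq_square)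
  qed (simp add: exp_cutoff_def)
qed

section \<open>The one-dimensional eigenvalue problem\<close>

text \<open>Taken at a = 1/q, this is the source of the sine in \<open>pi_p\<close>.\<close>

lemma Beta_reflection_real:
  assumes "0 < a" "a < 1"
  shows "Beta a (1 - a) = pi / sin (pi * (a::real))"
proof -
  have "complex_of_real (Gamma a * Gamma (1 - a)) = of_real (pi / sin (pi * a))"
    using Gamma_reflection_complex[of "of_real a"]
    by (simp flip: Gamma_complex_of_real sin_of_real)
  then have "Gamma a * Gamma (1 - a) = pi / sin (pi * a)"
    unfolding of_real_eq_iff .
  then show ?thesis by (simp add: Beta_def)
qed

text \<open>The function \<open>y\<close> is the solution of \<open>y' = -(1 + y\<^sup>q)\<close> decreasing from infinity at \<open>0\<close> to \<open>0\<close>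
  at \<open>L\<close>; convexity of \<open>y\<close> is built into the tangent inequality.
  The substitution \<open>y\<^sup>q = z / (1 - z)\<close> turns the time \<open>\<integral> dy / (1 + y\<^sup>q)\<close> into an incomplete Beta integral.\<close>

lemma Riccati_solution:
  fixes q :: real
  assumes q: "q > 1"
  defines "L \<equiv> (pi / q) / sin (pi / q)"
  obtains y :: "real \<Rightarrow> real" where
    "\<And>t. 0 < t \<Longrightarrow> t < L \<Longrightarrow> y t > 0"
    "\<And>t h. 0 < h \<Longrightarrow> h < t \<Longrightarrow> t < L \<Longrightarrow> y (t - h) \<ge> y t + h * (1 + y t powr q)"
proof -
  define f where "f = (\<lambda>t::real. t powr (1/q - 1) * (1 - t) powr ((1 - 1/q) - 1))"
  have aq: "0 < 1/q" "0 < 1 - 1/q" using q by auto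
  have int: "(f has_integral Beta (1/q) (1 - 1/q)) {0..1}"
    unfolding f_def using has_integral_Beta_real[OF aq] .
  have fint: "f integrable_on {0..1}" using int by auto
  have Lval: "Beta (1/q) (1 - 1/q) / q = L"
    using Beta_reflection_real[of "1/q"] q by (simp add: L_def)
  \<comment> \<open>With z = y^q / (1 + y^q), \<open>B z / q\<close> is the time that
    \<open>y\<close> still has before it reaches 0; the total time is
    \<open>B 1 / q = L\<close>.\<close>
  define B where "B = (\<lambda>z. integral {0..z} f)"
  have B0: "B 0 = 0" and B1: "B 1 = Beta (1/q) (1 - 1/q)"
    using int by (auto simp: B_def integral_unique)
  have Bcont: "continuous_on {0..1} B"
    unfolding B_def by (rule indefinite_integral_continuous_1[OF fint])
  have Bder: "(B has_real_derivative f z) (at z)" if z: "0 < z" "z < 1" for z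
  proof -
    define c d where "c = z / 2" and "d = (z + 1) / 2"
    have cd: "0 < c" "c < z" "z < d" "d < 1" using z by (auto simp: c_def d_def)
    have cont: "continuous_on {c..d} f"
      unfolding f_def using cd by (auto intro!: continuous_intros)
    have "((\<lambda>u. integral {c..u} f) has_real_derivative f z) (at z within {c..d})"
      by (rule integral_has_real_derivative[OF cont]) (use cd in auto)
    then have "((\<lambda>u. integral {c..u} f) has_real_derivative f z) (at z)"
      using cd by (subst (asm) at_within_interior) auto
    then have "((\<lambda>u. B c + integral {c..u} f) has_real_derivative f z) (at z)"
      by (auto intro!: derivative_eq_intros)
    then show ?thesis
    proof (rule has_field_derivative_transform_within_open[where S = "{c<..<d}"])
      fix u assume u: "u \<in> {c<..<d}"
      then have "f integrable_on {0..u}"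
        using cd by (auto intro: integrable_on_subinterval[OF fint])
      then show "B c + integral {c..u} f = B u"
        unfolding B_def using u cd by (intro Henstock_Kurzweil_Integration.integral_combine) auto
    qed (use cd in auto)
  qed
  \<comment> \<open>The value of \<open>y\<close> that belongs to z; it satisfies 1 + X^q = 1 / (1 -
    z).\<close>
  define X where "X = (\<lambda>z::real. (z / (1 - z)) powr (1/q))"
  have Xq: "X z powr q = z / (1 - z)" "X z > 0" if "0 < z" "z < 1" for z
    using that q by (auto simp: X_def powr_powr)
  have Xder: "(X has_real_derivative (1/q) * f z / (1 - z)) (at z)" if z: "0 < z" "z < 1" for z
  proof -
    have "(X has_real_derivative ((1/q) * (z / (1 - z)) powr (1/q - 1) * (1 / (1 - z)\<^sup>2))) (at z)"
    proof -
      have "((\<lambda>z. z / (1 - z)) has_real_derivative 1 / (1 - z)\<^sup>2) (at z)"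
        using z by (auto intro!: derivative_eq_intros simp: divide_simps power2_eq_square)
      moreover have "0 < z / (1 - z)" using z by simp
      ultimately show ?thesis
        unfolding X_def using DERIV_fun_powr[of "\<lambda>z. z / (1 - z)" "1 / (1 - z)\<^sup>2" z "1/q"] by simp
    qed
    also have "(1/q) * (z / (1 - z)) powr (1/q - 1) * (1 / (1 - z)\<^sup>2) = (1/q) * f z / (1 - z)"
    proof -
      have 1: "(z / (1 - z)) powr (1/q - 1) = z powr (1/q - 1) / (1 - z) powr (1/q - 1)"
        using z by (simp add: powr_divide)
      have "(1 - z) powr ((1 - 1/q) - 1) * (1 - z) powr (1/q - 1) * (1 - z) powr 1 = 1"
        unfolding powr_add[symmetric] using z by simp
      then have 2: "1 / (1 - z) powr (1/q - 1) = (1 - z) powr ((1 - 1/q) - 1) * (1 - z)"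
        using z by (simp add: nonzero_divide_eq_eq ac_simps)
      have "(z / (1 - z)) powr (1/q - 1) = f z * (1 - z)"
        unfolding 1 f_def using arg_cong[OF 2, of "\<lambda>w. z powr (1/q - 1) * w"] by simp
      then show ?thesis using z by (simp add: power2_eq_square)
    qed
    finally show ?thesis .
  qed
  \<comment> \<open>Measured in the time B/q, X moves at speed 1 / (1 - z), which increases with z;
    from \<open>z0\<close> on the speed is therefore at least 1 + X(z0)^q.\<close>
  have tangent: "X z0 + (B z1 - B z0) / q * (1 + X z0 powr q) \<le> X z1"
    if z: "0 < z0" "z0 < z1" "z1 < 1" for z0 z1
  proof -
    let ?g = "\<lambda>z. X z - B z / q * (1 / (1 - z0))"
    have "?g z0 \<le> ?g z1"
    proof (rule DERIV_nonneg_imp_nondecreasing[where f = ?g])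
      fix x assume x: "z0 \<le> x" "x \<le> z1"
      have "(?g has_real_derivative ((1/q) * f x / (1 - x) - f x / q * (1 / (1 - z0)))) (at x)"
        using Xder[of x] Bder[of x] x z q by (auto intro!: derivative_eq_intros)
      moreover have "f x / q * (1 / (1 - z0)) \<le> f x / q * (1 / (1 - x))"
        using x z q by (intro mult_left_mono) (auto simp: f_def divide_simps)
      ultimately show "\<exists>y. (?g has_real_derivative y) (at x) \<and> y \<ge> 0" by fastforce
    qed (use z in auto)
    moreover have "1 + X z0 powr q = 1 / (1 - z0)" using Xq(1)[of z0] z by (simp add: field_simps)
    ultimately show ?thesis by (simp add: algebra_simps diff_divide_distrib)
  qed
  \<comment> \<open>At time t the remaining time is L - t, and the intermediate value theorem finds
    the z that has it.\<close>
  have "\<exists>z. 0 < z \<and> z < 1 \<and> B z = q * (L - t)" if t: "0 < t" "t < L" for t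
  proof -
    have b1: "B 1 = q * L" using B1 Lval q by (simp add: field_simps)
    have "\<exists>z. 0 \<le> z \<and> z \<le> 1 \<and> B z = q * (L - t)"
      using IVT'[of B 0 "q * (L - t)" 1] t q b1 B0 Bcont by auto
    then obtain z where "0 \<le> z" "z \<le> 1" "B z = q * (L - t)" by auto
    moreover have "z \<noteq> 0" "z \<noteq> 1" using calculation B0 b1 t q by auto
    ultimately show ?thesis by (metis less_eq_real_def)
  qed
  then obtain Z where Z: "0 < Z t" "Z t < 1" "B (Z t) = q * (L - t)" if "0 < t" "t < L" for t
    by metis
  have Bmono: "B u \<le> B v" if "0 < u" "u \<le> v" "v < 1" for u v
  proof (rule DERIV_nonneg_imp_nondecreasing[OF that(2)])
    show "\<exists>D. (B has_real_derivative D) (at x) \<and> 0 \<le> D" if "u \<le> x" "x \<le> v" for x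
      using that \<open>0 < u\<close> \<open>v < 1\<close> by (intro exI[of _ "f x"] conjI Bder) (auto simp: f_def)
  qed
  show ?thesis
  proof (rule that[of "\<lambda>t. X (Z t)"])
    show "X (Z t) > 0" if "0 < t" "t < L" for t using Xq Z that by auto
    fix t h assume h: "0 < h" "h < t" "t < L"
    have *: "0 < t" "0 < t - h" "t - h < L" using h by auto
    note Z1 = Z[OF *(1) h(3)] and Z2 = Z[OF *(2,3)]
    have "q * (L - t) < q * (L - (t - h))" using h q by simp
    then have lt: "Z t < Z (t - h)" using Bmono[of "Z (t - h)" "Z t"] Z1 Z2 by force
    have "(B (Z (t - h)) - B (Z t)) / q = h" using Z1 Z2 q by (simp add: field_simps)
    with tangent[OF Z1(1) lt Z2(2)] show "X (Z (t - h)) \<ge> X (Z t) + h * (1 + X (Z t) powr q)"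
      by simp
  qed
qed

section \<open>Polytopes and their cells\<close>

text \<open>Every frontier point is cut off from \<open>K\<close> by a half-space, and finitely many
  of these suffice because the frontier is compact. The resulting polytope is connected, meets
  \<Omega> and misses its frontier, so it stays inside.\<close>

lemma halfspaces_between:
  fixes K \<Omega> :: "'a::euclidean_space set"
  assumes "open \<Omega>" "bounded \<Omega>" "compact K" "convex K" "K \<noteq> {}" "K \<subseteq> \<Omega>"
  obtains N :: nat and n :: "nat \<Rightarrow> 'a" and b :: "nat \<Rightarrow> real" where
    "0 < N" "\<And>i. i < N \<Longrightarrow> norm (n i) = 1"
    "\<And>i x. i < N \<Longrightarrow> x \<in> K \<Longrightarrow> n i \<bullet> x < b i"
    "{x. \<forall>i<N. n i \<bullet> x \<le> b i} \<subseteq> \<Omega>"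
proof -
  have "\<exists>a c. norm a = 1 \<and> a \<bullet> z > c \<and> (\<forall>x\<in>K. a \<bullet> x < c)" if z: "z \<in> frontier \<Omega>" for z
  proof -
    have "z \<notin> K" using z assms by (auto simp: frontier_def interior_open)
    then obtain a c where a: "a \<bullet> z < c" "\<forall>x\<in>K. a \<bullet> x > c"
      using separating_hyperplane_closed_point[OF assms(4) compact_imp_closed[OF assms(3)]] by blast
    then have "a \<noteq> 0" using assms(5) by force
    then show ?thesis using a
      by (intro exI[of _ "- a /\<^sub>R norm a"] exI[of _ "- c / norm a"]) (auto simp: divide_simps mult.commute)
  qed
  then obtain A c where A: "\<And>z. z \<in> frontier \<Omega> \<Longrightarrow> norm (A z) = 1 \<and> A z \<bullet> z > c z \<and> (\<forall>x\<in>K. A z \<bullet> x < c z)"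
    by metis
  have "compact (frontier \<Omega>)" using assms(2) by (rule compact_frontier_bounded)
  then obtain D where D: "D \<subseteq> frontier \<Omega>" "finite D" "frontier \<Omega> \<subseteq> (\<Union>z\<in>D. {x. A z \<bullet> x > c z})"
  proof (rule compactE_image[of _ "frontier \<Omega>" "\<lambda>z. {x. A z \<bullet> x > c z}"])
    show "open {x. A z \<bullet> x > c z}" for z by (simp add: open_halfspace_gt)
  qed (use A in blast)+
  obtain f where f: "bij_betw f {..<card D} D"
    using ex_bij_betw_nat_finite[OF D(2)] by (auto simp: atLeast0LessThan)
  have fD: "f i \<in> frontier \<Omega>" if "i < card D" for i
    using f that D(1) by (auto simp: bij_betw_def)
  define P where "P = {x. \<forall>i<card D. A (f i) \<bullet> x \<le> c (f i)}"
  have "P = (\<Inter>i\<in>{..<card D}. {x. A (f i) \<bullet> x \<le> c (f i)})" by (auto simp: P_def)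
  then have "convex P" by (auto intro!: convex_INT convex_halfspace_le)
  then have "connected P" by (rule convex_connected)
  moreover have KP: "K \<subseteq> P" using A fD by (auto simp: P_def less_imp_le)
  then have "P \<inter> \<Omega> \<noteq> {}" using assms by auto
  moreover have "P \<inter> frontier \<Omega> = {}"
  proof (rule ccontr)
    assume "P \<inter> frontier \<Omega> \<noteq> {}"
    then obtain x z where "x \<in> P" "z \<in> D" "A z \<bullet> x > c z" using D(3) by blast
    moreover obtain i where "i < card D" "f i = z"
      using f \<open>z \<in> D\<close> by (metis bij_betw_imp_surj_on imageE lessThan_iff)
    ultimately show False unfolding P_def using not_less by blast
  qed
  ultimately have P: "P \<subseteq> \<Omega>" using connected_Int_frontier[of P \<Omega>] by blast
  have "card D \<noteq> 0"
  proof
    assume "card D = 0"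
    then have "P = UNIV" by (simp add: P_def)
    then show False using P assms(2) not_bounded_UNIV bounded_subset by blast
  qed
  show ?thesis
    by (rule that[of "card D" "\<lambda>i. A (f i)" "\<lambda>i. c (f i)"])
      (use A fD P \<open>card D \<noteq> 0\<close> in \<open>auto simp: P_def\<close>)
qed

text \<open>Ties between facets go to the least index, so that the cells partition the space. Moving towards its
  nearest facet never takes a point out of its cell, so a cell consists of segments issuing
  orthogonally from the facet, of length at most the inradius.\<close>

locale polytope_cells =
  fixes N :: nat and n :: "nat \<Rightarrow> 'a::euclidean_space" and b :: "nat \<Rightarrow> real" and \<rho> :: real
  assumes N_pos: "0 < N" and rho_nonneg: "0 \<le> \<rho>"
    and norm_n: "i < N \<Longrightarrow> norm (n i) = 1"
    and ball_le: "\<And>x r. 0 < r \<Longrightarrow> ball x r \<subseteq> {x. \<forall>i<N. n i \<bullet> x \<le> b i} \<Longrightarrow> r \<le> \<rho>"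
begin

definition P :: "'a set" where "P = {x. \<forall>i<N. n i \<bullet> x \<le> b i}"

text \<open>Signed distance to the hyperplane of facet \<open>i\<close>, positive on the inner side,
  since \<open>n i\<close> is a unit vector.\<close>

definition d :: "nat \<Rightarrow> 'a \<Rightarrow> real" where "d i x = b i - n i \<bullet> x"

definition cell :: "nat \<Rightarrow> 'a set" where
  "cell i = {x. \<forall>j<N. d i x < d j x \<or> d i x = d j x \<and> i \<le> j}"

lemma closed_P: "closed P"
proof -
  have "P = (\<Inter>i\<in>{..<N}. {x. n i \<bullet> x \<le> b i})" by (auto simp: P_def)
  then show ?thesis by (auto intro!: closed_INT closed_halfspace_le)
qed

lemma d_measurable [measurable]: "d i \<in> borel_measurable borel"
  unfolding d_def by measurable

lemma cell_measurable [measurable]: "cell i \<in> sets borel"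
  unfolding cell_def by measurable

lemma P_measurable [measurable]: "P \<in> sets borel"
  using closed_P by auto

lemma d_le: "x \<in> cell i \<Longrightarrow> j < N \<Longrightarrow> d i x \<le> d j x"
  by (auto simp: cell_def intro: less_imp_le)

lemma ex1_cell: "\<exists>!i. i < N \<and> x \<in> cell i"
proof -
  define M where "M = Min ((\<lambda>i. d i x) ` {..<N})"
  define i where "i = (LEAST i. i < N \<and> d i x = M)"
  have ne: "(\<lambda>i. d i x) ` {..<N} \<noteq> {}" using N_pos by auto
  have "M \<in> (\<lambda>i. d i x) ` {..<N}" unfolding M_def by (rule Min_in) (use ne in auto)
  then have "\<exists>i. i < N \<and> d i x = M" by auto
  then have i: "i < N \<and> d i x = M" unfolding i_def by (rule LeastI_ex)
  have M: "M \<le> d j x" if "j < N" for j unfolding M_def using that by (intro Min_le) auto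
  have ile: "i \<le> j" if "j < N" "d j x = M" for j unfolding i_def using that by (intro Least_le) auto
  have "d i x < d j x \<or> d i x = d j x \<and> i \<le> j" if "j < N" for j
    using M[OF that] ile[OF that] i by (cases "d j x = M") auto
  then have "i < N \<and> x \<in> cell i" unfolding cell_def using i by blast
  moreover have "i' = i" if "i' < N \<and> x \<in> cell i'" for i'
  proof -
    have "d i x < d i' x \<or> d i x = d i' x \<and> i \<le> i'" "d i' x < d i x \<or> d i' x = d i x \<and> i' \<le> i"
      using that calculation unfolding cell_def by blast+
    then show ?thesis by auto
  qed
  ultimately show ?thesis by blast
qed

lemma sum_cells: "(\<Sum>i<N. indicator (cell i) x * (c::real)) = c"
proof -
  from ex1_cell[of x] obtain i where i: "i < N \<and> x \<in> cell i" "\<forall>j. j < N \<and> x \<in> cell j \<longrightarrow> j = i"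
    by (rule ex1E)
  have "x \<in> cell j \<longleftrightarrow> j = i" if "j \<in> {..<N}" for j
  proof
    assume "x \<in> cell j"
    with i(2) that show "j = i" by (metis lessThan_iff)
  qed (use i(1) in simp)
  then have "(\<Sum>j<N. indicator (cell j) x * c) = (\<Sum>j<N. if j = i then c else 0)"
    by (intro sum.cong) (auto simp: indicator_def)
  then show ?thesis using i(1) by simp
qed

lemma d_shift: "d j (x + h *\<^sub>R v) = d j x - h * (n j \<bullet> v)"
  by (simp add: d_def inner_add_right)

lemma inner_n_le: "i < N \<Longrightarrow> j < N \<Longrightarrow> n j \<bullet> n i \<le> 1"
  using norm_cauchy_schwarz[of "n j" "n i"] norm_n by simp

lemma inner_n_self: "i < N \<Longrightarrow> n i \<bullet> n i = 1"
  using norm_n by (simp add: dot_square_norm)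

lemma d_shift_self: "i < N \<Longrightarrow> d i (x + h *\<^sub>R n i) = d i x - h"
  by (simp add: d_shift inner_n_self)

text \<open>Along \<open>n i\<close> the distance \<open>d i\<close> falls at speed 1 and every
  other \<open>d j\<close> at speed \<open>n j \<bullet> n i\<close>, at most 1, so that facet
  \<open>i\<close> remains the nearest.\<close>

lemma cell_shift:
  assumes "i < N" "x \<in> cell i" "0 \<le> h"
  shows "x + h *\<^sub>R n i \<in> cell i"
  unfolding cell_def
proof (intro CollectI allI impI)
  fix j assume j: "j < N"
  have "h * (n j \<bullet> n i) \<le> h * 1" using inner_n_le assms j by (intro mult_left_mono) auto
  then show "d i (x + h *\<^sub>R n i) < d j (x + h *\<^sub>R n i) \<or> d i (x + h *\<^sub>R n i) = d j (x + h *\<^sub>R n i) \<and> i \<le> j"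
    using assms(2) j unfolding cell_def by (auto simp: d_shift inner_n_self[OF assms(1)])
qed

lemma in_P: 
  assumes "i < N" "x \<in> cell i"
  shows "x \<in> P \<longleftrightarrow> 0 \<le> d i x"
proof -
  have "x \<in> P \<longleftrightarrow> (\<forall>j<N. 0 \<le> d j x)" by (auto simp: P_def d_def)
  also have "\<dots> \<longleftrightarrow> 0 \<le> d i x" using d_le[OF assms(2)] assms(1) order_trans by blast
  finally show ?thesis .
qed

text \<open>Every facet is at least as far away as \<open>d i x\<close>, so the open ball of that
  radius lies in the polytope.\<close>

lemma d_le_inradius:
  assumes "i < N" "x \<in> cell i" "x \<in> P"
  shows "d i x \<le> \<rho>"
proof (cases "d i x > 0")
  case True
  have "ball x (d i x) \<subseteq> {x. \<forall>i<N. n i \<bullet> x \<le> b i}"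
  proof (clarsimp)
    fix y j assume y: "dist x y < d i x" and j: "j < N"
    have "n j \<bullet> (y - x) \<le> norm (n j) * norm (y - x)" by (rule norm_cauchy_schwarz)
    also have "\<dots> < d i x" using y j by (simp add: norm_n dist_norm norm_minus_commute)
    also have "\<dots> \<le> d j x" using d_le assms j by blast
    finally show "n j \<bullet> y \<le> b j" by (simp add: d_def inner_diff_right)
  qed
  with True show ?thesis using ball_le by blast
next
  case False
  then show ?thesis using rho_nonneg by simp
qed

end

section \<open>Integration by shifting\<close>

text \<open>Young's inequality without the conjugate exponent; rearranged, it says that the power
  function lies above its tangent at \<open>x\<close>.\<close>

lemma Young_tangent:
  fixes p x y :: real
  assumes "1 < p" "0 \<le> x" "0 \<le> y"
  shows "p * x powr (p - 1) * y \<le> y powr p + (p - 1) * x powr p"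
proof -
  have 1: "1 / (p / (p - 1)) = (p - 1) / p" "1 / p + (p - 1) / p = 1" "1 < p / (p - 1)"
    using assms by (auto simp: field_simps)
  have "y * x powr (p - 1) \<le> y powr p / p + (x powr (p - 1)) powr (p / (p - 1)) / (p / (p - 1))"
    using assms 1 by (intro Youngs_inequality) auto
  also have "(x powr (p - 1)) powr (p / (p - 1)) = x powr p"
    using assms by (simp add: powr_powr)
  finally show ?thesis using assms by (simp add: field_simps)
qed

lemma powr_tangent:
  fixes p x y :: real
  assumes "1 < p" "0 \<le> x" "0 \<le> y"
  shows "x powr p + p * x powr (p - 1) * (y - x) \<le> y powr p"
proof -
  have "x powr (p - 1) * x = x powr p"
    using assms by (cases "x = 0") (auto simp: powr_diff)
  then show ?thesis using Young_tangent[OF assms] by (simp add: algebra_simps)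
qed

lemma abs_powr_tangent:
  fixes p x y :: real
  assumes "1 < p"
  shows "\<bar>x\<bar> powr p + p * \<bar>x\<bar> powr (p - 1) * sgn x * (y - x) \<le> \<bar>y\<bar> powr p"
proof -
  have "sgn x * (y - x) \<le> \<bar>y\<bar> - \<bar>x\<bar>" by (auto simp: sgn_if)
  then have "p * \<bar>x\<bar> powr (p - 1) * (sgn x * (y - x)) \<le> p * \<bar>x\<bar> powr (p - 1) * (\<bar>y\<bar> - \<bar>x\<bar>)"
    using assms by (intro mult_left_mono) auto
  with powr_tangent[OF assms, of "\<bar>x\<bar>" "\<bar>y\<bar>"] show ?thesis by (simp add: mult.assoc)
qed

lemma integrable_lborel_bounded:
  fixes f :: "'a::euclidean_space \<Rightarrow> real"
  assumes "f \<in> borel_measurable borel" "bounded K" "K \<in> sets borel"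
    and "\<And>x. x \<in> K \<Longrightarrow> \<bar>f x\<bar> \<le> C" "\<And>x. x \<notin> K \<Longrightarrow> f x = 0"
  shows "integrable lborel f"
  using assms emeasure_bounded_finite[OF assms(2)] by (intro integrableI_bounded_set[of K _ f C]) auto

text \<open>This stands in for integration by parts along \<open>v\<close>. A shift does not change
  the integral of \<open>F\<close>, so a lower bound for its difference quotient has integral at
  most 0, and dominated convergence passes to the limit. Because only a lower bound is demanded,
  \<open>F\<close> may jump upwards along \<open>v\<close>, as it does where a line enters a
  cell.\<close>

lemma integral_le_0_by_shift:
  fixes F :: "'a::euclidean_space \<Rightarrow> real"
  assumes F: "integrable lborel F"
    and h: "\<And>m. 0 < h m"
    and D: "\<And>m. D m \<in> borel_measurable borel" "\<And>m x. h m * D m x \<le> F (x + h m *\<^sub>R v) - F x"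
    and W: "integrable lborel W" "\<And>m x. \<bar>D m x\<bar> \<le> W x"
    and lim: "\<And>x. (\<lambda>m. D m x) \<longlonglongrightarrow> L x"
  shows "integrable lborel L" "integral\<^sup>L lborel L \<le> 0"
proof -
  have Lm: "L \<in> borel_measurable borel"
    by (rule borel_measurable_LIMSEQ_real[OF lim D(1)])
  show "integrable lborel L"
    by (rule integrable_dominated_convergence[where s = D and w = W]) (use Lm D W lim in auto)
  have Dint: "integrable lborel (D m)" for m
    by (rule Bochner_Integration.integrable_bound[OF W(1)])
      (use D W(2) order_trans[OF W(2) abs_ge_self] in auto)
  have shift: "integrable lborel (\<lambda>x. F (x + c)) \<and> (\<integral>x. F (x + c) \<partial>lborel) = (\<integral>x. F x \<partial>lborel)" for c
  proof -
    have F': "integrable (distr lborel borel ((+) c)) F" using F by (simp add: lborel_distr_plus)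
    have m: "(+) c \<in> lborel \<rightarrow>\<^sub>M borel" by simp
    have Fm: "F \<in> borel_measurable borel" using F by auto
    have "integrable lborel (\<lambda>x. F (c + x))" by (rule integrable_distr[OF m F'])
    moreover have "(\<integral>x. F (c + x) \<partial>lborel) = integral\<^sup>L (distr lborel borel ((+) c)) F"
      using Fm by (subst integral_distr) auto
    ultimately show ?thesis by (simp add: lborel_distr_plus add.commute)
  qed
  have "(\<integral>x. D m x \<partial>lborel) \<le> 0" for m
  proof -
    have "(\<integral>x. h m * D m x \<partial>lborel) \<le> (\<integral>x. F (x + h m *\<^sub>R v) - F x \<partial>lborel)"
      using shift F Dint D(2) by (intro integral_mono) auto
    also have "\<dots> = 0" using shift F by simp
    finally show ?thesis using h[of m] by (simp add: mult_le_0_iff)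
  qed
  moreover have "(\<lambda>m. \<integral>x. D m x \<partial>lborel) \<longlonglongrightarrow> integral\<^sup>L lborel L"
    by (rule integral_dominated_convergence[where w = W]) (use Lm D W lim in auto)
  ultimately show "integral\<^sup>L lborel L \<le> 0" by (intro LIMSEQ_le_const2) auto
qed

text \<open>\<open>K\<close> is any compact set around the support: the closed support itself serves
  for the completion, a convex enclosure for the cells.\<close>

locale C1_compact_support =
  fixes \<phi> :: "'a::euclidean_space \<Rightarrow> real" and g :: "'a \<Rightarrow> 'a" and K :: "'a set"
  assumes deriv: "\<And>x. GDERIV \<phi> x :> g x" and cont_g: "continuous_on UNIV g"
    and compact_K: "compact K" and zero: "\<And>x. x \<notin> K \<Longrightarrow> \<phi> x = 0" "\<And>x. x \<notin> K \<Longrightarrow> g x = 0"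
begin

lemma cont: "continuous_on UNIV \<phi>"
  using deriv unfolding gderiv_def
  by (auto intro!: continuous_at_imp_continuous_on has_derivative_continuous)

lemma measurable [measurable]: "\<phi> \<in> borel_measurable borel" "g \<in> borel_measurable borel"
  using cont cont_g by (auto intro: borel_measurable_continuous_onI)

lemma K_borel [measurable]: "K \<in> sets borel"
  using compact_K by (auto simp: compact_imp_closed)

lemma bounded_by_constant:
  fixes f :: "'a \<Rightarrow> 'b::euclidean_space"
  assumes "continuous_on UNIV f" "\<And>x. x \<notin> K \<Longrightarrow> f x = 0"
  obtains M where "0 \<le> M" "\<And>x. norm (f x) \<le> M"
proof -
  have "bounded (f ` K)"
    using assms(1) compact_K by (intro compact_imp_bounded compact_continuous_image) (auto intro: continuous_on_subset)
  then obtain M where "0 < M" "\<And>x. x \<in> K \<Longrightarrow> norm (f x) \<le> M" by (auto simp: bounded_pos)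
  then show ?thesis using assms(2) by (intro that[of M]) (metis less_imp_le norm_zero)+
qed

lemma Lipschitz:
  assumes "\<And>x. norm (g x) \<le> M"
  shows "\<bar>\<phi> x - \<phi> y\<bar> \<le> M * norm (x - y)"
proof -
  have "norm (\<phi> x - \<phi> y) \<le> M * norm (x - y)"
  proof (rule differentiable_bound[of UNIV])
    show "(\<phi> has_derivative (\<lambda>h. h \<bullet> g z)) (at z within UNIV)" for z
      using deriv[of z] by (simp add: gderiv_def)
    show "onorm (\<lambda>h. h \<bullet> g z) \<le> M" for z
    proof (rule onorm_le)
      fix h show "norm (h \<bullet> g z) \<le> M * norm h"
        using Cauchy_Schwarz_ineq2[of h "g z"] mult_left_mono[OF assms[of z] norm_ge_zero[of h]]
        by (simp add: mult.commute)
    qed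
  qed auto
  then show ?thesis by simp
qed

lemma directional_quotient:
  assumes "h \<longlonglongrightarrow> 0" "\<And>m. h m \<noteq> 0"
  shows "(\<lambda>m. (\<phi> (x + h m *\<^sub>R v) - \<phi> x) / h m) \<longlonglongrightarrow> g x \<bullet> v"
proof -
  have "((\<lambda>t. \<phi> (x + t *\<^sub>R v)) has_derivative (\<lambda>t. (t *\<^sub>R v) \<bullet> g x)) (at 0)"
  proof (rule has_derivative_compose[of "\<lambda>t. x + t *\<^sub>R v" "\<lambda>t. t *\<^sub>R v" 0 UNIV \<phi>])
    show "((\<lambda>t. x + t *\<^sub>R v) has_derivative (\<lambda>t. t *\<^sub>R v)) (at 0)"
      by (auto intro!: derivative_eq_intros)
    show "(\<phi> has_derivative (\<lambda>t. t \<bullet> g x)) (at (x + 0 *\<^sub>R v))"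
      using deriv[of x] by (simp add: gderiv_def)
  qed
  then have "((\<lambda>t. \<phi> (x + t *\<^sub>R v)) has_real_derivative (g x \<bullet> v)) (at 0)"
    by (rule has_derivative_imp_has_field_derivative) (simp add: inner_commute)
  then have "((\<lambda>t. (\<phi> (x + t *\<^sub>R v) - \<phi> x) / t) \<longlongrightarrow> g x \<bullet> v) (at 0)"
    by (simp add: DERIV_def)
  moreover have "filterlim h (at 0) sequentially"
    using assms by (simp add: filterlim_at)
  ultimately show ?thesis by (rule filterlim_compose)
qed

lemma integrable_cutoff:
  fixes f :: "'a \<Rightarrow> real"
  assumes "f \<in> borel_measurable borel" "\<And>x. x \<in> K \<Longrightarrow> \<bar>f x\<bar> \<le> C" "\<And>x. x \<notin> K \<Longrightarrow> f x = 0"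
  shows "integrable lborel f"
  by (rule integrable_lborel_bounded[OF assms(1) compact_imp_bounded[OF compact_K] K_borel assms(2,3)])

lemma integrable_indicator_powr:
  assumes [measurable]: "A \<in> sets borel" and "0 < p"
  shows "integrable lborel (\<lambda>x. indicator A x * norm (g x) powr p)"
    "integrable lborel (\<lambda>x. indicator A x * \<bar>\<phi> x\<bar> powr p)"
    "integrable lborel (\<lambda>x. indicator A x * \<bar>\<phi> x\<bar>)"
proof -
  obtain M where M: "0 \<le> M" "\<And>x. norm (g x) \<le> M" using bounded_by_constant[OF cont_g zero(2)] by auto
  obtain M' where M': "0 \<le> M'" "\<And>x. norm (\<phi> x) \<le> M'" using bounded_by_constant[OF cont zero(1)] by auto
  show "integrable lborel (\<lambda>x. indicator A x * norm (g x) powr p)"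
    using M assms(2) zero by (intro integrable_cutoff[where C = "M powr p"])
      (auto simp: indicator_def intro: powr_mono2)
  show "integrable lborel (\<lambda>x. indicator A x * \<bar>\<phi> x\<bar> powr p)"
    using M' assms(2) zero by (intro integrable_cutoff[where C = "M' powr p"])
      (auto simp: indicator_def intro: powr_mono2)
  show "integrable lborel (\<lambda>x. indicator A x * \<bar>\<phi> x\<bar>)"
    using M' assms(2) zero by (intro integrable_cutoff[where C = M']) (auto simp: indicator_def)
qed

lemma integrable_powr:
  assumes "0 < p"
  shows "integrable lborel (\<lambda>x. norm (g x) powr p)" "integrable lborel (\<lambda>x. \<bar>\<phi> x\<bar> powr p)"
    "integrable lborel (\<lambda>x. \<bar>\<phi> x\<bar>)"
  using integrable_indicator_powr[of UNIV p] assms by auto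

end

section \<open>The eigenvalue from below\<close>

text \<open>\<open>a\<close> plays the role of the logarithmic derivative of the one-dimensional
  eigenfunction to the power p - 1. Its differential equation is recorded as an inequality over
  finite steps \<open>h\<close>, valid by convexity of the solution, because this is the form that
  the shifting argument consumes.\<close>

lemma Riccati_supersolution:
  fixes p \<rho> \<Lambda> :: real
  assumes p: "1 < p" and \<Lambda>: "0 < \<Lambda>" and \<rho>: "0 \<le> \<rho>" and small: "\<Lambda> powr (1 / p) * \<rho> < pi_p p / 2"
  obtains a :: "real \<Rightarrow> real" where
    "\<And>t. 0 \<le> a t"
    "\<And>t h. 0 < h \<Longrightarrow> h < t \<Longrightarrow> t \<le> \<rho> \<Longrightarrow> a t + h * (\<Lambda> + (p - 1) * a t powr (p / (p - 1))) \<le> a (t - h)"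
    "\<And>s t. 0 < s \<Longrightarrow> s \<le> t \<Longrightarrow> t \<le> \<rho> \<Longrightarrow> a t \<le> a s"
    "a \<in> borel_measurable borel"
proof -
  define q where "q = p / (p - 1)"
  define L where "L = (pi / q) / sin (pi / q)"
  have q: "1 < q" using p by (simp add: q_def field_simps)
  obtain y where y: "\<And>t. 0 < t \<Longrightarrow> t < L \<Longrightarrow> y t > 0"
    "\<And>t h. 0 < h \<Longrightarrow> h < t \<Longrightarrow> t < L \<Longrightarrow> y (t - h) \<ge> y t + h * (1 + y t powr q)"
    using Riccati_solution[OF q] unfolding L_def by blast
  \<comment> \<open>With \<alpha>^q = \<Lambda> / (p - 1) and \<alpha> \<gamma> = \<Lambda>, the
    function \<alpha> y(\<gamma> t) turns y' = -(1 + y^q) into a' = -(\<Lambda> + (p - 1)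
    a^q).\<close>
  define \<alpha> where "\<alpha> = (\<Lambda> / (p - 1)) powr (1 / q)"
  define \<gamma> where "\<gamma> = \<Lambda> / \<alpha>"
  have \<alpha>: "0 < \<alpha>" "\<alpha> powr q = \<Lambda> / (p - 1)" using p \<Lambda> q by (auto simp: \<alpha>_def powr_powr)
  have \<gamma>: "0 < \<gamma>" using \<alpha> \<Lambda> by (simp add: \<gamma>_def)
  \<comment> \<open>As 1/p + 1/q = 1, sin(\<pi>/q) = sin(\<pi>/p), and \<open>L\<close> is
    \<open>pi_p p / 2\<close> times (p - 1)^(1 - 1/p). The same power of p - 1 relates \<gamma> to
    \<Lambda>^(1/p), so this is the hypothesis \<open>small\<close>.\<close>
  have \<gamma>\<rho>: "\<gamma> * \<rho> < L"
  proof -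
    have iq: "1 / q = 1 - 1 / p" using p by (simp add: q_def field_simps)
    have sin: "sin (pi / q) = sin (pi / p)"
    proof -
      have "pi / q = pi - pi / p" using iq by (metis mult.right_neutral right_diff_distrib times_divide_eq_right)
      then show ?thesis by simp
    qed
    have spos: "0 < sin (pi / p)" using p by (intro sin_gt_zero) (auto simp: divide_less_eq)
    have "\<gamma> = \<Lambda> powr (1 / p) * (p - 1) powr (1 - 1 / p)"
    proof -
      have "\<alpha> = \<Lambda> powr (1 - 1/p) / (p - 1) powr (1 - 1/p)"
        using p \<Lambda> by (simp add: \<alpha>_def iq powr_divide)
      then have "\<Lambda> powr (1 - 1/p) = \<alpha> * (p - 1) powr (1 - 1/p)" using p by (simp add: nonzero_eq_divide_eq)
      moreover have "\<Lambda> = \<Lambda> powr (1/p) * \<Lambda> powr (1 - 1/p)" using \<Lambda> by (simp flip: powr_add)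
      ultimately have "\<Lambda> = \<Lambda> powr (1/p) * (\<alpha> * (p - 1) powr (1 - 1/p))" by metis
      then have "\<Lambda> / \<alpha> = \<Lambda> powr (1/p) * (\<alpha> * (p - 1) powr (1 - 1/p)) / \<alpha>" by (rule arg_cong)
      then show ?thesis using \<alpha> by (simp add: \<gamma>_def)
    qed
    then have "\<gamma> * \<rho> = (\<Lambda> powr (1 / p) * \<rho>) * (p - 1) powr (1 - 1 / p)" by simp
    also have "\<dots> < pi_p p / 2 * (p - 1) powr (1 - 1 / p)"
      using small p by (intro mult_strict_right_mono) auto
    also have "\<dots> = pi * ((p - 1) powr (1 / p) * (p - 1) powr (1 - 1 / p)) / (p * sin (pi / p))"
      by (simp add: pi_p_def)
    also have "(p - 1) powr (1 / p) * (p - 1) powr (1 - 1 / p) = p - 1"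
      using p by (simp flip: powr_add)
    also have "pi * (p - 1) / (p * sin (pi / p)) = L"
      using p spos unfolding L_def sin by (simp add: q_def)
    finally show ?thesis .
  qed
  \<comment> \<open>The cells only produce distances in (0, \<rho>]; the value 0 elsewhere keeps
    \<open>a\<close> nonnegative everywhere.\<close>
  define a where "a = (\<lambda>t. if 0 < t \<and> t \<le> \<rho> then \<alpha> * y (\<gamma> * t) else 0)"
  have in_dom: "0 < \<gamma> * t \<and> \<gamma> * t < L" if "0 < t" "t \<le> \<rho>" for t
  proof -
    have "\<gamma> * t \<le> \<gamma> * \<rho>" using that \<gamma> by (intro mult_left_mono) auto
    then have "\<gamma> * t < L" using \<gamma>\<rho> by (rule le_less_trans)
    with that \<gamma> show ?thesis by simp
  qed
  have a0: "0 \<le> a t" for t using y(1) in_dom \<alpha> by (auto simp: a_def less_imp_le)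
  have a1: "a t + h * (\<Lambda> + (p - 1) * a t powr q) \<le> a (t - h)" if "0 < h" "h < t" "t \<le> \<rho>" for t h
  proof -
    have t: "0 < t" "0 < t - h" "t - h \<le> \<rho>" using that by auto
    have "y (\<gamma> * t) + \<gamma> * h * (1 + y (\<gamma> * t) powr q) \<le> y (\<gamma> * t - \<gamma> * h)"
      using that t \<gamma> in_dom[of t] by (intro y(2)) auto
    then have "\<alpha> * (y (\<gamma> * t) + \<gamma> * h * (1 + y (\<gamma> * t) powr q)) \<le> \<alpha> * y (\<gamma> * (t - h))"
      using \<alpha> unfolding right_diff_distrib by (intro mult_left_mono) auto
    moreover have "\<alpha> * \<gamma> = \<Lambda>" using \<alpha> by (simp add: \<gamma>_def)
    moreover have "(p - 1) * (\<alpha> * y (\<gamma> * t)) powr q = \<Lambda> * y (\<gamma> * t) powr q"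
      using \<alpha> p y(1) in_dom[of t] t that by (simp add: powr_mult less_imp_le)
    moreover have "\<alpha> * (y (\<gamma> * t) + \<gamma> * h * (1 + y (\<gamma> * t) powr q)) =
        \<alpha> * y (\<gamma> * t) + h * (\<alpha> * \<gamma> + (\<alpha> * \<gamma>) * y (\<gamma> * t) powr q)" by (simp add: algebra_simps)
    ultimately show ?thesis using t that by (simp add: a_def)
  qed
  have mono: "a t \<le> a s" if "0 < s" "s \<le> t" "t \<le> \<rho>" for s t
  proof (cases "s = t")
    case False
    have "0 \<le> (t - s) * (\<Lambda> + (p - 1) * a t powr q)" using that \<Lambda> p by simp
    with a1[of "t - s" t] False that show ?thesis by simp
  qed simp
  \<comment> \<open>Borel measurability comes from the monotonicity of \<open>a\<close> on (0,
    \<rho>].\<close>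
  have "mono_on {0<..\<rho>} (\<lambda>t. - a t)" using mono by (auto simp: mono_on_def)
  then have "(\<lambda>t. - a t) \<in> borel_measurable (restrict_space borel {0<..\<rho>})"
    by (rule borel_measurable_mono_on_fnc)
  then have "(\<lambda>t. indicator {0<..\<rho>} t *\<^sub>R (- a t)) \<in> borel_measurable borel"
    by (subst (asm) borel_measurable_restrict_space_iff) auto
  then have "(\<lambda>t. - (indicator {0<..\<rho>} t *\<^sub>R (- a t))) \<in> borel_measurable borel"
    by (rule borel_measurable_uminus)
  also have "(\<lambda>t. - (indicator {0<..\<rho>} t *\<^sub>R (- a t))) = a"
    by (auto simp: a_def indicator_def fun_eq_iff)
  finally have "a \<in> borel_measurable borel" .
  then show ?thesis using that[of a] a0 a1 mono unfolding q_def by blast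
qed

text \<open>The inequality in \<open>K_inside\<close> is strict because the weight of
  \<open>Riccati_supersolution\<close> is not controlled near distance 0: the compact
  \<open>K\<close> then keeps a positive distance from all facets.\<close>

locale cells_function = polytope_cells N n b \<rho> + C1_compact_support \<phi> g K
  for N :: nat and n :: "nat \<Rightarrow> 'a::euclidean_space" and b :: "nat \<Rightarrow> real" and \<rho> :: real
  and \<phi> :: "'a \<Rightarrow> real" and g :: "'a \<Rightarrow> 'a" and K :: "'a set" +
  assumes K_inside: "i < N \<Longrightarrow> x \<in> K \<Longrightarrow> n i \<bullet> x < b i"
begin

lemma gap:
  obtains c where "0 < c" "\<And>i x. i < N \<Longrightarrow> x \<in> K \<Longrightarrow> c \<le> d i x"
proof -
  have "\<exists>c>0. \<forall>x\<in>K. c \<le> d i x" if i: "i < N" for i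
  proof (cases "K = {}")
    case False
    have "continuous_on K (d i)" unfolding d_def[abs_def] by (intro continuous_intros)
    then obtain x where x: "x \<in> K" "\<forall>y\<in>K. d i x \<le> d i y"
      using continuous_attains_inf[OF compact_K False] by blast
    then show ?thesis using K_inside[OF i x(1)] by (intro exI[of _ "d i x"]) (auto simp: d_def)
  qed (auto intro: exI[of _ 1])
  then obtain c where c: "\<And>i. i < N \<Longrightarrow> 0 < c i \<and> (\<forall>x\<in>K. c i \<le> d i x)" by metis
  have ne: "c ` {..<N} \<noteq> {}" using N_pos by auto
  have "0 < Min (c ` {..<N})" using c ne by (subst Min_gr_iff) auto
  moreover have "Min (c ` {..<N}) \<le> d i x" if "i < N" "x \<in> K" for i x
    using c[OF that(1)] that by (intro order_trans[OF Min_le]) auto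
  ultimately show ?thesis by (rule that)
qed

lemma K_subset_P: "x \<in> K \<Longrightarrow> x \<in> P"
  using K_inside by (auto simp: P_def less_imp_le)

text \<open>Picone's argument: a(d) |\<phi>|^p is shifted towards the facet. The limit
  \<open>L\<close> of the lower bounds for its difference quotients has integral at most 0, and
  Young's inequality bounds \<open>L\<close> from below by \<Lambda> |\<phi>|^p - |\<nabla>\<phi>|^p
  on the cell.\<close>

lemma cell_eigenvalue_bound:
  assumes p: "1 < p" and \<Lambda>: "0 < \<Lambda>" and small: "\<Lambda> powr (1 / p) * \<rho> < pi_p p / 2" and i: "i < N"
  shows "\<Lambda> * (\<integral>x. indicator (cell i) x * \<bar>\<phi> x\<bar> powr p \<partial>lborel)
    \<le> (\<integral>x. indicator (cell i) x * norm (g x) powr p \<partial>lborel)"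
proof -
  define q where "q = p / (p - 1)"
  have q: "1 < q" using p by (simp add: q_def field_simps)
  obtain a where a: "\<And>t. 0 \<le> a t"
    "\<And>t h. 0 < h \<Longrightarrow> h < t \<Longrightarrow> t \<le> \<rho> \<Longrightarrow> a t + h * (\<Lambda> + (p - 1) * a t powr q) \<le> a (t - h)"
    "\<And>s t. 0 < s \<Longrightarrow> s \<le> t \<Longrightarrow> t \<le> \<rho> \<Longrightarrow> a t \<le> a s"
    and [measurable]: "a \<in> borel_measurable borel"
    using Riccati_supersolution[OF p \<Lambda> rho_nonneg small] unfolding q_def by metis
  obtain c where c: "0 < c" "\<And>i x. i < N \<Longrightarrow> x \<in> K \<Longrightarrow> c \<le> d i x" using gap by blast
  obtain M where M: "0 \<le> M" "\<And>x. norm (g x) \<le> M" using bounded_by_constant[OF cont_g zero(2)] by auto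
  obtain M' where M': "0 \<le> M'" "\<And>x. norm (\<phi> x) \<le> M'" using bounded_by_constant[OF cont zero(1)] by auto
  have ni: "norm (n i) = 1" using norm_n i .
  define A where "A = cell i \<inter> K"
  have A[measurable]: "A \<in> sets borel" unfolding A_def by simp
  have dA: "c \<le> d i x" "d i x \<le> \<rho>" "a (d i x) \<le> a c" if "x \<in> A" for x
    using that c i d_le_inradius K_subset_P a(3) by (auto simp: A_def)
  \<comment> \<open>Steps shorter than the gap \<open>c\<close> carry no point of \<open>A\<close>
    across the facet.\<close>
  define h where "h = (\<lambda>m. c / real (m + 2))"
  have h: "0 < h m" "h m < c" for m using c(1) by (auto simp: h_def divide_less_eq)
  have h0: "h \<longlonglongrightarrow> 0"
    unfolding h_def by (rule LIMSEQ_ignore_initial_segment[OF lim_const_over_n])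
  define \<kappa> where "\<kappa> = (\<lambda>t. \<Lambda> + (p - 1) * a t powr q)"
  have \<kappa>[measurable]: "\<kappa> \<in> borel_measurable borel" unfolding \<kappa>_def by measurable
  have \<kappa>0: "0 \<le> \<kappa> t" for t using \<Lambda> p by (simp add: \<kappa>_def)
  define F where "F = (\<lambda>x. indicator (cell i \<inter> P) x * (a (d i x) * \<bar>\<phi> x\<bar> powr p))"
  define \<Delta> where "\<Delta> = (\<lambda>m x. (\<phi> (x + h m *\<^sub>R n i) - \<phi> x) / h m)"
  define B where "B = (\<lambda>x. p * \<bar>\<phi> x\<bar> powr (p - 1) * sgn (\<phi> x))"
  define D where "D = (\<lambda>m x. indicator A x * (\<kappa> (d i x) * \<bar>\<phi> (x + h m *\<^sub>R n i)\<bar> powr p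
      + a (d i x) * (B x * \<Delta> m x)))"
  define L where "L = (\<lambda>x. indicator A x * (\<kappa> (d i x) * \<bar>\<phi> x\<bar> powr p + a (d i x) * (B x * (g x \<bullet> n i))))"
  have \<phi>K: "\<phi> x = 0" if "x \<in> cell i" "x \<notin> A" for x using that zero by (auto simp: A_def)
  define C where "C = (\<Lambda> + (p - 1) * a c powr q) * M' powr p + a c * (p * M' powr (p - 1) * M)"
  have \<Delta>: "\<bar>\<Delta> m x\<bar> \<le> M" for m x
    using Lipschitz[OF M(2), of "x + h m *\<^sub>R n i" x] h(1)[of m] ni
    by (simp add: \<Delta>_def divide_le_eq mult.commute)
  have B: "\<bar>B x\<bar> \<le> p * M' powr (p - 1)" for x
    using p M'(2)[of x] by (auto simp: B_def abs_mult sgn_if intro!: powr_mono2)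
  have Dle: "h m * D m x \<le> F (x + h m *\<^sub>R n i) - F x" for m x
  proof (cases "x \<in> A")
    case True
    let ?x = "x + h m *\<^sub>R n i"
    have xc: "x \<in> cell i" using True by (simp add: A_def)
    have dx: "d i ?x = d i x - h m" using d_shift_self i by simp
    have "?x \<in> cell i" using cell_shift[OF i xc] h(1)[of m] by simp
    moreover have "?x \<in> P" using in_P[OF i \<open>?x \<in> cell i\<close>] dx dA(1)[OF True] h(2)[of m] by simp
    ultimately have Fx: "F ?x = a (d i x - h m) * \<bar>\<phi> ?x\<bar> powr p" using dx by (simp add: F_def)
    \<comment> \<open>The increment of the product is split: the weight changes with \<phi> taken at
      the shifted point, and |\<phi>|^p changes with the weight taken at \<open>x\<close>.\<close>
    have "a (d i x) + h m * \<kappa> (d i x) \<le> a (d i x - h m)"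
      unfolding \<kappa>_def using dA[OF True] h[of m] by (intro a(2)) auto
    then have "(a (d i x) + h m * \<kappa> (d i x)) * \<bar>\<phi> ?x\<bar> powr p \<le> F ?x"
      unfolding Fx by (intro mult_right_mono) auto
    moreover have "a (d i x) * (\<bar>\<phi> x\<bar> powr p + B x * (\<phi> ?x - \<phi> x)) \<le> a (d i x) * \<bar>\<phi> ?x\<bar> powr p"
      unfolding B_def by (intro mult_left_mono abs_powr_tangent p a(1))
    moreover have "F x = a (d i x) * \<bar>\<phi> x\<bar> powr p"
      using True K_subset_P by (simp add: F_def A_def)
    moreover have "h m * D m x = h m * \<kappa> (d i x) * \<bar>\<phi> ?x\<bar> powr p + a (d i x) * (B x * (\<phi> ?x - \<phi> x))"
      using True h(1)[of m] by (simp add: D_def \<Delta>_def field_simps)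
    ultimately show ?thesis by (simp add: algebra_simps)
  next
    \<comment> \<open>Here \<open>F\<close> vanishes at \<open>x\<close>, and after the shift it
      only has to be nonnegative: a line that enters the cell at the far end of a segment produces a
      jump of the right sign.\<close>
    case False
    then have "F x = 0" using \<phi>K by (auto simp: F_def indicator_def)
    moreover have "0 \<le> F (x + h m *\<^sub>R n i)" using a(1) by (simp add: F_def)
    ultimately show ?thesis using False by (simp add: D_def)
  qed
  have "integral\<^sup>L lborel L \<le> 0" and Lint: "integrable lborel L"
  proof -
    have 1: "integrable lborel F"
    proof (rule integrable_cutoff)
      show "F \<in> borel_measurable borel" unfolding F_def by measurable
      show "\<bar>F x\<bar> \<le> a c * M' powr p" if "x \<in> K" for x
      proof (cases "x \<in> cell i")
        case True
        then have "a (d i x) * \<bar>\<phi> x\<bar> powr p \<le> a c * M' powr p"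
          using dA that M' a(1) p by (intro mult_mono powr_mono2) (auto simp: A_def)
        then show ?thesis using a(1) M' by (auto simp: F_def indicator_def)
      qed (use a(1) M' in \<open>simp add: F_def\<close>)
    qed (use zero in \<open>simp add: F_def\<close>)
    have 2: "D m \<in> borel_measurable borel" for m unfolding D_def \<Delta>_def B_def by measurable
    have 3: "integrable lborel (\<lambda>x. indicator A x * C)"
      by (rule integrable_cutoff[where C = "\<bar>C\<bar>"]) (auto simp: A_def indicator_def)
    have 4: "\<bar>D m x\<bar> \<le> indicator A x * C" for m x
    proof (cases "x \<in> A")
      case True
      have "\<kappa> (d i x) \<le> \<Lambda> + (p - 1) * a c powr q"
        unfolding \<kappa>_def using dA[OF True] a(1) p q by (intro add_left_mono mult_left_mono powr_mono2) auto
      then have "\<bar>\<kappa> (d i x) * \<bar>\<phi> (x + h m *\<^sub>R n i)\<bar> powr p\<bar> \<le> (\<Lambda> + (p - 1) * a c powr q) * M' powr p"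
        using \<kappa>0[of "d i x"] M' p by (auto simp: abs_mult intro!: mult_mono powr_mono2)
      moreover have "\<bar>a (d i x) * (B x * \<Delta> m x)\<bar> \<le> a c * (p * M' powr (p - 1) * M)"
        unfolding abs_mult using dA(3)[OF True] a(1) B[of x] \<Delta>[of m x] p
        by (intro mult_mono) auto
      ultimately show ?thesis using True unfolding D_def C_def by simp
    qed (simp add: D_def)
    have 5: "(\<lambda>m. D m x) \<longlonglongrightarrow> L x" for x
    proof -
      have "(\<lambda>m. x + h m *\<^sub>R n i) \<longlonglongrightarrow> x + 0 *\<^sub>R n i" by (intro tendsto_intros h0)
      then have "(\<lambda>m. \<phi> (x + h m *\<^sub>R n i)) \<longlonglongrightarrow> \<phi> x"
        using cont continuous_on_tendsto_compose[of UNIV \<phi> "\<lambda>m. x + h m *\<^sub>R n i" x sequentially] by simp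
      then have "(\<lambda>m. \<bar>\<phi> (x + h m *\<^sub>R n i)\<bar> powr p) \<longlonglongrightarrow> \<bar>\<phi> x\<bar> powr p"
        using p by (intro tendsto_powr' tendsto_rabs tendsto_const) auto
      moreover have "(\<lambda>m. \<Delta> m x) \<longlonglongrightarrow> g x \<bullet> n i"
        unfolding \<Delta>_def by (rule directional_quotient[OF h0]) (use h(1) less_imp_neq in metis)
      ultimately show ?thesis unfolding D_def L_def by (intro tendsto_mult tendsto_add tendsto_const)
    qed
    show "integral\<^sup>L lborel L \<le> 0" "integrable lborel L"
      using integral_le_0_by_shift[OF 1 h(1) 2 Dle 3 4 5] by auto
  qed
  have i1: "integrable lborel (\<lambda>x. indicator (cell i) x * \<bar>\<phi> x\<bar> powr p)"
    and i2: "integrable lborel (\<lambda>x. indicator (cell i) x * norm (g x) powr p)"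
    using p by (auto intro!: integrable_indicator_powr)
  have "(\<integral>x. \<Lambda> * (indicator (cell i) x * \<bar>\<phi> x\<bar> powr p) - indicator (cell i) x * norm (g x) powr p \<partial>lborel)
      \<le> integral\<^sup>L lborel L"
  proof (rule integral_mono)
    show "integrable lborel (\<lambda>x. \<Lambda> * (indicator (cell i) x * \<bar>\<phi> x\<bar> powr p) - indicator (cell i) x * norm (g x) powr p)"
      using i1 i2 by auto
    show "\<Lambda> * (indicator (cell i) x * \<bar>\<phi> x\<bar> powr p) - indicator (cell i) x * norm (g x) powr p \<le> L x" for x
    proof (cases "x \<in> A")
      case True
      \<comment> \<open>Since q / p = 1 / (p - 1), this choice gives z^(p-1) = a |\<phi>|^(p-1) and
        z^p = a^q |\<phi>|^p, the two terms that Young's inequality has to match.\<close>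
      define z where "z = a (d i x) powr (q / p) * \<bar>\<phi> x\<bar>"
      have z1: "z powr (p - 1) = a (d i x) * \<bar>\<phi> x\<bar> powr (p - 1)"
        using p a(1)[of "d i x"] by (simp add: z_def powr_mult powr_powr q_def)
      have z2: "z powr p = a (d i x) powr q * \<bar>\<phi> x\<bar> powr p"
        using p a(1)[of "d i x"] by (simp add: z_def powr_mult powr_powr)
      have "\<bar>a (d i x) * (B x * (g x \<bullet> n i))\<bar> \<le> p * z powr (p - 1) * norm (g x)"
      proof -
        have "\<bar>a (d i x) * B x\<bar> \<le> p * z powr (p - 1)"
          using a(1)[of "d i x"] p unfolding z1 B_def by (auto simp: abs_mult sgn_if)
        moreover have "\<bar>g x \<bullet> n i\<bar> \<le> norm (g x)" using Cauchy_Schwarz_ineq2[of "g x" "n i"] ni by simp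
        ultimately show ?thesis
          unfolding mult.assoc[symmetric] abs_mult[of "a (d i x) * B x"] using p by (intro mult_mono) auto
      qed
      moreover have "p * z powr (p - 1) * norm (g x) \<le> norm (g x) powr p + (p - 1) * z powr p"
        by (rule Young_tangent[OF p]) (auto simp: z_def)
      ultimately have "- (a (d i x) * (B x * (g x \<bullet> n i))) \<le> norm (g x) powr p + (p - 1) * (a (d i x) powr q * \<bar>\<phi> x\<bar> powr p)"
        unfolding z2 by linarith
      then show ?thesis using True by (simp add: L_def \<kappa>_def A_def algebra_simps)
    next
      case False
      then show ?thesis using \<phi>K p by (auto simp: L_def indicator_def)
    qed
  qed (rule Lint)
  also note \<open>integral\<^sup>L lborel L \<le> 0\<close>
  finally show ?thesis using i1 i2 by simp
qed

lemma eigenvalue_bound: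
  assumes p: "1 < p" and \<Lambda>: "0 < \<Lambda>" and small: "\<Lambda> powr (1 / p) * \<rho> < pi_p p / 2"
  shows "\<Lambda> * (\<integral>x. \<bar>\<phi> x\<bar> powr p \<partial>lborel) \<le> (\<integral>x. norm (g x) powr p \<partial>lborel)"
proof -
  have "\<Lambda> * (\<integral>x. \<bar>\<phi> x\<bar> powr p \<partial>lborel) = \<Lambda> * (\<integral>x. (\<Sum>i<N. indicator (cell i) x * \<bar>\<phi> x\<bar> powr p) \<partial>lborel)"
    by (simp add: sum_cells)
  also have "\<dots> = (\<Sum>i<N. \<Lambda> * (\<integral>x. indicator (cell i) x * \<bar>\<phi> x\<bar> powr p \<partial>lborel))"
    using p by (subst Bochner_Integration.integral_sum) (auto simp: sum_distrib_left intro!: integrable_indicator_powr)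
  also have "\<dots> \<le> (\<Sum>i<N. (\<integral>x. indicator (cell i) x * norm (g x) powr p \<partial>lborel))"
    using assms by (intro sum_mono cell_eigenvalue_bound) auto
  also have "\<dots> = (\<integral>x. (\<Sum>i<N. indicator (cell i) x * norm (g x) powr p) \<partial>lborel)"
    using p by (subst Bochner_Integration.integral_sum) (auto intro!: integrable_indicator_powr)
  finally show ?thesis by (simp add: sum_cells)
qed

end

section \<open>The torsional rigidity from above\<close>

context polytope_cells
begin

text \<open>How far one can back away from the facet inside the cell; the supremum
  \<open>depth\<close> is the distance from \<open>x\<close> to the far end of its segment. Backing
  away increases \<open>d i\<close>, so it never leaves the polytope.\<close>

definition cell_depths :: "nat \<Rightarrow> 'a \<Rightarrow> real set" where
  "cell_depths i x = {s. 0 \<le> s \<and> x - s *\<^sub>R n i \<in> cell i}"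

definition depth :: "nat \<Rightarrow> 'a \<Rightarrow> real" where
  "depth i x = (if x \<in> cell i \<inter> P then Sup (cell_depths i x) else 0)"

lemma cell_depths_le:
  assumes i: "i < N" and x: "x \<in> cell i" "x \<in> P" and s: "s \<in> cell_depths i x"
  shows "d i x + s \<le> \<rho>"
proof -
  let ?y = "x - s *\<^sub>R n i"
  have y: "?y \<in> cell i" "0 \<le> s" using s by (auto simp: cell_depths_def)
  have dy: "d i ?y = d i x + s" using d_shift_self[OF i, of x "- s"] by simp
  have "?y \<in> P" using in_P[OF i y(1)] in_P[OF i x(1)] x(2) y(2) dy by simp
  then show ?thesis using d_le_inradius[OF i y(1)] dy by simp
qed

lemma cell_depths_bdd: "i < N \<Longrightarrow> x \<in> cell i \<Longrightarrow> x \<in> P \<Longrightarrow> bdd_above (cell_depths i x)"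
  using cell_depths_le[of i x] by (intro bdd_aboveI[of _ "\<rho> - d i x"]) (simp add: algebra_simps)

lemma cell_depths_le_depth:
  "i < N \<Longrightarrow> x \<in> cell i \<Longrightarrow> x \<in> P \<Longrightarrow> s \<in> cell_depths i x \<Longrightarrow> s \<le> depth i x"
  by (simp add: depth_def cSup_upper cell_depths_bdd)

lemma zero_in_cell_depths: "x \<in> cell i \<Longrightarrow> 0 \<in> cell_depths i x"
  by (simp add: cell_depths_def)

lemma depth_le:
  "x \<in> cell i \<Longrightarrow> x \<in> P \<Longrightarrow> (\<And>s. s \<in> cell_depths i x \<Longrightarrow> s \<le> c) \<Longrightarrow> depth i x \<le> c"
  using zero_in_cell_depths[of x i] by (auto simp: depth_def intro!: cSup_least)

lemma depth_nonneg: "i < N \<Longrightarrow> 0 \<le> depth i x"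
  using cell_depths_le_depth[of i x 0] zero_in_cell_depths[of x i] by (cases "x \<in> cell i \<inter> P") (auto simp: depth_def)

lemma depth_outside: "x \<notin> cell i \<inter> P \<Longrightarrow> depth i x = 0"
  unfolding depth_def by (rule if_not_P)

text \<open>\<open>d i x + depth i x\<close> is the length of the whole segment through
  \<open>x\<close>, and no point of the segment is farther than \<rho> from the facet.\<close>

lemma depth_sum_le: "i < N \<Longrightarrow> x \<in> cell i \<Longrightarrow> x \<in> P \<Longrightarrow> d i x + depth i x \<le> \<rho>"
  using depth_le[of x i "\<rho> - d i x"] cell_depths_le[of i x] by (simp add: algebra_simps)

lemma depth_le_inradius: "i < N \<Longrightarrow> depth i x \<le> \<rho>"
  using depth_sum_le[of i x] in_P[of i x] rho_nonneg by (cases "x \<in> cell i \<inter> P") (auto simp: depth_outside)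

lemma depth_shift:
  assumes i: "i < N" and x: "x \<in> cell i" "x \<in> P" and h: "0 \<le> h" and y: "x - h *\<^sub>R n i \<in> cell i"
  shows "x - h *\<^sub>R n i \<in> P" "depth i (x - h *\<^sub>R n i) = depth i x - h"
proof -
  let ?y = "x - h *\<^sub>R n i"
  have dy: "d i ?y = d i x + h" using d_shift_self[OF i, of x "- h"] by simp
  show yP: "?y \<in> P" using in_P[OF i y] in_P[OF i x(1)] x(2) h dy by simp
  have 1: "s + h \<in> cell_depths i x" if "s \<in> cell_depths i ?y" for s
    using that h by (auto simp: cell_depths_def algebra_simps)
  have "depth i ?y \<le> depth i x - h"
    using 1 cell_depths_le_depth[OF i x] by (intro depth_le y yP) (auto simp: le_diff_eq)
  moreover have "depth i x \<le> depth i ?y + h"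
  proof (rule depth_le[OF x])
    fix s assume s: "s \<in> cell_depths i x"
    show "s \<le> depth i ?y + h"
    proof (cases "h \<le> s")
      case True
      then have "s - h \<in> cell_depths i ?y" using s by (auto simp: cell_depths_def algebra_simps)
      then show ?thesis using cell_depths_le_depth[OF i y yP] by force
    qed (use depth_nonneg[OF i, of ?y] in simp)
  qed
  ultimately show "depth i ?y = depth i x - h" by simp
qed

lemma depth_measurable [measurable]:
  assumes i: "i < N"
  shows "depth i \<in> borel_measurable borel"
  unfolding borel_measurable_iff_greater
proof (intro allI)
  fix c :: real
  show "{w \<in> space borel. c < depth i w} \<in> sets borel"
  proof (cases "c < 0")
    case True
    then have "{w \<in> space borel. c < depth i w} = UNIV"
      using depth_nonneg[OF i] by (auto intro: less_le_trans)
    then show ?thesis by simp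
  next
    case False
    have "{w \<in> space borel. c < depth i w} = (\<Union>s\<in>\<rat> \<inter> {c<..}. {x \<in> cell i \<inter> P. x - s *\<^sub>R n i \<in> cell i})"
    proof (intro equalityI subsetI)
      fix x assume "x \<in> {w \<in> space borel. c < depth i w}"
      then have cx: "c < depth i x" by simp
      then have x: "x \<in> cell i" "x \<in> P" using False depth_outside[of x i] by auto
      obtain s where s: "s \<in> cell_depths i x" "c < s"
        using depth_le[OF x, of c] cx by fastforce
      obtain r where r: "r \<in> \<rat>" "c < r" "r < s" using Rats_dense_in_real[OF s(2)] by auto
      have "x - s *\<^sub>R n i + (s - r) *\<^sub>R n i \<in> cell i"
        using s r i by (intro cell_shift) (auto simp: cell_depths_def)
      then have "x - r *\<^sub>R n i \<in> cell i" by (simp add: algebra_simps)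
      then show "x \<in> (\<Union>s\<in>\<rat> \<inter> {c<..}. {x \<in> cell i \<inter> P. x - s *\<^sub>R n i \<in> cell i})"
        using r x by auto
    next
      fix x assume "x \<in> (\<Union>s\<in>\<rat> \<inter> {c<..}. {x \<in> cell i \<inter> P. x - s *\<^sub>R n i \<in> cell i})"
      then obtain s where s: "c < s" "x \<in> cell i" "x \<in> P" "x - s *\<^sub>R n i \<in> cell i" by auto
      then have "s \<le> depth i x"
        using False by (intro cell_depths_le_depth[OF i]) (auto simp: cell_depths_def)
      then show "x \<in> {w \<in> space borel. c < depth i w}" using s by simp
    qed
    moreover have "countable (\<rat> \<inter> {c<..})" using countable_rat by (rule countable_Int1)
    moreover have "{x \<in> cell i \<inter> P. x - s *\<^sub>R n i \<in> cell i} \<in> sets borel" for s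
    proof -
      have "(\<lambda>x. x - s *\<^sub>R n i) -` cell i \<inter> space borel \<in> sets borel"
        by (intro measurable_sets[of _ borel borel]) simp_all
      then have "(cell i \<inter> P) \<inter> ((\<lambda>x. x - s *\<^sub>R n i) -` cell i \<inter> space borel) \<in> sets borel"
        by (intro sets.Int) simp_all
      moreover have "(cell i \<inter> P) \<inter> ((\<lambda>x. x - s *\<^sub>R n i) -` cell i \<inter> space borel)
          = {x \<in> cell i \<inter> P. x - s *\<^sub>R n i \<in> cell i}" by auto
      ultimately show ?thesis by simp
    qed
    ultimately show ?thesis by (metis (no_types, lifting) sets.countable_UN'')
  qed
qed

text \<open>On a segment of length \<open>l\<close>, the average of \<open>depth\<^sup>q\<close> is \<open>l\<^sup>q / (q + 1)\<close>; averaging is replaced by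
  shifting the function \<open>depth (l\<^sup>q - depth\<^sup>q)\<close>, which vanishes at both ends of the segment.\<close>

lemma integral_depth_powr:
  assumes q: "0 < q" and i: "i < N" and bnd: "bounded P"
  shows "(q + 1) * (\<integral>x. depth i x powr q \<partial>lborel) \<le> \<rho> powr q * measure lborel (cell i \<inter> P)"
proof -
  define S where "S = cell i \<inter> P"
  have S[measurable]: "S \<in> sets borel" unfolding S_def by simp
  have Sb: "bounded S" using bnd unfolding S_def by (rule bounded_subset) auto
  note [measurable] = depth_measurable[OF i]
  \<comment> \<open>The length of the segment through \<open>x\<close>, constant along it.\<close>
  define G where "G = (\<lambda>x. d i x + depth i x)"
  have [measurable]: "G \<in> borel_measurable borel" unfolding G_def by measurable
  have dS: "0 \<le> depth i x" "depth i x \<le> G x" "G x \<le> \<rho>" "0 \<le> G x" if "x \<in> S" for x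
    using that depth_nonneg[OF i, of x] depth_sum_le[OF i] in_P[OF i] by (auto simp: G_def S_def)
  define F where "F = (\<lambda>x. indicator S x * (depth i x * (G x powr q - depth i x powr q)))"
  define h where "h = (\<lambda>m. 1 / real (m + 1))"
  have h: "0 < h m" for m by (auto simp: h_def)
  have h0: "h \<longlonglongrightarrow> 0"
    unfolding h_def by (rule LIMSEQ_ignore_initial_segment[OF lim_const_over_n])
  \<comment> \<open>The cut at 0 is for points closer than \<open>h m\<close> to the far end: the
    shift takes them out of the cell, and \<open>D\<close> becomes -G^q.\<close>
  define D where "D = (\<lambda>m x. indicator S x * ((q + 1) * max 0 (depth i x - h m) powr q - G x powr q))"
  define L where "L = (\<lambda>x. indicator S x * ((q + 1) * depth i x powr q - G x powr q))"
  have F0: "0 \<le> F x" for x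
    using dS q by (cases "x \<in> S") (auto simp: F_def intro!: mult_nonneg_nonneg powr_mono2)
  have split: "t * t powr q = t powr (q + 1)" if "0 \<le> t" for t :: real
    using that q by (cases "t = 0") (auto simp: powr_add)
  have 1: "integrable lborel F"
  proof (rule integrable_lborel_bounded[OF _ Sb S])
    show "F \<in> borel_measurable borel" unfolding F_def by measurable
    show "\<bar>F x\<bar> \<le> \<rho> * \<rho> powr q" if "x \<in> S" for x
    proof -
      have "G x powr q \<le> \<rho> powr q" using dS[OF that] q by (intro powr_mono2) auto
      then have "G x powr q - depth i x powr q \<le> \<rho> powr q"
        using powr_ge_zero[of "depth i x" q] by linarith
      moreover have "0 \<le> G x powr q - depth i x powr q" using dS[OF that] q by (auto intro: powr_mono2)
      ultimately have "depth i x * (G x powr q - depth i x powr q) \<le> \<rho> * \<rho> powr q"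
        using dS[OF that] by (intro mult_mono) auto
      then show ?thesis using F0[of x] that by (simp add: F_def)
    qed
  qed (simp add: F_def)
  have 2: "D m \<in> borel_measurable borel" for m unfolding D_def by measurable
  have 3: "h m * D m x \<le> F (x + h m *\<^sub>R (- n i)) - F x" for m x
  proof (cases "x \<in> S")
    case True
    then have x: "x \<in> cell i" "x \<in> P" by (auto simp: S_def)
    let ?y = "x - h m *\<^sub>R n i"
    show ?thesis
    proof (cases "?y \<in> cell i")
      case y: True
      note sh = depth_shift[OF i x less_imp_le[OF h] y]
      have Gy: "G ?y = G x" using sh(2) d_shift_self[OF i, of x "- h m"] by (simp add: G_def)
      define t where "t = depth i x - h m"
      have t: "0 \<le> t" "depth i x = t + h m" using depth_nonneg[OF i, of ?y] sh(2) by (auto simp: t_def)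
      \<comment> \<open>The power t^(q+1) is convex, and its tangent at the shifted depth yields the
        factor q + 1.\<close>
      have "t powr (q + 1) + (q + 1) * t powr q * h m \<le> (t + h m) powr (q + 1)"
        using powr_tangent[of "q + 1" t "t + h m"] q t h[of m] by simp
      moreover have "F ?y = t * G x powr q - t powr (q + 1)"
        using y sh Gy t by (simp add: F_def S_def t_def[symmetric] right_diff_distrib split)
      moreover have "F x = (t + h m) * G x powr q - (t + h m) powr (q + 1)"
        using True t h[of m] by (simp add: F_def right_diff_distrib split)
      moreover have "h m * D m x = (q + 1) * t powr q * h m - h m * G x powr q"
        using True t by (simp add: D_def right_diff_distrib)
      ultimately show ?thesis by (simp add: distrib_right)
    next
      case y: False
      have "depth i x \<le> h m"
      proof (rule depth_le[OF x])
        fix s assume s: "s \<in> cell_depths i x"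
        show "s \<le> h m"
        proof (rule ccontr)
          assume "\<not> s \<le> h m"
          then have "x - s *\<^sub>R n i + (s - h m) *\<^sub>R n i \<in> cell i"
            using s i by (intro cell_shift) (auto simp: cell_depths_def)
          then show False using y by (simp add: algebra_simps)
        qed
      qed
      then have "depth i x * (G x powr q - depth i x powr q) \<le> h m * G x powr q"
        using dS[OF True] q h[of m] by (intro mult_mono) (auto intro: powr_mono2)
      then have "F x \<le> h m * G x powr q" using True by (simp add: F_def)
      moreover have "D m x = - (G x powr q)" using True \<open>depth i x \<le> h m\<close> by (simp add: D_def)
      ultimately show ?thesis using F0[of "x + h m *\<^sub>R (- n i)"] by simp
    qed
  next
    case False
    then show ?thesis using F0[of "x + h m *\<^sub>R (- n i)"] by (simp add: D_def F_def)
  qed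
  have W: "integrable lborel (\<lambda>x. indicator S x * ((q + 2) * \<rho> powr q))"
    using q by (intro integrable_lborel_bounded[OF _ Sb S, where C = "(q + 2) * \<rho> powr q"]) auto
  have bd: "\<bar>D m x\<bar> \<le> indicator S x * ((q + 2) * \<rho> powr q)" for m x
  proof (cases "x \<in> S")
    case True
    have "max 0 (depth i x - h m) powr q \<le> \<rho> powr q" "G x powr q \<le> \<rho> powr q"
      using dS[OF True] q h[of m] by (auto intro!: powr_mono2)
    then have "(q + 1) * max 0 (depth i x - h m) powr q \<le> (q + 1) * \<rho> powr q" "G x powr q \<le> \<rho> powr q"
      using q by auto
    moreover have "0 \<le> (q + 1) * max 0 (depth i x - h m) powr q" "0 \<le> G x powr q" using q by auto
    moreover have "(q + 2) * \<rho> powr q = (q + 1) * \<rho> powr q + \<rho> powr q" by (simp add: algebra_simps)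
    ultimately have "\<bar>(q + 1) * max 0 (depth i x - h m) powr q - G x powr q\<bar> \<le> (q + 2) * \<rho> powr q" by linarith
    then show ?thesis using True by (simp add: D_def)
  qed (simp add: D_def)
  have lim: "(\<lambda>m. D m x) \<longlonglongrightarrow> L x" for x
  proof -
    have "(\<lambda>m. max 0 (depth i x - h m)) \<longlonglongrightarrow> max 0 (depth i x - 0)" by (intro tendsto_intros h0)
    then have "(\<lambda>m. max 0 (depth i x - h m) powr q) \<longlonglongrightarrow> max 0 (depth i x - 0) powr q"
      using q by (intro tendsto_powr') auto
    then show ?thesis unfolding D_def L_def using depth_nonneg[OF i, of x]
      by (intro tendsto_mult tendsto_diff tendsto_const) auto
  qed
  note res = integral_le_0_by_shift[OF 1 h 2 3 W bd lim]
  have i1: "integrable lborel (\<lambda>x. depth i x powr q)"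
    using depth_nonneg[OF i] depth_le_inradius[OF i] q
    by (intro integrable_lborel_bounded[OF _ Sb S, where C = "\<rho> powr q"])
      (auto simp: S_def depth_outside intro!: powr_mono2)
  have i2: "integrable lborel (\<lambda>x. indicator S x * \<rho> powr q)"
    using q by (intro integrable_lborel_bounded[OF _ Sb S, where C = "\<rho> powr q"]) auto
  have "(\<integral>x. (q + 1) * depth i x powr q - indicator S x * \<rho> powr q \<partial>lborel) \<le> integral\<^sup>L lborel L"
  proof (rule integral_mono)
    show "(q + 1) * depth i x powr q - indicator S x * \<rho> powr q \<le> L x" for x
    proof (cases "x \<in> S")
      case True
      then have "G x powr q \<le> \<rho> powr q" using dS q by (auto intro!: powr_mono2)
      with True show ?thesis by (simp add: L_def)
    qed (use depth_outside[of x i] in \<open>simp add: L_def S_def\<close>)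
  qed (use i1 i2 res in auto)
  also note res(2)
  finally have "(q + 1) * (\<integral>x. depth i x powr q \<partial>lborel) \<le> (\<integral>x. indicator S x * \<rho> powr q \<partial>lborel)"
    using i1 i2 by simp
  then show ?thesis by (simp add: S_def mult.commute)
qed

end

context cells_function
begin

text \<open>On a segment, |\<phi>| at \<open>x\<close> is at most the integral of |\<nabla>\<phi>|
  between the facet and \<open>x\<close>. A point is counted for all \<open>x\<close> behind it,
  that is, for a length \<open>depth\<close>, which becomes its weight. In the shifting form,
  \<open>depth\<close> grows at unit speed towards the facet, near which \<phi> is 0.\<close>

lemma cell_torsion_bound:
  assumes i: "i < N"
  shows "(\<integral>x. indicator (cell i) x * \<bar>\<phi> x\<bar> \<partial>lborel) \<le> (\<integral>x. depth i x * norm (g x) \<partial>lborel)"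
proof -
  obtain c where c: "0 < c" "\<And>i x. i < N \<Longrightarrow> x \<in> K \<Longrightarrow> c \<le> d i x" using gap by blast
  obtain M where M: "0 \<le> M" "\<And>x. norm (g x) \<le> M" using bounded_by_constant[OF cont_g zero(2)] by auto
  obtain M' where M': "0 \<le> M'" "\<And>x. norm (\<phi> x) \<le> M'" using bounded_by_constant[OF cont zero(1)] by auto
  note [measurable] = depth_measurable[OF i]
  have ni: "norm (n i) = 1" using norm_n i .
  define A where "A = cell i \<inter> K"
  have A[measurable]: "A \<in> sets borel" unfolding A_def by simp
  have len: "0 \<le> depth i x" "depth i x \<le> \<rho>" for x
    using depth_nonneg depth_le_inradius i by auto
  define h where "h = (\<lambda>m. c / real (m + 2))"
  have h: "0 < h m" "h m < c" for m using c(1) by (auto simp: h_def divide_less_eq)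
  have h0: "h \<longlonglongrightarrow> 0"
    unfolding h_def by (rule LIMSEQ_ignore_initial_segment[OF lim_const_over_n])
  define F where "F = (\<lambda>x. depth i x * \<bar>\<phi> x\<bar>)"
  define \<Delta> where "\<Delta> = (\<lambda>m x. (\<phi> (x + h m *\<^sub>R n i) - \<phi> x) / h m)"
  define D where "D = (\<lambda>m x. indicator A x * (sgn (\<phi> x) * \<phi> (x + h m *\<^sub>R n i)
      + depth i x * (sgn (\<phi> x) * \<Delta> m x)))"
  define L where "L = (\<lambda>x. indicator A x * (\<bar>\<phi> x\<bar> + depth i x * (sgn (\<phi> x) * (g x \<bullet> n i))))"
  have \<Delta>: "\<bar>\<Delta> m x\<bar> \<le> M" for m x
    using Lipschitz[OF M(2), of "x + h m *\<^sub>R n i" x] h(1)[of m] ni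
    by (simp add: \<Delta>_def divide_le_eq mult.commute)
  have sgn: "sgn t * u \<le> \<bar>u\<bar>" "\<bar>sgn t * u\<bar> \<le> \<bar>u\<bar>" for t u :: real by (auto simp: sgn_if)
  have Dle: "h m * D m x \<le> F (x + h m *\<^sub>R n i) - F x" for m x
  proof (cases "x \<in> A")
    case True
    let ?x = "x + h m *\<^sub>R n i"
    have xc: "x \<in> cell i" "x \<in> K" using True by (auto simp: A_def)
    have dx: "d i ?x = d i x - h m" using d_shift_self i by simp
    have xc': "?x \<in> cell i" using cell_shift[OF i xc(1)] h(1)[of m] by simp
    have "?x \<in> P" using in_P[OF i xc'] dx c(2)[OF i xc(2)] h(2)[of m] by simp
    then have l: "depth i ?x = depth i x + h m"
      using depth_shift(2)[OF i xc', of "h m"] xc h(1)[of m] by simp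
    have "(depth i x + h m) * (sgn (\<phi> x) * \<phi> ?x) \<le> F ?x"
      unfolding F_def l using len(1)[of x] h(1)[of m] sgn by (intro mult_left_mono) auto
    moreover have "F x = depth i x * (sgn (\<phi> x) * \<phi> x)" by (simp add: F_def abs_sgn mult.commute)
    moreover have "h m * D m x = h m * (sgn (\<phi> x) * \<phi> ?x) + depth i x * (sgn (\<phi> x) * (\<phi> ?x - \<phi> x))"
      using True h(1)[of m] by (simp add: D_def \<Delta>_def field_simps)
    ultimately show ?thesis by (simp add: algebra_simps)
  next
    case False
    then have "F x = 0" using zero(1)[of x] depth_outside[of x i] by (auto simp: F_def A_def)
    moreover have "0 \<le> F (x + h m *\<^sub>R n i)" using len by (simp add: F_def)
    ultimately show ?thesis using False by (simp add: D_def)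
  qed
  have 1: "integrable lborel F"
  proof (rule integrable_cutoff)
    show "F \<in> borel_measurable borel" unfolding F_def by measurable
    show "\<bar>F x\<bar> \<le> \<rho> * M'" if "x \<in> K" for x
      using len M' rho_nonneg unfolding F_def abs_mult by (intro mult_mono) auto
  qed (use zero in \<open>simp add: F_def\<close>)
  have 2: "D m \<in> borel_measurable borel" for m unfolding D_def \<Delta>_def by measurable
  have 3: "integrable lborel (\<lambda>x. indicator A x * (M' + \<rho> * M))"
    by (rule integrable_cutoff[where C = "\<bar>M' + \<rho> * M\<bar>"]) (auto simp: A_def indicator_def)
  have 4: "\<bar>D m x\<bar> \<le> indicator A x * (M' + \<rho> * M)" for m x
  proof (cases "x \<in> A")
    case True
    have "\<bar>sgn (\<phi> x) * \<phi> (x + h m *\<^sub>R n i)\<bar> \<le> M'"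
      using order_trans[OF sgn(2) M'(2)[unfolded real_norm_def]] .
    moreover have "\<bar>depth i x * (sgn (\<phi> x) * \<Delta> m x)\<bar> \<le> \<rho> * M"
      using len order_trans[OF sgn(2) \<Delta>] rho_nonneg unfolding abs_mult[of "depth i x"] by (intro mult_mono) auto
    ultimately show ?thesis using True unfolding D_def by simp
  qed (simp add: D_def)
  have 5: "(\<lambda>m. D m x) \<longlonglongrightarrow> L x" for x
  proof -
    have "(\<lambda>m. x + h m *\<^sub>R n i) \<longlonglongrightarrow> x + 0 *\<^sub>R n i" by (intro tendsto_intros h0)
    then have "(\<lambda>m. \<phi> (x + h m *\<^sub>R n i)) \<longlonglongrightarrow> \<phi> x"
      using cont continuous_on_tendsto_compose[of UNIV \<phi> "\<lambda>m. x + h m *\<^sub>R n i" x sequentially] by simp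
    moreover have "(\<lambda>m. \<Delta> m x) \<longlonglongrightarrow> g x \<bullet> n i"
      unfolding \<Delta>_def by (rule directional_quotient[OF h0]) (use h(1) less_imp_neq in metis)
    ultimately show ?thesis unfolding D_def L_def abs_sgn[of "\<phi> x"] mult.commute[of "\<phi> x"]
      by (intro tendsto_mult tendsto_add tendsto_const)
  qed
  note res = integral_le_0_by_shift[OF 1 h(1) 2 Dle 3 4 5]
  have i1: "integrable lborel (\<lambda>x. indicator (cell i) x * \<bar>\<phi> x\<bar>)"
    by (intro integrable_indicator_powr(3)[where p = 1]) auto
  have i2: "integrable lborel (\<lambda>x. depth i x * norm (g x))"
  proof (rule integrable_cutoff)
    show "\<bar>depth i x * norm (g x)\<bar> \<le> \<rho> * M" for x
      using len M rho_nonneg unfolding abs_mult by (intro mult_mono) auto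
  qed (use zero in auto)
  have "(\<integral>x. indicator (cell i) x * \<bar>\<phi> x\<bar> - depth i x * norm (g x) \<partial>lborel) \<le> integral\<^sup>L lborel L"
  proof (rule integral_mono)
    show "indicator (cell i) x * \<bar>\<phi> x\<bar> - depth i x * norm (g x) \<le> L x" for x
    proof (cases "x \<in> A")
      case True
      have "\<bar>g x \<bullet> n i\<bar> \<le> norm (g x)" using Cauchy_Schwarz_ineq2[of "g x" "n i"] ni by simp
      then have "- (sgn (\<phi> x) * (g x \<bullet> n i)) \<le> norm (g x)" using sgn(2)[of "\<phi> x" "g x \<bullet> n i"] by linarith
      then have "depth i x * (- (sgn (\<phi> x) * (g x \<bullet> n i))) \<le> depth i x * norm (g x)"
        using len by (intro mult_left_mono) auto
      then show ?thesis using True by (simp add: L_def A_def)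
    next
      case False
      then show ?thesis using zero[of x] len by (auto simp: L_def A_def)
    qed
  qed (use i1 i2 res in auto)
  also note res(2)
  finally show ?thesis using i1 i2 by simp
qed

text \<open>Hoelder's inequality for \<open>depth\<close> and |\<nabla>\<phi>| in Young's form. With
  one common \<open>t\<close> it is additive, so the cells can be summed before \<open>t\<close> is
  optimised.\<close>

lemma torsion_bound_Young:
  assumes p: "1 < p" and t: "0 < t" and bnd: "bounded P"
  defines "q \<equiv> p / (p - 1)"
  shows "p * (\<integral>x. \<bar>\<phi> x\<bar> \<partial>lborel) \<le> t * (\<integral>x. norm (g x) powr p \<partial>lborel)
     + (p - 1) * (1 / t) powr (q / p) * (\<rho> powr q * measure lborel P / (q + 1))"
proof -
  have q: "1 < q" using p by (simp add: q_def field_simps)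
  define \<tau> where "\<tau> = (1 / t) powr (q / p)"
  obtain M where M: "0 \<le> M" "\<And>x. norm (g x) \<le> M" using bounded_by_constant[OF cont_g zero(2)] by auto
  have PS: "integrable lborel (indicator P :: 'a \<Rightarrow> real)"
    using bnd by (intro integrable_real_indicator) (auto simp: emeasure_bounded_finite[unfolded infinity_ennreal_def])
  have cellle: "p * (\<integral>x. indicator (cell i) x * \<bar>\<phi> x\<bar> \<partial>lborel)
      \<le> t * (\<integral>x. indicator (cell i) x * norm (g x) powr p \<partial>lborel)
        + (p - 1) * \<tau> * (\<rho> powr q * measure lborel (cell i \<inter> P) / (q + 1))" if i: "i < N" for i
  proof -
    note [measurable] = depth_measurable[OF i]
    have len: "0 \<le> depth i x" "depth i x \<le> \<rho>" for x
      using depth_nonneg depth_le_inradius i by auto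
    have i1: "integrable lborel (\<lambda>x. indicator (cell i) x * norm (g x) powr p)"
      using p by (intro integrable_indicator_powr) auto
    have i2: "integrable lborel (\<lambda>x. depth i x powr q)"
      using len q by (intro integrable_lborel_bounded[OF _ bnd P_measurable, where C = "\<rho> powr q"])
        (auto simp: depth_outside intro!: powr_mono2)
    have i3: "integrable lborel (\<lambda>x. depth i x * norm (g x))"
    proof (rule integrable_cutoff)
      show "\<bar>depth i x * norm (g x)\<bar> \<le> \<rho> * M" for x
        using len M rho_nonneg unfolding abs_mult by (intro mult_mono) auto
    qed (use zero in auto)
    have "p * (\<integral>x. indicator (cell i) x * \<bar>\<phi> x\<bar> \<partial>lborel) \<le> p * (\<integral>x. depth i x * norm (g x) \<partial>lborel)"
      using cell_torsion_bound[OF i] p by simp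
    also have "\<dots> = (\<integral>x. p * (depth i x * norm (g x)) \<partial>lborel)" by simp
    also have "\<dots> \<le> (\<integral>x. t * (indicator (cell i) x * norm (g x) powr p) + (p - 1) * \<tau> * depth i x powr q \<partial>lborel)"
    proof (rule integral_mono)
      fix x
      show "p * (depth i x * norm (g x)) \<le> t * (indicator (cell i) x * norm (g x) powr p) + (p - 1) * \<tau> * depth i x powr q"
      proof (cases "x \<in> cell i")
        case True
        \<comment> \<open>The scales are chosen so that w^(p-1) u is \<open>depth i x\<close> times
          |\<nabla>\<phi>|, while u^p carries the factor \<open>t\<close> and w^p the factor
          \<tau>.\<close>
        define u where "u = t powr (1 / p) * norm (g x)"
        define w where "w = (t powr (- 1 / p) * depth i x) powr (1 / (p - 1))"
        have w: "w powr (p - 1) = t powr (- 1 / p) * depth i x"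
          using p len by (simp add: w_def powr_powr)
        have "w powr p = (t powr (- 1 / p) * depth i x) powr q"
          using p by (simp add: w_def powr_powr q_def)
        also have "\<dots> = \<tau> * depth i x powr q"
          using len t by (simp add: \<tau>_def powr_mult powr_powr powr_minus_divide powr_divide)
        finally have w': "w powr p = \<tau> * depth i x powr q" .
        have u: "u powr p = t * norm (g x) powr p" using t p by (simp add: u_def powr_mult powr_powr)
        have "t powr (- 1 / p) * t powr (1 / p) = 1" using t by (simp flip: powr_add)
        then have "p * (depth i x * norm (g x)) = p * w powr (p - 1) * u"
          unfolding w u_def by (simp add: ac_simps)
        also have "\<dots> \<le> u powr p + (p - 1) * w powr p"
          by (rule Young_tangent[OF p]) (auto simp: w_def u_def)
        finally show ?thesis using True u w' by simp
      qed (use p t in \<open>simp add: depth_outside \<tau>_def\<close>)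
    qed (use i1 i2 i3 in auto)
    also have "\<dots> = t * (\<integral>x. indicator (cell i) x * norm (g x) powr p \<partial>lborel)
        + (p - 1) * \<tau> * (\<integral>x. depth i x powr q \<partial>lborel)" using i1 i2 by simp
    also have "(\<integral>x. depth i x powr q \<partial>lborel) \<le> \<rho> powr q * measure lborel (cell i \<inter> P) / (q + 1)"
      using integral_depth_powr[OF _ i bnd, of q] q by (simp add: field_simps)
    finally show ?thesis using p t by (simp add: \<tau>_def mult_left_mono)
  qed
  have "p * (\<integral>x. \<bar>\<phi> x\<bar> \<partial>lborel) = p * (\<integral>x. (\<Sum>i<N. indicator (cell i) x * \<bar>\<phi> x\<bar>) \<partial>lborel)"
    by (simp add: sum_cells)
  also have "\<dots> = (\<Sum>i<N. p * (\<integral>x. indicator (cell i) x * \<bar>\<phi> x\<bar> \<partial>lborel))"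
    by (subst Bochner_Integration.integral_sum)
      (auto simp: sum_distrib_left intro!: integrable_indicator_powr(3)[where p = 1])
  also have "\<dots> \<le> (\<Sum>i<N. t * (\<integral>x. indicator (cell i) x * norm (g x) powr p \<partial>lborel)
        + (p - 1) * \<tau> * (\<rho> powr q * measure lborel (cell i \<inter> P) / (q + 1)))"
    by (intro sum_mono cellle) auto
  also have "\<dots> = t * (\<Sum>i<N. \<integral>x. indicator (cell i) x * norm (g x) powr p \<partial>lborel)
       + (p - 1) * \<tau> * (\<rho> powr q * (\<Sum>i<N. measure lborel (cell i \<inter> P)) / (q + 1))"
    by (simp add: sum.distrib sum_distrib_left sum_divide_distrib)
  also have "(\<Sum>i<N. \<integral>x. indicator (cell i) x * norm (g x) powr p \<partial>lborel)
      = (\<integral>x. (\<Sum>i<N. indicator (cell i) x * norm (g x) powr p) \<partial>lborel)"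
    using p by (subst Bochner_Integration.integral_sum) (auto intro!: integrable_indicator_powr)
  also have "\<dots> = (\<integral>x. norm (g x) powr p \<partial>lborel)" by (simp add: sum_cells)
  also have "(\<Sum>i<N. measure lborel (cell i \<inter> P)) = (\<Sum>i<N. \<integral>x. indicator (cell i) x * indicator P x \<partial>lborel)"
    by (simp flip: indicator_inter_arith)
  also have "\<dots> = (\<integral>x. (\<Sum>i<N. indicator (cell i) x * indicator P x) \<partial>lborel)"
    using PS by (subst Bochner_Integration.integral_sum) (auto intro: integrable_mult_indicator[where 'b = real, simplified])
  also have "\<dots> = measure lborel P" by (simp add: sum_cells)
  finally show ?thesis unfolding \<tau>_def .
qed

end

section \<open>The torsional rigidity from below\<close>

lemma lborel_integral_affine:
  fixes f :: "'a::euclidean_space \<Rightarrow> real"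
  assumes [measurable]: "f \<in> borel_measurable borel" and c: "c \<noteq> 0"
  shows "(\<integral>x. f x \<partial>lborel) = \<bar>c\<bar> ^ DIM('a) * (\<integral>x. f (t + c *\<^sub>R x) \<partial>lborel)"
proof -
  have "(\<integral>x. f x \<partial>lborel) = (\<integral>x. f x \<partial>(density (distr lborel borel (\<lambda>x. t + c *\<^sub>R x)) (\<lambda>_. \<bar>c\<bar> ^ DIM('a))))"
    using lborel_affine[OF c, of t] by metis
  also have "\<dots> = (\<integral>x. \<bar>c\<bar> ^ DIM('a) *\<^sub>R f x \<partial>(distr lborel borel (\<lambda>x. t + c *\<^sub>R x)))"
    by (subst integral_density) auto
  also have "\<dots> = (\<integral>x. \<bar>c\<bar> ^ DIM('a) *\<^sub>R f (t + c *\<^sub>R x) \<partial>lborel)"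
    by (subst integral_distr) auto
  finally show ?thesis by simp
qed

lemma Cc_infinityI:
  assumes "\<And>k. C_k k \<phi>" "compact S" "S \<subseteq> \<Omega>" "\<And>x. x \<notin> S \<Longrightarrow> \<phi> x = 0"
  shows "\<phi> \<in> Cc_infinity \<Omega>"
proof -
  have "closure {x. \<phi> x \<noteq> 0} \<subseteq> S"
    using assms(2,4) by (intro closure_minimal compact_imp_closed) auto
  then show ?thesis
    using assms compact_Int_closed[OF assms(2) closed_closure[of "{x. \<phi> x \<noteq> 0}"]] Int_absorb1[of "closure {x. \<phi> x \<noteq> 0}" S] unfolding Cc_infinity_def by auto
qed

lemma GDERIV_sum:
  assumes "finite A" "\<And>i. i \<in> A \<Longrightarrow> GDERIV (f i) x :> D i"
  shows "GDERIV (\<lambda>x. \<Sum>i\<in>A. f i x) x :> (\<Sum>i\<in>A. D i)"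
  using assms by (induction A rule: finite_induct) (auto intro: GDERIV_add GDERIV_const)

lemma grad_eq: "GDERIV f x :> D \<Longrightarrow> grad f x = D"
proof -
  assume D: "GDERIV f x :> D"
  have "D' = D" if "GDERIV f x :> D'" for D'
  proof -
    have "(\<lambda>h. h \<bullet> D') = (\<lambda>h. h \<bullet> D)"
      using D that unfolding gderiv_def by (rule has_derivative_unique[rotated])
    then show ?thesis by (metis euclidean_eqI inner_commute)
  qed
  with D show ?thesis unfolding grad_def by blast
qed

text \<open>\<open>J\<close> is the gauge of the polytope \<open>P\<close>, and \<open>j m\<close> is its log-sum-exp approximation from above. The summand \<open>1\<close>
  in \<open>E\<close> stands for the extra vector \<open>0\<close>; it keeps \<open>j m\<close> positive. The gradient of \<open>j m\<close> is a convex combination of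
  \<open>0\<close> and the \<open>c i\<close>, hence no longer than the longest of these.\<close>

locale gauge_polytope =
  fixes N :: nat and c :: "nat \<Rightarrow> 'a::euclidean_space" and x0 :: 'a and r :: real
  assumes r_pos: "0 < r" and norm_c: "i < N \<Longrightarrow> norm (c i) \<le> 1 / r"
    and bounded_poly: "bounded {x. \<forall>i<N. c i \<bullet> (x - x0) \<le> 1}"
begin

definition P :: "'a set" where "P = {x. \<forall>i<N. c i \<bullet> (x - x0) \<le> 1}"

definition J :: "'a \<Rightarrow> real" where "J x = Max (insert 0 ((\<lambda>i. c i \<bullet> (x - x0)) ` {..<N}))"

definition E :: "real \<Rightarrow> 'a \<Rightarrow> real" where
  "E m x = 1 + (\<Sum>i<N. exp (m * (c i \<bullet> (x - x0))))"

definition j :: "real \<Rightarrow> 'a \<Rightarrow> real" where "j m x = ln (E m x) / m"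

lemma J_ge: "0 \<le> J x" "i < N \<Longrightarrow> c i \<bullet> (x - x0) \<le> J x"
  unfolding J_def by (auto intro!: Max_ge)

lemma J_le_iff: "J x \<le> t \<longleftrightarrow> 0 \<le> t \<and> (\<forall>i<N. c i \<bullet> (x - x0) \<le> t)"
  unfolding J_def by auto

lemma P_iff: "x \<in> P \<longleftrightarrow> J x \<le> 1"
  by (simp add: P_def J_le_iff)

lemma closed_P: "closed P"
proof -
  have "P = (\<Inter>i\<in>{..<N}. {x. c i \<bullet> x \<le> 1 + c i \<bullet> x0})" by (auto simp: P_def inner_diff_right algebra_simps)
  then show ?thesis by (auto intro!: closed_INT closed_halfspace_le)
qed

lemma compact_P: "compact P"
  using closed_P bounded_poly by (simp add: compact_eq_bounded_closed P_def)

lemma P_borel [measurable]: "P \<in> sets borel"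
  using closed_P by auto

lemma E_gt: "1 \<le> E m x"
  unfolding E_def by (simp add: sum_nonneg)

lemma E_measurable [measurable]: "E m \<in> borel_measurable borel"
  unfolding E_def by measurable

lemma j_measurable [measurable]: "j m \<in> borel_measurable borel"
  unfolding j_def by measurable

lemma j_pos: "0 < N \<Longrightarrow> 0 < m \<Longrightarrow> 0 < j m x"
proof -
  assume "0 < N" "0 < m"
  then have "0 < (\<Sum>i<N. exp (m * (c i \<bullet> (x - x0))))" by (intro sum_pos) auto
  then show ?thesis using \<open>0 < m\<close> by (simp add: j_def E_def)
qed

lemma J_le_j: "0 < m \<Longrightarrow> J x \<le> j m x"
proof -
  assume m: "0 < m"
  have "c i \<bullet> (x - x0) \<le> j m x" if i: "i < N" for i
  proof -
    have "exp (m * (c i \<bullet> (x - x0))) \<le> (\<Sum>i<N. exp (m * (c i \<bullet> (x - x0))))"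
      using i by (intro member_le_sum) auto
    then have "exp (m * (c i \<bullet> (x - x0))) \<le> E m x" by (simp add: E_def)
    then have "m * (c i \<bullet> (x - x0)) \<le> ln (E m x)" using E_gt[of m x] by (subst ln_ge_iff) auto
    then show ?thesis using m by (simp add: j_def field_simps)
  qed
  moreover have "0 \<le> j m x" using m E_gt[of m x] by (simp add: j_def)
  ultimately show ?thesis by (simp add: J_le_iff)
qed

text \<open>\<open>E\<close> has N + 1 terms, each at most exp(m J), which accounts for the error
  ln(N + 1) / m.\<close>

lemma j_le: "0 < m \<Longrightarrow> j m x \<le> J x + ln (real N + 1) / m"
proof -
  assume m: "0 < m"
  have "E m x \<le> exp (m * J x) + (\<Sum>i<N. exp (m * J x))"
    unfolding E_def using m J_ge by (intro add_mono sum_mono) auto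
  then have "E m x \<le> (real N + 1) * exp (m * J x)" by (simp add: algebra_simps)
  then have "ln (E m x) \<le> ln ((real N + 1) * exp (m * J x))" using E_gt[of m x] by (subst ln_le_cancel_iff) auto
  also have "\<dots> = ln (real N + 1) + m * J x" by (simp add: ln_mult)
  finally show ?thesis using m by (simp add: j_def field_simps)
qed

lemma j_tendsto_J: "(\<lambda>k. j (real (Suc k)) x) \<longlonglongrightarrow> J x"
proof (rule tendsto_sandwich)
  show "(\<lambda>k. J x) \<longlonglongrightarrow> J x" by simp
  have "(\<lambda>k. J x + ln (real N + 1) / real (Suc k)) \<longlonglongrightarrow> J x + 0"
    by (intro tendsto_add tendsto_const LIMSEQ_Suc[OF lim_const_over_n])
  then show "(\<lambda>k. J x + ln (real N + 1) / real (Suc k)) \<longlonglongrightarrow> J x" by simp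
qed (use J_le_j j_le in auto)

lemma J_measurable [measurable]: "J \<in> borel_measurable borel"
  by (rule borel_measurable_LIMSEQ_real[OF j_tendsto_J]) measurable

lemma C_k_E: "C_k k (E m)"
proof -
  have "C_k k (\<lambda>x. m * (x \<bullet> c i + - (c i \<bullet> x0)))" for k i
    by (intro C_k_mult C_k_add C_k_const C_k_inner)
  then have "C_k k (\<lambda>x. exp (m * (c i \<bullet> (x - x0))))" for i
    using C_k_exp[of "\<lambda>x. m * (c i \<bullet> (x - x0))" k] by (simp add: inner_diff_right inner_commute)
  then have "C_k k (\<lambda>x. 1 + (\<Sum>i<N. exp (m * (c i \<bullet> (x - x0)))))"
    by (intro C_k_add C_k_const C_k_sum) auto
  then show ?thesis unfolding E_def[abs_def] .
qed

lemma C_k_j: "C_k k (j m)"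
proof -
  have "C_k k (\<lambda>x. (1 / m) * ln (E m x))"
    using E_gt by (intro C_k_mult C_k_const C_k_ln C_k_E) (rule less_le_trans[OF zero_less_one])
  then show ?thesis by (simp add: j_def[abs_def] mult.commute)
qed

lemma GDERIV_j:
  assumes m: "0 < m"
  obtains D where "GDERIV (j m) x :> D" "norm D \<le> 1 / r"
proof
  let ?e = "\<lambda>i. exp (m * (c i \<bullet> (x - x0)))"
  let ?D = "(1 / (E m x * m)) *\<^sub>R (\<Sum>i<N. (m * ?e i) *\<^sub>R c i)"
  have "GDERIV (\<lambda>x. exp (m * (c i \<bullet> (x - x0)))) x :> (m * ?e i) *\<^sub>R c i" for i
    unfolding gderiv_def by (auto intro!: derivative_eq_intros simp: inner_commute)
  then have "GDERIV (E m) x :> 0 + (\<Sum>i<N. (m * ?e i) *\<^sub>R c i)"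
    unfolding E_def[abs_def] by (intro GDERIV_add GDERIV_const GDERIV_sum) auto
  moreover have "((\<lambda>t. ln t / m) has_real_derivative 1 / (E m x * m)) (at (E m x))"
    using E_gt[of m x] m by (auto intro!: derivative_eq_intros simp: field_simps)
  ultimately show "GDERIV (j m) x :> ?D"
    unfolding j_def[abs_def] using GDERIV_DERIV_compose by fastforce
  have "norm (\<Sum>i<N. (m * ?e i) *\<^sub>R c i) \<le> (\<Sum>i<N. norm ((m * ?e i) *\<^sub>R c i))" by (rule norm_sum)
  also have "\<dots> \<le> (\<Sum>i<N. (m * ?e i) * (1 / r))"
  proof (rule sum_mono)
    fix i assume "i \<in> {..<N}"
    then have "(m * ?e i) * norm (c i) \<le> (m * ?e i) * (1 / r)"
      using m norm_c by (intro mult_left_mono) auto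
    then show "norm ((m * ?e i) *\<^sub>R c i) \<le> (m * ?e i) * (1 / r)" using m by simp
  qed
  also have "\<dots> = m * (E m x - 1) * (1 / r)" by (simp add: E_def sum_distrib_left sum_divide_distrib)
  also have "\<dots> \<le> m * E m x * (1 / r)" using m r_pos by (intro mult_right_mono mult_left_mono) auto
  finally show "norm ?D \<le> 1 / r"
    using m E_gt[of m x] r_pos by (simp add: divide_simps mult.commute)
qed

text \<open>Compare \<open>P\<close> with its homothetic copy of ratio t < 1 about
  \<open>x0\<close>. With d the dimension, homogeneity of J makes the integral over the shell
  between them (1 - t^(d+q)) \<open>I\<close>; as J \<le> 1 there, it is at most the volume (1 -
  t^d) |P| of the shell. The claim is this comparison to first order as t tends to 1.\<close>

lemma integral_gauge_powr_le:
  fixes q :: real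
  assumes q: "0 < q"
  shows "(DIM('a) + q) * (\<integral>x. indicator P x * J x powr q \<partial>lborel) \<le> DIM('a) * measure lborel P"
proof -
  define I where "I = (\<integral>x. indicator P x * J x powr q \<partial>lborel)"
  have bP: "bounded P" using compact_P by (rule compact_imp_bounded)
  have Jint: "integrable lborel (\<lambda>x. indicator A x * J x powr q)" if [measurable]: "A \<in> sets borel" and A: "A \<subseteq> P" for A
    using A J_ge q by (intro integrable_lborel_bounded[OF _ bP P_borel, where C = 1])
      (auto simp: indicator_def P_iff subset_eq powr_le1)
  \<comment> \<open>Volume of the shell minus the integral of J^q over it. From \<psi> \<ge> 0 to
    the left of 1 and \<psi>(1) = 0 follows \<psi>'(1) \<le> 0.\<close>
  define \<psi> where "\<psi> = (\<lambda>t. measure lborel P * (1 - t powr DIM('a)) - (1 - t powr (DIM('a) + q)) * I)"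
  have pos: "0 \<le> \<psi> t" if t: "0 < t" "t < 1" for t
  proof -
    define Pt where "Pt = {x. J x \<le> t}"
    have [measurable]: "Pt \<in> sets borel" unfolding Pt_def by measurable
    have sub: "Pt \<subseteq> P" using t by (auto simp: Pt_def P_iff)
    define T where "T = (\<lambda>x. (x0 - t *\<^sub>R x0) + t *\<^sub>R x)"
    have JT: "J (T x) = t * J x" for x
    proof -
      have T: "c i \<bullet> (T x - x0) = t * (c i \<bullet> (x - x0))" for i by (simp add: T_def inner_diff_right inner_add_right algebra_simps)
      have "J (T x) \<le> s \<longleftrightarrow> t * J x \<le> s" for s
      proof -
        have "J (T x) \<le> s \<longleftrightarrow> J x \<le> s / t"
          using t by (simp add: J_le_iff T pos_le_divide_eq mult.commute zero_le_divide_iff)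
        then show ?thesis using t by (simp add: pos_le_divide_eq mult.commute)
      qed
      then show ?thesis by (meson order_antisym order_refl)
    qed
    have ind: "indicator Pt (T x) = (indicator P x :: real)" for x
      using t by (simp add: Pt_def P_iff JT indicator_def)
    have tq: "t ^ DIM('a) = t powr DIM('a)" using t by (simp add: powr_realpow)
    have "(\<integral>x. indicator Pt x * J x powr q \<partial>lborel) = t powr DIM('a) * (\<integral>x. indicator Pt (T x) * J (T x) powr q \<partial>lborel)"
      unfolding T_def using t by (subst lborel_integral_affine[of _ t "x0 - t *\<^sub>R x0"]) (auto simp: tq)
    also have "(\<lambda>x. indicator Pt (T x) * J (T x) powr q) = (\<lambda>x. t powr q * (indicator P x * J x powr q))"
      using t J_ge by (auto simp: ind JT powr_mult fun_eq_iff)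
    also have "(\<integral>x. t powr q * (indicator P x * J x powr q) \<partial>lborel) = t powr q * I" by (simp add: I_def)
    finally have 1: "(\<integral>x. indicator Pt x * J x powr q \<partial>lborel) = t powr (DIM('a) + q) * I"
      by (simp add: powr_add)
    have "(\<integral>x. indicator Pt x \<partial>lborel) = t powr DIM('a) * (\<integral>x. indicator Pt (T x) \<partial>lborel)"
      unfolding T_def using t by (subst lborel_integral_affine[of _ t "x0 - t *\<^sub>R x0"]) (auto simp: tq)
    then have 2: "measure lborel Pt = t powr DIM('a) * measure lborel P" unfolding ind by simp
    have fin: "integrable lborel (indicator A :: 'a \<Rightarrow> real)" if "A \<in> sets borel" "A \<subseteq> P" for A
      using that by (intro integrable_lborel_bounded[OF _ bP P_borel, where C = 1]) (auto simp: indicator_def)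
    have "I - t powr (DIM('a) + q) * I = (\<integral>x. indicator P x * J x powr q - indicator Pt x * J x powr q \<partial>lborel)"
      using 1 sub by (subst Bochner_Integration.integral_diff) (auto intro!: Jint simp: I_def)
    also have "\<dots> \<le> (\<integral>x. indicator P x - indicator Pt x \<partial>lborel)"
    proof (rule integral_mono)
      show "integrable lborel (\<lambda>x. indicator P x * J x powr q - indicator Pt x * J x powr q)"
        using sub by (intro Bochner_Integration.integrable_diff Jint) auto
      show "integrable lborel (\<lambda>x. indicator P x - indicator Pt x :: real)"
        using sub by (intro Bochner_Integration.integrable_diff fin) auto
      show "indicator P x * J x powr q - indicator Pt x * J x powr q \<le> indicator P x - indicator Pt x" for x
        using sub J_ge(1)[of x] q by (auto simp: indicator_def P_iff intro!: powr_le1)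
    qed
    also have "\<dots> = measure lborel P - measure lborel Pt"
      using fin[of P] fin[of Pt] sub by (subst Bochner_Integration.integral_diff) auto
    finally show ?thesis unfolding 2 \<psi>_def by (simp add: algebra_simps)
  qed
  have der: "(\<psi> has_real_derivative (- (DIM('a) * measure lborel P) + (DIM('a) + q) * I)) (at 1)"
    unfolding \<psi>_def by (auto intro!: derivative_eq_intros simp: algebra_simps)
  have "\<not> 0 < - (DIM('a) * measure lborel P) + (DIM('a) + q) * I"
  proof
    assume "0 < - (DIM('a) * measure lborel P) + (DIM('a) + q) * I"
    then obtain e where e: "0 < e" "\<And>h. 0 < h \<Longrightarrow> h < e \<Longrightarrow> \<psi> (1 - h) < \<psi> 1"
      using DERIV_pos_inc_left[OF der] by blast
    have "\<psi> (1 - min (e / 2) (1 / 2)) < \<psi> 1" using e(1) by (intro e(2)) auto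
    moreover have "\<psi> 1 = 0" by (simp add: \<psi>_def)
    moreover have "0 \<le> \<psi> (1 - min (e / 2) (1 / 2))" using e(1) by (intro pos) auto
    ultimately show False by simp
  qed
  then show ?thesis unfolding I_def by simp
qed

text \<open>For 1 - J^q the gradient is at most (q/r) J^(q-1), and (q-1) p = q, so both integrals
  are governed by the same \<open>I\<close>: the quotient is at least (V - I)^p / ((q/r)^p I). With
  I \<le> V d / (d+q), d the dimension, this gives r^p V^(p-1) / (d (d+q)^(p-1)). \<open>C\<close>
  lies strictly below that value, which leaves room for the smoothing error.\<close>

lemma torsion_test_function:
  fixes p q C :: real
  assumes N: "0 < N" and p: "1 < p" and sub: "P \<subseteq> \<Omega>"
  defines "q \<equiv> p / (p - 1)"
  assumes C: "0 \<le> C" "C * (DIM('a) * (DIM('a) + q) powr (p - 1)) < r powr p * measure lborel P powr (p - 1)"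
  obtains \<phi> where "\<phi> \<in> Cc_infinity \<Omega>"
    "C * (\<integral>x. norm (grad \<phi> x) powr p \<partial>lborel) < (\<integral>x. \<bar>\<phi> x\<bar> \<partial>lborel) powr p"
proof -
  have q: "1 < q" and qp: "(q - 1) * p = q" using p by (auto simp: q_def field_simps)
  define \<phi> where "\<phi> = (\<lambda>m x. smooth_pos (m * (1 - j m x powr q)) / m)"
  define I where "I = (\<integral>x. indicator P x * J x powr q \<partial>lborel)"
  define V where "V = measure lborel P"
  have bP: "bounded P" using compact_P by (rule compact_imp_bounded)
  have fin: "integrable lborel (indicator P :: 'a \<Rightarrow> real)"
    by (intro integrable_lborel_bounded[OF _ bP P_borel, where C = 1]) (auto simp: indicator_def)
  \<comment> \<open>\<open>j m\<close> lies above \<open>J\<close>, so the test function vanishes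
    outside \<open>P\<close> for every \<open>m\<close>; an approximation from below could leak out
    of \<Omega>.\<close>
  have outside: "1 - j m x powr q \<le> 0" if "0 < m" "x \<notin> P" for m x
    using J_le_j[OF that(1), of x] that(2) q by (auto simp: P_iff intro: ge_one_powr_ge_zero)
  have Ck: "C_k k (\<phi> m)" if m: "0 < m" for m k
  proof -
    have *: "C_k k (\<lambda>x. m * (1 + - 1 * j m x powr q))" for k
      using j_pos[OF N m] by (intro C_k_mult C_k_add C_k_const C_k_powr C_k_j) auto
    have "C_k k (\<lambda>x. (1 / m) * smooth_pos (m * (1 + - 1 * j m x powr q)))"
      by (rule C_k_mult[OF C_k_const C_k_smooth_pos[OF *]])
    then show ?thesis unfolding \<phi>_def by simp
  qed
  have mem: "\<phi> m \<in> Cc_infinity \<Omega>" if m: "0 < m" for m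
    using Ck[OF m] compact_P sub
  proof (rule Cc_infinityI)
    show "\<phi> m x = 0" if "x \<notin> P" for x
      using outside[OF m that] m by (simp add: \<phi>_def mult_nonneg_nonpos)
  qed
  have grad: "norm (grad (\<phi> m) x) powr p \<le> (q / r) powr p * (indicator P x * j m x powr q)" if m: "0 < m" for m x
  proof -
    obtain D where D: "GDERIV (j m) x :> D" "norm D \<le> 1 / r" using GDERIV_j[OF m] .
    define u where "u = m * (1 - j m x powr q)"
    obtain s where s: "(smooth_pos has_real_derivative s) (at u)" "0 \<le> s" "s \<le> 1" "u \<le> 0 \<Longrightarrow> s = 0"
      using DERIV_smooth_pos[of u] by blast
    have jp: "0 < j m x" by (rule j_pos[OF N m])
    have "((\<lambda>t. m * (1 - t powr q)) has_real_derivative (- (m * (q * j m x powr (q - 1))))) (at (j m x))"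
      using jp by (auto intro!: derivative_eq_intros)
    then have "((\<lambda>t. smooth_pos (m * (1 - t powr q))) has_real_derivative s * (- (m * (q * j m x powr (q - 1))))) (at (j m x))"
      using s(1) unfolding u_def by (rule DERIV_chain2[rotated])
    then have "((\<lambda>t. smooth_pos (m * (1 - t powr q)) / m) has_real_derivative
        s * (- (m * (q * j m x powr (q - 1)))) / m) (at (j m x))"
      by (rule DERIV_cdivide)
    then have "GDERIV (\<phi> m) x :> (s * (- (m * (q * j m x powr (q - 1)))) / m) *\<^sub>R D"
      unfolding \<phi>_def using D(1) by (intro GDERIV_DERIV_compose[where f = "j m"])
    then have gr: "grad (\<phi> m) x = (s * (- (m * (q * j m x powr (q - 1)))) / m) *\<^sub>R D" by (rule grad_eq)
    have n: "norm (grad (\<phi> m) x) = s * (q * j m x powr (q - 1)) * norm D"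
      unfolding gr using m s(2) q by (simp add: abs_mult)
    show ?thesis
    proof (cases "x \<in> P")
      case True
      have "s * (q * j m x powr (q - 1)) * norm D \<le> 1 * (q * j m x powr (q - 1)) * (1 / r)"
        using s D q by (intro mult_mono) auto
      then have "norm (grad (\<phi> m) x) powr p \<le> (q / r * j m x powr (q - 1)) powr p"
        unfolding n using p s q by (intro powr_mono2) auto
      also have "\<dots> = (q / r) powr p * j m x powr q"
        using q r_pos by (subst powr_mult) (auto simp: powr_powr qp)
      finally show ?thesis using True by simp
    next
      case False
      then have "u \<le> 0" using outside[OF m] m by (simp add: u_def mult_nonneg_nonpos)
      then have "norm (grad (\<phi> m) x) = 0" using s(4) n by simp
      then show ?thesis using p by simp
    qed
  qed
  \<comment> \<open>A bound for the powers of \<open>j m\<close> on \<open>P\<close> that is uniform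
    in m \<ge> 1, for dominated convergence.\<close>
  define M where "M = (1 + ln (real N + 1)) powr q"
  have jM: "j m x powr q \<le> M" if m: "1 \<le> m" and x: "x \<in> P" for m x
  proof -
    have "ln (real N + 1) / m \<le> ln (real N + 1)" using m N by (simp add: divide_le_eq mult_left_mono[of 1 m, simplified])
    then have "j m x \<le> 1 + ln (real N + 1)" using j_le[of m x] m x by (auto simp: P_iff)
    then show ?thesis unfolding M_def using j_pos[OF N, of m x] m q by (intro powr_mono2) auto
  qed
  have jint: "integrable lborel (\<lambda>x. indicator P x * j m x powr q)" if m: "1 \<le> m" for m
    using jM[OF m] by (intro integrable_lborel_bounded[OF _ bP P_borel, where C = M]) auto
  define Im where "Im = (\<lambda>k. \<integral>x. indicator P x * j (real (Suc k)) x powr q \<partial>lborel)"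
  have Im: "Im \<longlonglongrightarrow> I"
    unfolding Im_def I_def
  proof (rule integral_dominated_convergence[where w = "\<lambda>x. indicator P x * M"])
    show "AE x in lborel. (\<lambda>k. indicator P x * j (real (Suc k)) x powr q) \<longlonglongrightarrow> indicator P x * J x powr q"
      using q J_ge j_pos[OF N] by (intro always_eventually allI tendsto_mult tendsto_const tendsto_powr' j_tendsto_J)
        (auto intro!: always_eventually less_imp_le)
    show "AE x in lborel. norm (indicator P x * j (real (Suc k)) x powr q) \<le> indicator P x * M" for k
      using jM[of "real (Suc k)"] by (auto simp: indicator_def)
  qed (use fin in auto)
  have lower: "V - Im k - V / real (Suc k) \<le> (\<integral>x. \<bar>\<phi> (real (Suc k)) x\<bar> \<partial>lborel)" for k
  proof -
    define m where "m = real (Suc k)"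
    have m: "0 < m" "1 \<le> m" by (auto simp: m_def)
    have zero: "\<phi> m x = 0" if "x \<notin> P" for x
      using outside[OF m(1) that] m by (simp add: \<phi>_def mult_nonneg_nonpos)
    have low: "1 - j m x powr q - 1 / m \<le> \<phi> m x" for x
    proof -
      have "(m * (1 - j m x powr q) - 1) / m \<le> smooth_pos (m * (1 - j m x powr q)) / m"
        using m by (intro divide_right_mono smooth_pos_ge) auto
      then show ?thesis using m by (simp add: \<phi>_def diff_divide_distrib)
    qed
    have cont: "continuous_on UNIV (\<phi> m)" using Ck[OF m(1), of 0] by simp
    have mint: "integrable lborel (\<lambda>x. \<bar>\<phi> m x\<bar>)"
    proof -
      have "integrable lborel (\<lambda>x. indicator P x *\<^sub>R \<bar>\<phi> m x\<bar>)"
        using cont by (intro borel_integrable_compact compact_P continuous_intros) (auto intro: continuous_on_subset)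
      moreover have "(\<lambda>x. indicator P x *\<^sub>R \<bar>\<phi> m x\<bar>) = (\<lambda>x. \<bar>\<phi> m x\<bar>)"
        using zero by (auto simp: indicator_def fun_eq_iff)
      ultimately show ?thesis by simp
    qed
    have "V - Im k - V / m = (\<integral>x. indicator P x - indicator P x * j m x powr q - indicator P x / m \<partial>lborel)"
      using fin jint[OF m(2)] by (simp add: V_def Im_def m_def)
    also have "\<dots> \<le> (\<integral>x. \<bar>\<phi> m x\<bar> \<partial>lborel)"
    proof (rule integral_mono)
      show "indicator P x - indicator P x * j m x powr q - indicator P x / m \<le> \<bar>\<phi> m x\<bar>" for x
        using low[of x] by (auto simp: indicator_def)
    qed (use fin jint[OF m(2)] mint in auto)
    finally show ?thesis by (simp add: m_def)
  qed
  have upper: "(\<integral>x. norm (grad (\<phi> (real (Suc k))) x) powr p \<partial>lborel) \<le> (q / r) powr p * Im k" for k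
  proof -
    have "(\<integral>x. norm (grad (\<phi> (real (Suc k))) x) powr p \<partial>lborel)
      \<le> (\<integral>x. (q / r) powr p * (indicator P x * j (real (Suc k)) x powr q) \<partial>lborel)"
      using jint[of "real (Suc k)"] grad[of "real (Suc k)"] by (intro integral_mono') auto
    then show ?thesis by (simp add: Im_def)
  qed
  \<comment> \<open>For V = 0 the hypothesis on \<open>C\<close> would put a nonnegative number
    strictly below 0.\<close>
  have V0: "0 < V"
  proof (rule ccontr)
    assume "\<not> 0 < V"
    then have "V = 0" by (simp add: V_def not_less measure_le_0_iff)
    then have "C * (DIM('a) * (DIM('a) + q) powr (p - 1)) < 0" using C(2) by (simp add: V_def)
    moreover have "0 \<le> C * (DIM('a) * (DIM('a) + q) powr (p - 1))" using C(1) by simp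
    ultimately show False by simp
  qed
  have IV: "I \<le> V * (DIM('a) / (DIM('a) + q))"
    using integral_gauge_powr_le[of q] q unfolding I_def[symmetric] V_def[symmetric] by (simp add: field_simps)
  have main: "C * ((q / r) powr p * I) < (V - I) powr p"
  proof -
    let ?d = "real DIM('a)"
    have "C * ((q / r) powr p * I) \<le> C * ((q / r) powr p * (V * (?d / (?d + q))))"
      using C(1) IV by (intro mult_left_mono) auto
    also have "\<dots> = (C * (?d * (?d + q) powr (p - 1))) * ((q / r) powr p * V / (?d + q) powr p)"
      using q by (simp add: powr_diff)
    also have "\<dots> < (r powr p * V powr (p - 1)) * ((q / r) powr p * V / (?d + q) powr p)"
      using C(2) V0 q r_pos unfolding V_def[symmetric] by (intro mult_strict_right_mono) auto
    also have "\<dots> = (V * (q / (?d + q))) powr p"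
      using V0 q r_pos by (simp add: powr_mult powr_divide powr_diff)
    also have "V * (q / (?d + q)) = V - V * (?d / (?d + q))"
      using q by (simp add: field_simps)
    also have "(V - V * (?d / (?d + q))) powr p \<le> (V - I) powr p"
    proof (rule powr_mono2)
      show "0 \<le> V - V * (?d / (?d + q))" using V0 q by (simp add: field_simps)
    qed (use IV p in auto)
    finally show ?thesis .
  qed
  have VI: "0 < V - I"
  proof -
    have "V * (DIM('a) / (DIM('a) + q)) < V * 1"
      using V0 q by (intro mult_strict_left_mono) auto
    with IV show ?thesis by simp
  qed
  have l1: "(\<lambda>k. V - Im k - V / real (Suc k)) \<longlonglongrightarrow> V - I - 0"
    by (intro tendsto_diff tendsto_const Im LIMSEQ_Suc[OF lim_const_over_n])
  have "(\<lambda>k. C * ((q / r) powr p * Im k) - (V - Im k - V / real (Suc k)) powr p)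
      \<longlonglongrightarrow> C * ((q / r) powr p * I) - (V - I - 0) powr p"
    using VI by (intro tendsto_diff tendsto_mult tendsto_const Im tendsto_powr l1[unfolded diff_0_right] l1) auto
  moreover have "C * ((q / r) powr p * I) - (V - I - 0) powr p < 0" using main by simp
  ultimately have "eventually (\<lambda>k. C * ((q / r) powr p * Im k) - (V - Im k - V / real (Suc k)) powr p < 0) sequentially"
    by (rule order_tendstoD)
  moreover have "eventually (\<lambda>k. 0 < V - Im k - V / real (Suc k)) sequentially"
    using l1 by (rule order_tendstoD) (use VI in simp)
  ultimately have "eventually (\<lambda>k. C * ((q / r) powr p * Im k) - (V - Im k - V / real (Suc k)) powr p < 0
     \<and> 0 < V - Im k - V / real (Suc k)) sequentially"
    by eventually_elim simp
  then obtain k where k: "C * ((q / r) powr p * Im k) < (V - Im k - V / real (Suc k)) powr p"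
     "0 < V - Im k - V / real (Suc k)"
    by (auto simp: eventually_sequentially)
  show ?thesis
  proof (rule that[OF mem[of "real (Suc k)"]])
    have "C * (\<integral>x. norm (grad (\<phi> (real (Suc k))) x) powr p \<partial>lborel) \<le> C * ((q / r) powr p * Im k)"
      using upper C(1) by (rule mult_left_mono)
    also note k(1)
    also have "(V - Im k - V / real (Suc k)) powr p \<le> (\<integral>x. \<bar>\<phi> (real (Suc k)) x\<bar> \<partial>lborel) powr p"
      using k(2) lower p by (intro powr_mono2) auto
    finally show "C * (\<integral>x. norm (grad (\<phi> (real (Suc k))) x) powr p \<partial>lborel)
      < (\<integral>x. \<bar>\<phi> (real (Suc k)) x\<bar> \<partial>lborel) powr p" .
  qed simp
qed

end

section \<open>Bounds in terms of the inradius\<close>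

text \<open>The distance to the complement is continuous and attains its maximum on the compact
  closure; a maximum point is an incentre.\<close>

lemma inradius_attained:
  fixes \<Omega> :: "'a::euclidean_space set"
  assumes "open \<Omega>" "bounded \<Omega>" "\<Omega> \<noteq> {}"
  obtains x0 \<rho> where "0 < \<rho>" "ball x0 \<rho> \<subseteq> \<Omega>" "\<forall>x r. 0 < r \<and> ball x r \<subseteq> \<Omega> \<longrightarrow> r \<le> \<rho>"
proof -
  have ne: "- \<Omega> \<noteq> {}"
  proof
    assume "- \<Omega> = {}"
    then have "\<Omega> = UNIV" by auto
    with assms(2) show False by simp
  qed
  have "continuous_on (closure \<Omega>) (\<lambda>x. infdist x (- \<Omega>))" by (intro continuous_intros)
  moreover have "compact (closure \<Omega>)" "closure \<Omega> \<noteq> {}"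
    using assms by (auto simp: compact_closure)
  ultimately obtain x0 where x0: "x0 \<in> closure \<Omega>" "\<forall>y\<in>closure \<Omega>. infdist y (- \<Omega>) \<le> infdist x0 (- \<Omega>)"
    using continuous_attains_sup by blast
  have 1: "r \<le> infdist x0 (- \<Omega>)" if r: "0 < r" "ball x r \<subseteq> \<Omega>" for x r
  proof -
    have "r \<le> infdist x (- \<Omega>)"
      unfolding infdist_notempty[OF ne] using ne r(2) by (intro cINF_greatest) (auto simp: subset_eq not_less[symmetric])
    moreover have "x \<in> closure \<Omega>" using r closure_subset[of \<Omega>] centre_in_ball[of x r] by blast
    ultimately show ?thesis using x0(2) by force
  qed
  have 2: "ball x0 (infdist x0 (- \<Omega>)) \<subseteq> \<Omega>"
  proof
    fix y assume "y \<in> ball x0 (infdist x0 (- \<Omega>))"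
    then show "y \<in> \<Omega>" using infdist_le[of y "- \<Omega>" x0] by (cases "y \<in> \<Omega>") auto
  qed
  obtain x where x: "x \<in> \<Omega>" using assms(3) by auto
  then obtain r where r: "0 < r" "ball x r \<subseteq> \<Omega>" using assms(1) open_contains_ball by blast
  have "0 < infdist x0 (- \<Omega>)" using 1[OF r] r(1) by simp
  then show ?thesis using 1 2 that by blast
qed

lemma Cc_infinity_C1:
  fixes \<phi> :: "'a::euclidean_space \<Rightarrow> real"
  assumes "\<phi> \<in> Cc_infinity \<Omega>" "compact K" "closure {x. \<phi> x \<noteq> 0} \<subseteq> K"
  shows "C1_compact_support \<phi> (grad \<phi>) K"
proof
  have "C_k 1 \<phi>" using assms(1) by (simp add: Cc_infinity_def)
  then obtain g where g: "\<And>x. GDERIV \<phi> x :> g x" "\<And>b. b \<in> Basis \<Longrightarrow> continuous_on UNIV (\<lambda>x. g x \<bullet> b)"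
    by auto
  have gr: "grad \<phi> = g" using g(1) grad_eq by blast
  show "GDERIV \<phi> x :> grad \<phi> x" for x using g(1) gr by simp
  show "continuous_on UNIV (grad \<phi>)"
    unfolding gr using g(2) by (subst continuous_on_componentwise) auto
  show "compact K" by fact
  show "\<phi> x = 0" if "x \<notin> K" for x using that assms(3) closure_subset[of "{x. \<phi> x \<noteq> 0}"] by blast
  show "grad \<phi> x = 0" if "x \<notin> K" for x
  proof (rule grad_eq)
    have "((\<lambda>_. 0) has_derivative (\<lambda>h. h \<bullet> 0)) (at x)" by simp
    then show "GDERIV \<phi> x :> 0"
      unfolding gderiv_def
    proof (rule has_derivative_transform_within_open[where s = "- closure {x. \<phi> x \<noteq> 0}"])
      show "x \<in> - closure {x. \<phi> x \<noteq> 0}" using that assms(3) by auto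
      show "0 = \<phi> y" if "y \<in> - closure {x. \<phi> x \<noteq> 0}" for y
        using that closure_subset[of "{x. \<phi> x \<noteq> 0}"] by (metis (mono_tags, lifting) Compl_iff mem_Collect_eq subsetD)
    qed auto
  qed
qed

lemma Cc_infinity_C1_closure:
  "\<phi> \<in> Cc_infinity \<Omega> \<Longrightarrow> C1_compact_support \<phi> (grad \<phi>) (closure {x. \<phi> x \<noteq> 0})"
  by (rule Cc_infinity_C1) (auto simp: Cc_infinity_def)

lemma Cc_infinity_zero:
  assumes "\<phi> \<in> Cc_infinity \<Omega>" "x \<notin> \<Omega>"
  shows "\<phi> x = 0" "grad \<phi> x = 0"
proof -
  have "x \<notin> closure {x. \<phi> x \<noteq> 0}" using assms by (auto simp: Cc_infinity_def)
  then show "\<phi> x = 0" "grad \<phi> x = 0"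
    by (rule C1_compact_support.zero[OF Cc_infinity_C1_closure[OF assms(1)]])+
qed

lemma Cc_infinity_cells:
  fixes \<phi> :: "'a::euclidean_space \<Rightarrow> real"
  assumes \<phi>: "\<phi> \<in> Cc_infinity \<Omega>" and "open \<Omega>" "convex \<Omega>" "bounded \<Omega>" "\<Omega> \<noteq> {}"
    and \<rho>: "0 \<le> \<rho>" "\<forall>x r. 0 < r \<and> ball x r \<subseteq> \<Omega> \<longrightarrow> r \<le> \<rho>"
  obtains N n b K where "cells_function N n b \<rho> \<phi> (grad \<phi>) K" "polytope_cells.P N n b \<subseteq> \<Omega>"
proof -
  obtain x0 where x0: "x0 \<in> \<Omega>" using assms by auto
  define S where "S = closure {x. \<phi> x \<noteq> 0}"
  have S: "compact S" "S \<subseteq> \<Omega>" using \<phi> by (auto simp: Cc_infinity_def S_def)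
  \<comment> \<open>The additional point \<open>x0\<close> keeps \<open>K\<close> nonempty when
    \<phi> vanishes identically.\<close>
  define K where "K = convex hull (insert x0 S)"
  have K: "compact K" "convex K" "K \<noteq> {}" "S \<subseteq> K"
    using S hull_subset[of "insert x0 S" convex] unfolding K_def
    by (auto intro!: compact_convex_hull compact_insert)
  have KO: "K \<subseteq> \<Omega>" unfolding K_def using S x0 assms(3) by (intro hull_minimal) auto
  obtain N n b where N: "0 < (N::nat)" "\<And>i. i < N \<Longrightarrow> norm (n i) = 1"
    "\<And>i x. i < N \<Longrightarrow> x \<in> K \<Longrightarrow> n i \<bullet> x < b i" "{x. \<forall>i<N. n i \<bullet> x \<le> b i} \<subseteq> \<Omega>"
    using halfspaces_between[OF assms(2,4) K(1-3) KO] by blast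
  have pc: "polytope_cells N n b \<rho>"
  proof
    show "r \<le> \<rho>" if "0 < r" "ball x r \<subseteq> {x. \<forall>i<N. n i \<bullet> x \<le> b i}" for x r
      using \<rho>(2) that(1) subset_trans[OF that(2) N(4)] by blast
  qed (use N(1,2) \<rho>(1) in auto)
  interpret C1_compact_support \<phi> "grad \<phi>" K
    using K S_def by (intro Cc_infinity_C1[OF \<phi>]) auto
  have "cells_function N n b \<rho> \<phi> (grad \<phi>) K"
    unfolding cells_function_def cells_function_axioms_def
    using pc N(3) C1_compact_support_axioms by blast
  moreover have "polytope_cells.P N n b \<subseteq> \<Omega>" using N(4) by (simp add: polytope_cells.P_def[OF pc])
  ultimately show ?thesis by (rule that)
qed

lemma measure_open_pos:
  fixes \<Omega> :: "'a::euclidean_space set"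
  assumes \<Omega>: "open \<Omega>" "bounded \<Omega>" "\<Omega> \<noteq> {}"
  shows "0 < measure lborel \<Omega>"
proof -
  have "emeasure lborel \<Omega> \<noteq> 0"
    using open_not_negligible[OF \<Omega>(1,3)] \<Omega>(1) by (auto simp: negligible_iff_null_sets null_sets_completion_iff null_sets_def)
  then show ?thesis
    using emeasure_bounded_finite[OF \<Omega>(2)] by (simp add: measure_def enn2real_positive_iff zero_less_iff_neq_zero)
qed

lemma pi_p_pos: "1 < p \<Longrightarrow> 0 < pi_p p"
  unfolding pi_p_def by (intro mult_pos_pos divide_pos_pos sin_gt_zero) (auto simp: divide_less_eq)

text \<open>The Riccati weight requires a strictly subcritical value of \<Lambda>, so the bound is
  proved with a factor z < 1, and z then tends to 1.\<close>

lemma eigenvalue_lower_bound: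
  fixes \<phi> :: "'a::euclidean_space \<Rightarrow> real" and p \<rho> :: real
  assumes \<phi>: "\<phi> \<in> Cc_infinity \<Omega>" and \<Omega>: "open \<Omega>" "convex \<Omega>" "bounded \<Omega>" "\<Omega> \<noteq> {}"
    and \<rho>: "0 < \<rho>" "\<forall>x r. 0 < r \<and> ball x r \<subseteq> \<Omega> \<longrightarrow> r \<le> \<rho>" and p: "1 < p"
  shows "(pi_p p / 2 / \<rho>) powr p * (\<integral>x. \<bar>\<phi> x\<bar> powr p \<partial>lborel) \<le> (\<integral>x. norm (grad \<phi> x) powr p \<partial>lborel)"
proof (rule field_le_mult_one_interval)
  fix z :: real assume z: "0 < z" "z < 1"
  obtain N n b K where c: "cells_function N n b \<rho> \<phi> (grad \<phi>) K" and "polytope_cells.P N n b \<subseteq> \<Omega>"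
    using Cc_infinity_cells[OF \<phi> \<Omega> less_imp_le[OF \<rho>(1)] \<rho>(2)] by blast
  let ?l = "z * (pi_p p / 2 / \<rho>) powr p"
  have pos: "0 < pi_p p / 2 / \<rho>" using pi_p_pos[OF p] \<rho> by simp
  have "?l powr (1 / p) * \<rho> = z powr (1 / p) * (pi_p p / 2)"
    using z pos p \<rho> pi_p_pos[OF p] by (simp add: powr_mult powr_powr)
  also have "\<dots> < 1 * (pi_p p / 2)"
  proof (rule mult_strict_right_mono)
    have "z powr (1 / p) < 1 powr (1 / p)" using z p by (intro powr_less_mono2) auto
    then show "z powr (1 / p) < 1" by simp
  qed (use pi_p_pos[OF p] in simp)
  finally have "?l powr (1 / p) * \<rho> < pi_p p / 2" by simp
  then have "?l * (\<integral>x. \<bar>\<phi> x\<bar> powr p \<partial>lborel) \<le> (\<integral>x. norm (grad \<phi> x) powr p \<partial>lborel)"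
    using z pos by (intro cells_function.eigenvalue_bound[OF c p] mult_pos_pos) auto
  then show "z * ((pi_p p / 2 / \<rho>) powr p * (\<integral>x. \<bar>\<phi> x\<bar> powr p \<partial>lborel)) \<le> (\<integral>x. norm (grad \<phi> x) powr p \<partial>lborel)"
    by (simp add: mult.assoc)
qed

lemma torsion_upper_bound:
  fixes \<phi> :: "'a::euclidean_space \<Rightarrow> real" and p \<rho> :: real
  assumes \<phi>: "\<phi> \<in> Cc_infinity \<Omega>" and \<Omega>: "open \<Omega>" "convex \<Omega>" "bounded \<Omega>" "\<Omega> \<noteq> {}"
    and \<rho>: "0 < \<rho>" "\<forall>x r. 0 < r \<and> ball x r \<subseteq> \<Omega> \<longrightarrow> r \<le> \<rho>" and p: "1 < p"
  defines "q \<equiv> p / (p - 1)"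
  shows "(\<integral>x. \<bar>\<phi> x\<bar> \<partial>lborel) powr p
    \<le> (\<rho> powr q * measure lborel \<Omega> / (q + 1)) powr (p - 1) * (\<integral>x. norm (grad \<phi> x) powr p \<partial>lborel)"
proof -
  have q: "1 < q" and qp: "q / p = 1 / (p - 1)" using p by (auto simp: q_def field_simps)
  obtain N n b K where c: "cells_function N n b \<rho> \<phi> (grad \<phi>) K" and PO: "polytope_cells.P N n b \<subseteq> \<Omega>"
    using Cc_infinity_cells[OF \<phi> \<Omega> less_imp_le[OF \<rho>(1)] \<rho>(2)] by blast
  interpret cells_function N n b \<rho> \<phi> "grad \<phi>" K by (rule c)
  define I X Y where "I = (\<integral>x. \<bar>\<phi> x\<bar> \<partial>lborel)" and "X = (\<integral>x. norm (grad \<phi> x) powr p \<partial>lborel)"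
    and "Y = \<rho> powr q * measure lborel \<Omega> / (q + 1)"
  have I0: "0 \<le> I" unfolding I_def by simp
  have fin: "emeasure lborel \<Omega> < \<infinity>" using \<Omega>(3) by (rule emeasure_bounded_finite)
  have "0 < measure lborel \<Omega>" by (rule measure_open_pos[OF \<Omega>(1,3,4)])
  then have Y: "0 < Y" using \<rho> q by (simp add: Y_def)
  have "measure lborel P \<le> measure lborel \<Omega>"
    using PO fin \<Omega>(1) by (intro measure_mono_fmeasurable) (auto simp: fmeasurable_def)
  then have PY: "\<rho> powr q * measure lborel P / (q + 1) \<le> Y"
    unfolding Y_def using q by (intro divide_right_mono mult_left_mono) auto
  have bP: "bounded P" using PO \<Omega>(3) by (rule bounded_subset[rotated])
  \<comment> \<open>The gradient integral \<open>X\<close> may be 0, so \<open>t\<close> is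
    optimised for every \<open>Z\<close> above it.\<close>
  have "I powr p / Y powr (p - 1) \<le> Z" if Z: "X < Z" for Z
  proof -
    have "0 \<le> X" by (simp add: X_def)
    with Z have Z0: "0 < Z" by simp
    \<comment> \<open>This value makes both terms of the Young bound multiples of the same quantity
      Y^((p-1)/p) Z^(1/p), with factors 1 and p - 1.\<close>
    define t where "t = (Y / Z) powr ((p - 1) / p)"
    have t: "0 < t" using Y Z0 by (simp add: t_def)
    have "p * I \<le> t * X + (p - 1) * (1 / t) powr (q / p) * (\<rho> powr q * measure lborel P / (q + 1))"
      unfolding I_def X_def q_def by (rule torsion_bound_Young[OF p t bP])
    also have "\<dots> \<le> t * Z + (p - 1) * (1 / t) powr (q / p) * Y"
      using t Z p PY by (intro add_mono mult_left_mono) auto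
    finally have I1: "p * I \<le> t * Z + (p - 1) * ((1 / t) powr (q / p) * Y)" by (simp add: mult.assoc)
    have e1: "t * Z = Y powr ((p - 1) / p) * Z powr (1 / p)"
    proof -
      have "Z powr 1 = Z powr ((p - 1) / p) * Z powr (1 / p)"
        using p by (subst powr_add[symmetric]) (auto simp: diff_divide_distrib)
      then have "t * Z = t * (Z powr ((p - 1) / p) * Z powr (1 / p))" using Z0 by simp
      then show ?thesis using Y Z0 by (simp add: t_def powr_divide)
    qed
    have e2: "(1 / t) powr (q / p) * Y = Y powr ((p - 1) / p) * Z powr (1 / p)"
    proof -
      have "1 / t = (Z / Y) powr ((p - 1) / p)" using Y Z0 by (simp add: t_def powr_divide)
      then have "(1 / t) powr (q / p) = Z powr (1 / p) / Y powr (1 / p)"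
        using Y Z0 p by (simp add: qp powr_powr powr_divide)
      moreover have "Y powr 1 = Y powr ((p - 1) / p) * Y powr (1 / p)"
        using p by (subst powr_add[symmetric]) (auto simp: diff_divide_distrib)
      ultimately have "(1 / t) powr (q / p) * Y = Z powr (1 / p) / Y powr (1 / p) * (Y powr ((p - 1) / p) * Y powr (1 / p))"
        using Y by simp
      then show ?thesis using Y by simp
    qed
    have "p * I \<le> p * (Y powr ((p - 1) / p) * Z powr (1 / p))"
      using I1 unfolding e1 e2 by (simp add: algebra_simps)
    then have "I \<le> Y powr ((p - 1) / p) * Z powr (1 / p)" using p by simp
    then have "I powr p \<le> (Y powr ((p - 1) / p) * Z powr (1 / p)) powr p"
      using I0 p by (intro powr_mono2) auto
    also have "\<dots> = Y powr (p - 1) * Z" using Y Z0 p by (simp add: powr_mult powr_powr)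
    finally show ?thesis using Y by (simp add: divide_le_eq mult.commute)
  qed
  then have "I powr p / Y powr (p - 1) \<le> X" by (rule dense_ge)
  then have "I powr p \<le> Y powr (p - 1) * X" using Y by (simp add: divide_le_eq mult.commute)
  then show ?thesis unfolding I_def X_def Y_def .
qed

text \<open>Shrink the closure of \<Omega> by a factor s < 1 about \<open>x0\<close>. A polytope
  between this copy and \<Omega> contains a ball of radius s \<rho> about \<open>x0\<close> and has
  at least s^d times the volume of \<Omega>, d being the dimension. The strict hypothesis on
  \<open>C\<close> allows s close to 1.\<close>

lemma torsion_lower_bound:
  fixes \<Omega> :: "'a::euclidean_space set" and p q C :: real
  assumes \<Omega>: "open \<Omega>" "convex \<Omega>" "bounded \<Omega>" and \<rho>: "0 < \<rho>" "ball x0 \<rho> \<subseteq> \<Omega>" and p: "1 < p"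
  defines "q \<equiv> p / (p - 1)"
  assumes C: "0 \<le> C" "C * (DIM('a) * (DIM('a) + q) powr (p - 1)) < \<rho> powr p * measure lborel \<Omega> powr (p - 1)"
  obtains \<phi> where "\<phi> \<in> Cc_infinity \<Omega>"
    "C * (\<integral>x. norm (grad \<phi> x) powr p \<partial>lborel) < (\<integral>x. \<bar>\<phi> x\<bar> \<partial>lborel) powr p"
proof -
  define V where "V = measure lborel \<Omega>"
  define D where "D = C * (DIM('a) * (DIM('a) + q) powr (p - 1))"
  define f where "f = (\<lambda>s. (s * \<rho>) powr p * (s ^ DIM('a) * V) powr (p - 1))"
  have V0: "0 < V"
  proof (rule ccontr)
    assume "\<not> 0 < V"
    then have "V = 0" by (simp add: V_def not_less measure_le_0_iff)
    then have "D < 0" using C(2) by (simp add: V_def D_def)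
    moreover have "0 \<le> D" unfolding D_def using C(1) by simp
    ultimately show False by simp
  qed
  have "(f \<longlongrightarrow> (1 * \<rho>) powr p * (1 ^ DIM('a) * V) powr (p - 1)) (at_left 1)"
    unfolding f_def using V0 \<rho> by (intro tendsto_intros) auto
  then have "eventually (\<lambda>s. D < f s) (at_left 1)"
    by (rule order_tendstoD) (use C(2) in \<open>simp add: D_def V_def\<close>)
  moreover have "eventually (\<lambda>s. s \<in> {0<..<1}) (at_left (1::real))"
    by (rule eventually_at_left_real) simp
  ultimately have "eventually (\<lambda>s. D < f s \<and> s \<in> {0<..<1}) (at_left (1::real))" by eventually_elim simp
  then obtain s where s: "D < f s" "0 < s" "s < 1"
    using eventually_happens[of _ "at_left (1::real)"] by (auto simp: trivial_limit_at_left_real)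
  define K where "K = (\<lambda>x. s *\<^sub>R x + (x0 - s *\<^sub>R x0)) ` closure \<Omega>"
  have x0: "x0 \<in> \<Omega>" using \<rho> by auto
  have Kc: "compact K"
    unfolding K_def using \<Omega> by (intro compact_continuous_image continuous_intros) (simp add: compact_closure)
  have Kconv: "convex K"
    unfolding K_def using \<Omega>(2) convex_affinity[of "closure \<Omega>" "x0 - s *\<^sub>R x0" s] by (simp add: convex_closure add.commute)
  have Kne: "K \<noteq> {}" using x0 by (auto simp: K_def)
  have KO: "K \<subseteq> \<Omega>"
  proof
    fix y assume "y \<in> K"
    then obtain x where x: "x \<in> closure \<Omega>" "y = s *\<^sub>R x + (x0 - s *\<^sub>R x0)" by (auto simp: K_def)
    show "y \<in> \<Omega>"
    proof (cases "x = x0")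
      case True then show ?thesis using x x0 by simp
    next
      case False
      have "y \<in> open_segment x0 x"
        using False s x(2) by (auto simp: in_segment algebra_simps intro!: exI[of _ s])
      then show ?thesis
        using in_interior_closure_convex_segment[OF \<Omega>(2), of x0 x] x x0 \<Omega>(1) by (auto simp: interior_open)
    qed
  qed
  obtain N n b where N: "0 < (N::nat)" "\<And>i. i < N \<Longrightarrow> norm (n i) = 1"
    "\<And>i x. i < N \<Longrightarrow> x \<in> K \<Longrightarrow> n i \<bullet> x < b i" "{x. \<forall>i<N. n i \<bullet> x \<le> b i} \<subseteq> \<Omega>"
    using halfspaces_between[OF \<Omega>(1,3) Kc Kconv Kne KO] by blast
  define \<beta> where "\<beta> = (\<lambda>i. b i - n i \<bullet> x0)"
  have \<beta>: "s * \<rho> < \<beta> i" if i: "i < N" for i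
  proof -
    have "x0 + \<rho> *\<^sub>R n i \<in> closure (ball x0 \<rho>)" using \<rho> N(2)[OF i] by (simp add: closure_ball dist_norm)
    then have "x0 + \<rho> *\<^sub>R n i \<in> closure \<Omega>" using closure_mono[OF \<rho>(2)] by blast
    then have "s *\<^sub>R (x0 + \<rho> *\<^sub>R n i) + (x0 - s *\<^sub>R x0) \<in> K" unfolding K_def by blast
    then have "n i \<bullet> (s *\<^sub>R (x0 + \<rho> *\<^sub>R n i) + (x0 - s *\<^sub>R x0)) < b i" by (rule N(3)[OF i])
    then have "n i \<bullet> x0 + s * \<rho> * (n i \<bullet> n i) < b i" by (simp add: algebra_simps inner_add_right inner_diff_right)
    then show ?thesis using N(2)[OF i] by (simp add: \<beta>_def dot_square_norm)
  qed
  \<comment> \<open>Normalised so that every facet lies at level 1, as in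
    \<open>gauge_polytope\<close>; the bound \<beta> > s \<rho> controls the norms.\<close>
  define c where "c = (\<lambda>i. n i /\<^sub>R \<beta> i)"
  have s\<rho>: "0 < s * \<rho>" using s \<rho> by simp
  have c_iff: "c i \<bullet> (x - x0) \<le> 1 \<longleftrightarrow> n i \<bullet> x \<le> b i" if i: "i < N" for i x
  proof -
    have "0 < \<beta> i" using \<beta>[OF i] s\<rho> by simp
    then have "c i \<bullet> (x - x0) \<le> 1 \<longleftrightarrow> n i \<bullet> (x - x0) \<le> \<beta> i" by (simp add: c_def field_simps)
    then show ?thesis by (simp add: \<beta>_def inner_diff_right)
  qed
  have set_eq: "{x. \<forall>i<N. c i \<bullet> (x - x0) \<le> 1} = {x. \<forall>i<N. n i \<bullet> x \<le> b i}" using c_iff by auto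
  interpret gauge_polytope N c x0 "s * \<rho>"
  proof
    show "0 < s * \<rho>" by (rule s\<rho>)
    show "norm (c i) \<le> 1 / (s * \<rho>)" if "i < N" for i
      using \<beta>[OF that] s\<rho> N(2)[OF that] by (simp add: c_def field_simps)
    show "bounded {x. \<forall>i<N. c i \<bullet> (x - x0) \<le> 1}"
      unfolding set_eq using N(4) \<Omega>(3) by (rule bounded_subset[rotated])
  qed
  have PO: "P \<subseteq> \<Omega>" unfolding P_def set_eq by (rule N(4))
  have KP: "K \<subseteq> P" unfolding P_def set_eq using N(3) by (auto intro: less_imp_le)
  have "s ^ DIM('a) * V \<le> measure lborel P"
  proof -
    have "V = measure lebesgue \<Omega>" using \<Omega>(1) by (simp add: V_def measure_completion)
    also have "\<dots> \<le> measure lebesgue (closure \<Omega>)"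
      using \<Omega> closure_subset[of \<Omega>]
      by (intro measure_mono_fmeasurable lmeasurable_compact) (auto simp: compact_closure)
    finally have "V \<le> measure lebesgue (closure \<Omega>)" .
    then have "s ^ DIM('a) * V \<le> s ^ DIM('a) * measure lebesgue (closure \<Omega>)"
      using s by (intro mult_left_mono) auto
    also have "\<dots> = measure lebesgue K"
      unfolding K_def using s by (subst measure_lebesgue_affine) simp
    also have "\<dots> \<le> measure lebesgue P"
      using KP Kc compact_P by (intro measure_mono_fmeasurable lmeasurable_compact) (auto simp: lmeasurable_compact fmeasurableD)
    also have "\<dots> = measure lborel P" by (simp add: measure_completion)
    finally show ?thesis .
  qed
  then have "f s \<le> (s * \<rho>) powr p * measure lborel P powr (p - 1)"
    unfolding f_def using s V0 p by (intro mult_left_mono powr_mono2) auto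
  with s(1) have lt: "C * (DIM('a) * (DIM('a) + p / (p - 1)) powr (p - 1)) < (s * \<rho>) powr p * measure lborel P powr (p - 1)"
    by (simp add: D_def q_def)
  obtain \<phi> where "\<phi> \<in> Cc_infinity \<Omega>"
    "C * (\<integral>x. norm (grad \<phi> x) powr p \<partial>lborel) < (\<integral>x. \<bar>\<phi> x\<bar> \<partial>lborel) powr p"
    by (rule torsion_test_function[OF N(1) p PO C(1) lt])
  then show ?thesis by (rule that)
qed

section \<open>Passage to the completion\<close>

text \<open>The first constant tends to 1 as t tends to 0, and for fixed t the second is finite:
  this takes the place of Minkowski's inequality in limits. It is convexity of the power at |a| / (1
  - t) and |b| / t with weights 1 - t and t.\<close>

lemma powr_norm_add_le:
  fixes a b :: "'b::real_normed_vector"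
  assumes p: "1 < p" and t: "0 < t" "t < 1"
  shows "norm (a + b) powr p \<le> (1 - t) powr (1 - p) * norm a powr p + t powr (1 - p) * norm b powr p"
proof -
  define x y z where "x = norm a / (1 - t)" and "y = norm b / t" and "z = norm a + norm b"
  have nn: "0 \<le> x" "0 \<le> y" "0 \<le> z" using t by (auto simp: x_def y_def z_def)
  have z: "z = (1 - t) * x + t * y" using t by (simp add: x_def y_def z_def)
  have "(1 - t) * (z powr p + p * z powr (p - 1) * (x - z)) + t * (z powr p + p * z powr (p - 1) * (y - z))
      \<le> (1 - t) * x powr p + t * y powr p"
    using t nn by (intro add_mono mult_left_mono powr_tangent p) auto
  also have "(1 - t) * (z powr p + p * z powr (p - 1) * (x - z)) + t * (z powr p + p * z powr (p - 1) * (y - z))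
      = z powr p + p * z powr (p - 1) * ((1 - t) * x + t * y - z)" by (simp add: algebra_simps)
  also have "\<dots> = z powr p" by (simp add: z)
  also have "(1 - t) * x powr p = (1 - t) powr (1 - p) * norm a powr p"
    using t by (simp add: x_def powr_divide powr_diff)
  also have "t * y powr p = t powr (1 - p) * norm b powr p"
    using t by (simp add: y_def powr_divide powr_diff)
  finally have "z powr p \<le> (1 - t) powr (1 - p) * norm a powr p + t powr (1 - p) * norm b powr p" .
  moreover have "norm (a + b) powr p \<le> z powr p"
    unfolding z_def using p by (intro powr_mono2 norm_triangle_ineq) auto
  ultimately show ?thesis by linarith
qed

lemma integrable_powr_norm_diff:
  fixes f g :: "'a \<Rightarrow> 'b::euclidean_space"
  assumes p: "1 < p" and [measurable]: "f \<in> borel_measurable M" "g \<in> borel_measurable M"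
    and "integrable M (\<lambda>x. norm (f x) powr p)" "integrable M (\<lambda>x. norm (g x) powr p)"
  shows "integrable M (\<lambda>x. norm (f x - g x) powr p)"
proof (rule Bochner_Integration.integrable_bound)
  let ?c = "(1 / 2 :: real) powr (1 - p)"
  show "integrable M (\<lambda>x. ?c * norm (f x) powr p + ?c * norm (g x) powr p)"
    using assms by auto
  show "AE x in M. norm (norm (f x - g x) powr p) \<le> norm (?c * norm (f x) powr p + ?c * norm (g x) powr p)"
    using powr_norm_add_le[OF p, of "1/2" "f x" "- g x" for x] by (auto intro: order_trans[OF _ abs_ge_self])
qed measurable

text \<open>For fixed t the error term vanishes as n grows; t is chosen beforehand so that the
  remaining factor is as close to 1 as required. Exchanging \<open>f n\<close> and \<open>u\<close>
  gives the other direction.\<close>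

lemma integral_powr_norm_tendsto:
  fixes f :: "nat \<Rightarrow> 'a \<Rightarrow> 'b::euclidean_space"
  assumes p: "1 < p" and m: "\<And>n. f n \<in> borel_measurable M" "u \<in> borel_measurable M"
    and i: "\<And>n. integrable M (\<lambda>x. norm (f n x) powr p)" "integrable M (\<lambda>x. norm (u x) powr p)"
    and lim: "(\<lambda>n. \<integral>x. norm (f n x - u x) powr p \<partial>M) \<longlonglongrightarrow> 0"
  shows "(\<lambda>n. \<integral>x. norm (f n x) powr p \<partial>M) \<longlonglongrightarrow> (\<integral>x. norm (u x) powr p \<partial>M)"
proof -
  define A where "A = (\<lambda>n. \<integral>x. norm (f n x) powr p \<partial>M)"
  define B where "B = (\<integral>x. norm (u x) powr p \<partial>M)"
  define e where "e = (\<lambda>n. \<integral>x. norm (f n x - u x) powr p \<partial>M)"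
  have e: "e \<longlonglongrightarrow> 0" using lim by (simp add: e_def)
  have id: "integrable M (\<lambda>x. norm (f n x - u x) powr p)" for n
    by (rule integrable_powr_norm_diff[OF p m(1) m(2) i(1) i(2)])
  have up: "A n \<le> (1 - t) powr (1 - p) * B + t powr (1 - p) * e n" if t: "0 < t" "t < 1" for n t
  proof -
    have "A n \<le> (\<integral>x. (1 - t) powr (1 - p) * norm (u x) powr p + t powr (1 - p) * norm (f n x - u x) powr p \<partial>M)"
      unfolding A_def
    proof (rule integral_mono)
      show "norm (f n x) powr p \<le> (1 - t) powr (1 - p) * norm (u x) powr p + t powr (1 - p) * norm (f n x - u x) powr p" for x
        using powr_norm_add_le[OF p t, of "u x" "f n x - u x"] by simp
    qed (use i id in auto)
    then show ?thesis using i id by (simp add: B_def e_def)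
  qed
  have low: "B \<le> (1 - t) powr (1 - p) * A n + t powr (1 - p) * e n" if t: "0 < t" "t < 1" for n t
  proof -
    have "B \<le> (\<integral>x. (1 - t) powr (1 - p) * norm (f n x) powr p + t powr (1 - p) * norm (f n x - u x) powr p \<partial>M)"
      unfolding B_def
    proof (rule integral_mono)
      show "norm (u x) powr p \<le> (1 - t) powr (1 - p) * norm (f n x) powr p + t powr (1 - p) * norm (f n x - u x) powr p" for x
        using powr_norm_add_le[OF p t, of "f n x" "u x - f n x"] by (simp add: norm_minus_commute)
    qed (use i id in auto)
    then show ?thesis using i id by (simp add: A_def e_def)
  qed
  have pick: "\<exists>t. 0 < t \<and> t < 1 \<and> P ((1 - t) powr s * B)" if "eventually P (nhds B)" for P s
  proof -
    have "((\<lambda>t. (1 - t) powr s * B) \<longlongrightarrow> (1 - 0) powr s * B) (at_right 0)" by (intro tendsto_intros) auto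
    then have "eventually (\<lambda>t. P ((1 - t) powr s * B)) (at_right 0)"
      using that by (auto simp: filterlim_iff)
    moreover have "eventually (\<lambda>t. t \<in> {0<..<1}) (at_right (0::real))" by (rule eventually_at_right_real) simp
    ultimately have "eventually (\<lambda>t. t \<in> {0<..<1} \<and> P ((1 - t) powr s * B)) (at_right 0)" by eventually_elim simp
    then show ?thesis using eventually_happens[of _ "at_right (0::real)"] by (fastforce simp: trivial_limit_at_right_real)
  qed
  have "A \<longlonglongrightarrow> B"
  proof (rule order_tendstoI)
    fix a assume "a > B"
    then have "eventually (\<lambda>x. x < a) (nhds B)" by (intro eventually_nhds_in_open[of "{..<a}", simplified]) auto
    from pick[OF this] obtain t where t: "0 < t" "t < 1" "(1 - t) powr (1 - p) * B < a" by blast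
    have "(\<lambda>n. (1 - t) powr (1 - p) * B + t powr (1 - p) * e n) \<longlonglongrightarrow> (1 - t) powr (1 - p) * B + t powr (1 - p) * 0"
      by (intro tendsto_intros e)
    then have "eventually (\<lambda>n. (1 - t) powr (1 - p) * B + t powr (1 - p) * e n < a) sequentially"
      by (rule order_tendstoD) (use t in simp)
    then show "eventually (\<lambda>n. A n < a) sequentially"
      by eventually_elim (use up[OF t(1,2)] in \<open>auto intro: le_less_trans\<close>)
  next
    fix a assume "a < B"
    then have "eventually (\<lambda>x. a < x) (nhds B)" by (intro eventually_nhds_in_open[of "{a<..}", simplified]) auto
    from pick[OF this] obtain t where t: "0 < t" "t < 1" "a < (1 - t) powr (p - 1) * B" by blast
    have "(\<lambda>n. (1 - t) powr (p - 1) * (B - t powr (1 - p) * e n)) \<longlonglongrightarrow> (1 - t) powr (p - 1) * (B - t powr (1 - p) * 0)"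
      by (intro tendsto_intros e)
    then have ev: "eventually (\<lambda>n. a < (1 - t) powr (p - 1) * (B - t powr (1 - p) * e n)) sequentially"
      by (rule order_tendstoD) (use t in simp)
    have "(1 - t) powr (p - 1) * (B - t powr (1 - p) * e n) \<le> A n" for n
    proof -
      have "(1 - t) powr (p - 1) * (B - t powr (1 - p) * e n) \<le> (1 - t) powr (p - 1) * ((1 - t) powr (1 - p) * A n)"
        using low[OF t(1,2), of n] by (intro mult_left_mono) auto
      also have "\<dots> = ((1 - t) powr (p - 1) * (1 - t) powr (1 - p)) * A n" by simp
      also have "(1 - t) powr (p - 1) * (1 - t) powr (1 - p) = 1"
        using t by (subst powr_add[symmetric]) auto
      finally show ?thesis by simp
    qed
    with ev show "eventually (\<lambda>n. a < A n) sequentially"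
      by (auto elim!: eventually_mono intro: less_le_trans)
  qed
  then show ?thesis by (simp add: A_def B_def)
qed

text \<open>Jensen's inequality: the tangent inequality is integrated at the mean value
  \<open>m\<close> of |f|, where the linear term drops out.\<close>

lemma integral_abs_powr_le:
  fixes f :: "'a \<Rightarrow> real"
  assumes p: "1 < p" and [measurable]: "f \<in> borel_measurable M" and i: "integrable M (\<lambda>x. \<bar>f x\<bar> powr p)"
    and fin: "emeasure M (space M) < \<infinity>" and pos: "0 < measure M (space M)"
  shows "integrable M f"
    "(\<integral>x. \<bar>f x\<bar> \<partial>M) powr p \<le> measure M (space M) powr (p - 1) * (\<integral>x. \<bar>f x\<bar> powr p \<partial>M)"
proof -
  define V where "V = measure M (space M)"
  interpret finite_measure M using fin by (intro finite_measureI) auto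
  show fi: "integrable M f"
  proof (rule Bochner_Integration.integrable_bound)
    show "integrable M (\<lambda>x. 1 + \<bar>f x\<bar> powr p)" using i by auto
    have "\<bar>f x\<bar> \<le> 1 + \<bar>f x\<bar> powr p" for x
    proof (cases "\<bar>f x\<bar> \<le> 1")
      case True then show ?thesis using powr_ge_zero[of "\<bar>f x\<bar>" p] by linarith
    next
      case False
      then have "\<bar>f x\<bar> powr 1 \<le> \<bar>f x\<bar> powr p" using p by (intro powr_mono) auto
      then show ?thesis using False by simp
    qed
    then show "AE x in M. norm (f x) \<le> norm (1 + \<bar>f x\<bar> powr p)" by (auto intro: order_trans[OF _ abs_ge_self])
  qed measurable
  define I where "I = (\<integral>x. \<bar>f x\<bar> \<partial>M)"
  define m where "m = I / V"
  have V: "0 < V" using pos by (simp add: V_def)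
  have I: "0 \<le> I" by (simp add: I_def)
  have m: "0 \<le> m" using V I by (simp add: m_def)
  have "(\<integral>x. m powr p + p * m powr (p - 1) * (\<bar>f x\<bar> - m) \<partial>M) \<le> (\<integral>x. \<bar>f x\<bar> powr p \<partial>M)"
    using fi i by (intro integral_mono powr_tangent p m) auto
  also have "(\<integral>x. m powr p + p * m powr (p - 1) * (\<bar>f x\<bar> - m) \<partial>M) = V * m powr p + p * m powr (p - 1) * (I - V * m)"
    using fi by (simp add: V_def I_def mult.commute)
  also have "I - V * m = 0" using V by (simp add: m_def)
  finally have "V * m powr p \<le> (\<integral>x. \<bar>f x\<bar> powr p \<partial>M)" by simp
  moreover have "V * m powr p = I powr p / V powr (p - 1)"
    using V I by (simp add: m_def powr_divide powr_diff)
  ultimately show "I powr p \<le> V powr (p - 1) * (\<integral>x. \<bar>f x\<bar> powr p \<partial>M)"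
    using V by (simp add: divide_le_eq mult.commute)
qed

section \<open>Test functions as elements of the completion, and approximation by them\<close>

lemma lebesgue_on_eq_lborel:
  fixes f :: "'a::euclidean_space \<Rightarrow> real"
  assumes [measurable]: "\<Omega> \<in> sets borel" "f \<in> borel_measurable borel" and zero: "\<And>x. x \<notin> \<Omega> \<Longrightarrow> f x = 0"
  shows "(LINT x|lebesgue_on \<Omega>. f x) = (\<integral>x. f x \<partial>lborel)"
    "integrable lborel f \<Longrightarrow> integrable (lebesgue_on \<Omega>) f"
proof -
  have eq: "(\<lambda>x. indicator \<Omega> x * f x) = f" using zero by (auto simp: indicator_def fun_eq_iff)
  show "(LINT x|lebesgue_on \<Omega>. f x) = (\<integral>x. f x \<partial>lborel)"
    by (subst integral_restrict_space) (auto simp: eq integral_completion)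
  show "integrable (lebesgue_on \<Omega>) f" if "integrable lborel f"
    using that by (subst integrable_restrict_space) (auto simp: eq integrable_completion)
qed

lemma tendsto_0_of_powr:
  assumes p: "0 < (p::real)" and nn: "\<And>n. 0 \<le> x n" and lim: "(\<lambda>n. x n powr (1 / p)) \<longlonglongrightarrow> 0"
  shows "x \<longlonglongrightarrow> 0"
proof -
  have "(\<lambda>n. (x n powr (1 / p)) powr p) \<longlonglongrightarrow> 0 powr p"
    using p by (intro tendsto_powr' lim tendsto_const) auto
  then show ?thesis using p nn by (simp add: powr_powr)
qed

lemma Cc_infinity_lebesgue_on:
  assumes \<phi>: "\<phi> \<in> Cc_infinity \<Omega>" and \<Omega>: "open \<Omega>" and p: "0 < p"
  shows "\<phi> \<in> Lp p \<Omega>" "grad \<phi> \<in> Lp p \<Omega>"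
    "(LINT x|lebesgue_on \<Omega>. \<bar>\<phi> x\<bar> powr p) = (\<integral>x. \<bar>\<phi> x\<bar> powr p \<partial>lborel)"
    "(LINT x|lebesgue_on \<Omega>. norm (grad \<phi> x) powr p) = (\<integral>x. norm (grad \<phi> x) powr p \<partial>lborel)"
    "(LINT x|lebesgue_on \<Omega>. \<bar>\<phi> x\<bar>) = (\<integral>x. \<bar>\<phi> x\<bar> \<partial>lborel)"
proof -
  interpret C1_compact_support \<phi> "grad \<phi>" "closure {x. \<phi> x \<noteq> 0}" by (rule Cc_infinity_C1_closure[OF \<phi>])
  have O: "\<Omega> \<in> sets borel" using \<Omega> by simp
  have m: "f \<in> borel_measurable (lebesgue_on \<Omega>)" if "f \<in> borel_measurable borel" for f :: "'a \<Rightarrow> 'c::euclidean_space"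
    using that by (intro measurable_restrict_space1 measurable_completion) simp
  note z = Cc_infinity_zero[OF \<phi>]
  show "\<phi> \<in> Lp p \<Omega>" "grad \<phi> \<in> Lp p \<Omega>"
    unfolding Lp_def using p z integrable_powr[OF p] by (auto intro!: m lebesgue_on_eq_lborel(2) O)
  show "(LINT x|lebesgue_on \<Omega>. \<bar>\<phi> x\<bar> powr p) = (\<integral>x. \<bar>\<phi> x\<bar> powr p \<partial>lborel)"
    "(LINT x|lebesgue_on \<Omega>. norm (grad \<phi> x) powr p) = (\<integral>x. norm (grad \<phi> x) powr p \<partial>lborel)"
    "(LINT x|lebesgue_on \<Omega>. \<bar>\<phi> x\<bar>) = (\<integral>x. \<bar>\<phi> x\<bar> \<partial>lborel)"
    using z p by (auto intro!: lebesgue_on_eq_lborel(1) O)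
qed

lemma Cc_infinity_W1p_0:
  assumes \<phi>: "\<phi> \<in> Cc_infinity \<Omega>" and \<Omega>: "open \<Omega>" and p: "0 < p"
  shows "(\<phi>, grad \<phi>) \<in> W1p_0 p \<Omega>"
  unfolding W1p_0_def using Cc_infinity_lebesgue_on[OF assms] \<phi>
  by (auto simp: Lp_norm_def intro!: exI[of _ "\<lambda>_. \<phi>"])

text \<open>One sequence serves all three integrals. Convergence of the integrals of |\<phi>| is not
  in the definition of the completion; it follows from convergence in \<open>Lp\<close> by
  \<open>integral_abs_powr_le\<close>, as \<Omega> has finite measure.\<close>

lemma W1p_0_approx:
  fixes u :: "'a::euclidean_space \<Rightarrow> real"
  assumes uG: "(u, G) \<in> W1p_0 p \<Omega>" and \<Omega>: "open \<Omega>" "bounded \<Omega>" "\<Omega> \<noteq> {}" and p: "1 < p"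
  obtains \<phi> where "\<forall>n::nat. \<phi> n \<in> Cc_infinity \<Omega>"
    "(\<lambda>n. \<integral>x. \<bar>\<phi> n x\<bar> powr p \<partial>lborel) \<longlonglongrightarrow> (LINT x|lebesgue_on \<Omega>. \<bar>u x\<bar> powr p)"
    "(\<lambda>n. \<integral>x. norm (grad (\<phi> n) x) powr p \<partial>lborel) \<longlonglongrightarrow> (LINT x|lebesgue_on \<Omega>. norm (G x) powr p)"
    "(\<lambda>n. \<integral>x. \<bar>\<phi> n x\<bar> \<partial>lborel) \<longlonglongrightarrow> (LINT x|lebesgue_on \<Omega>. \<bar>u x\<bar>)"
proof -
  define M where "M = lebesgue_on \<Omega>"
  have uL: "u \<in> Lp p \<Omega>" "G \<in> Lp p \<Omega>"
    and "\<exists>\<phi>. (\<forall>n::nat. \<phi> n \<in> Cc_infinity \<Omega>) \<and> (\<lambda>n. Lp_norm p \<Omega> (\<lambda>x. \<phi> n x - u x)) \<longlonglongrightarrow> 0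
      \<and> (\<lambda>n. Lp_norm p \<Omega> (\<lambda>x. grad (\<phi> n) x - G x)) \<longlonglongrightarrow> 0"
    using uG unfolding W1p_0_def by blast+
  then obtain \<phi> where "(\<forall>n::nat. \<phi> n \<in> Cc_infinity \<Omega>) \<and> (\<lambda>n. Lp_norm p \<Omega> (\<lambda>x. \<phi> n x - u x)) \<longlonglongrightarrow> 0
      \<and> (\<lambda>n. Lp_norm p \<Omega> (\<lambda>x. grad (\<phi> n) x - G x)) \<longlonglongrightarrow> 0"
    by (elim exE)
  then have \<phi>: "\<phi> n \<in> Cc_infinity \<Omega>" and l1: "(\<lambda>n. Lp_norm p \<Omega> (\<lambda>x. \<phi> n x - u x)) \<longlonglongrightarrow> 0"
    and l2: "(\<lambda>n. Lp_norm p \<Omega> (\<lambda>x. grad (\<phi> n) x - G x)) \<longlonglongrightarrow> 0" for n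
    by simp_all
  have u: "u \<in> borel_measurable M" "integrable M (\<lambda>x. norm (u x) powr p)"
    and G: "G \<in> borel_measurable M" "integrable M (\<lambda>x. norm (G x) powr p)"
    using uL by (simp_all add: Lp_def M_def)
  have p0: "0 < p" using p by simp
  note on = Cc_infinity_lebesgue_on[OF \<phi> \<Omega>(1) p0]
  have f: "\<phi> n \<in> borel_measurable M" "integrable M (\<lambda>x. norm (\<phi> n x) powr p)" for n
    using on(1)[of n] by (auto simp: Lp_def M_def)
  have g: "grad (\<phi> n) \<in> borel_measurable M" "integrable M (\<lambda>x. norm (grad (\<phi> n) x) powr p)" for n
    using on(2)[of n] by (auto simp: Lp_def M_def)
  have e1: "(\<lambda>n. \<integral>x. norm (\<phi> n x - u x) powr p \<partial>M) \<longlonglongrightarrow> 0"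
    using l1 unfolding Lp_norm_def M_def by (rule tendsto_0_of_powr[OF p0, rotated]) simp
  have e2: "(\<lambda>n. \<integral>x. norm (grad (\<phi> n) x - G x) powr p \<partial>M) \<longlonglongrightarrow> 0"
    using l2 unfolding Lp_norm_def M_def by (rule tendsto_0_of_powr[OF p0, rotated]) simp
  have c1: "(\<lambda>n. \<integral>x. norm (\<phi> n x) powr p \<partial>M) \<longlonglongrightarrow> (\<integral>x. norm (u x) powr p \<partial>M)"
    by (rule integral_powr_norm_tendsto[OF p f(1) u(1) f(2) u(2) e1])
  have c2: "(\<lambda>n. \<integral>x. norm (grad (\<phi> n) x) powr p \<partial>M) \<longlonglongrightarrow> (\<integral>x. norm (G x) powr p \<partial>M)"
    by (rule integral_powr_norm_tendsto[OF p g(1) G(1) g(2) G(2) e2])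
  have em: "emeasure M (space M) = emeasure lborel \<Omega>"
    using \<Omega>(1) by (simp add: M_def emeasure_restrict_space space_restrict_space)
  have fin: "emeasure M (space M) < \<infinity>" unfolding em using \<Omega>(2) by (rule emeasure_bounded_finite)
  have pos: "0 < measure M (space M)"
    using measure_open_pos[OF \<Omega>] em by (simp add: measure_def)
  have D: "(\<lambda>x. \<phi> n x - u x) \<in> borel_measurable M" "integrable M (\<lambda>x. \<bar>\<phi> n x - u x\<bar> powr p)" for n
    using f(1) u(1) integrable_powr_norm_diff[OF p f(1) u(1) f(2) u(2)] by auto
  note J = integral_abs_powr_le[OF p _ _ fin pos]
  have lim: "(\<lambda>n. measure M (space M) powr (p - 1) * (\<integral>x. \<bar>\<phi> n x - u x\<bar> powr p \<partial>M)) \<longlonglongrightarrow> measure M (space M) powr (p - 1) * 0"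
    using e1 by (intro tendsto_mult tendsto_const) simp
  have "(\<lambda>n. (\<integral>x. \<bar>\<phi> n x - u x\<bar> \<partial>M) powr p) \<longlonglongrightarrow> 0"
    by (rule tendsto_sandwich[OF _ _ tendsto_const lim[unfolded mult_zero_right]])
      (intro always_eventually allI powr_ge_zero J(2)[OF D])+
  then have e3: "(\<lambda>n. \<integral>x. \<bar>\<phi> n x - u x\<bar> \<partial>M) \<longlonglongrightarrow> 0"
    by - (rule tendsto_0_of_powr[where p = "1 / p"], use p0 in simp_all)
  have fi: "integrable M (\<phi> n)" "integrable M u" for n
    using J(1)[OF f(1)] J(1)[OF u(1)] f(2) u(2) by auto
  have "\<bar>(\<integral>x. \<bar>\<phi> n x\<bar> \<partial>M) - (\<integral>x. \<bar>u x\<bar> \<partial>M)\<bar> \<le> (\<integral>x. \<bar>\<phi> n x - u x\<bar> \<partial>M)" for n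
  proof -
    have "(\<integral>x. \<bar>\<phi> n x\<bar> \<partial>M) - (\<integral>x. \<bar>u x\<bar> \<partial>M) = (\<integral>x. \<bar>\<phi> n x\<bar> - \<bar>u x\<bar> \<partial>M)" using fi by simp
    also have "\<bar>\<dots>\<bar> \<le> (\<integral>x. \<bar>\<bar>\<phi> n x\<bar> - \<bar>u x\<bar>\<bar> \<partial>M)" by (rule integral_abs_bound)
    also have "\<dots> \<le> (\<integral>x. \<bar>\<phi> n x - u x\<bar> \<partial>M)"
      using fi by (intro integral_mono abs_triangle_ineq3) auto
    finally show ?thesis .
  qed
  then have "(\<lambda>n. (\<integral>x. \<bar>\<phi> n x\<bar> \<partial>M) - (\<integral>x. \<bar>u x\<bar> \<partial>M)) \<longlonglongrightarrow> 0"
    by (intro Lim_null_comparison[OF _ e3]) (auto intro!: always_eventually)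
  then have c3: "(\<lambda>n. \<integral>x. \<bar>\<phi> n x\<bar> \<partial>M) \<longlonglongrightarrow> (\<integral>x. \<bar>u x\<bar> \<partial>M)"
    by (simp add: LIM_zero_iff)
  show ?thesis
  proof (rule that)
    show "\<forall>n. \<phi> n \<in> Cc_infinity \<Omega>" using \<phi> by blast
    show "(\<lambda>n. \<integral>x. \<bar>\<phi> n x\<bar> powr p \<partial>lborel) \<longlonglongrightarrow> (LINT x|lebesgue_on \<Omega>. \<bar>u x\<bar> powr p)"
      using c1 unfolding M_def real_norm_def on(3) .
    show "(\<lambda>n. \<integral>x. norm (grad (\<phi> n) x) powr p \<partial>lborel) \<longlonglongrightarrow> (LINT x|lebesgue_on \<Omega>. norm (G x) powr p)"
      using c2 unfolding M_def on(4) .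
    show "(\<lambda>n. \<integral>x. \<bar>\<phi> n x\<bar> \<partial>lborel) \<longlonglongrightarrow> (LINT x|lebesgue_on \<Omega>. \<bar>u x\<bar>)"
      using c3 unfolding M_def on(5) .
  qed
qed

section \<open>From inequalities for test functions to the variational quantities and back\<close>

lemma W1p_0_eigenvalue_bound:
  assumes uG: "(u, G) \<in> W1p_0 p \<Omega>" and \<Omega>: "open \<Omega>" "bounded \<Omega>" "\<Omega> \<noteq> {}" and p: "1 < p"
    and A: "\<And>\<phi>. \<phi> \<in> Cc_infinity \<Omega> \<Longrightarrow> A * (\<integral>x. \<bar>\<phi> x\<bar> powr p \<partial>lborel) \<le> (\<integral>x. norm (grad \<phi> x) powr p \<partial>lborel)"
  shows "A * (LINT x|lebesgue_on \<Omega>. \<bar>u x\<bar> powr p) \<le> (LINT x|lebesgue_on \<Omega>. norm (G x) powr p)"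
proof -
  obtain \<phi> where \<phi>: "\<forall>n::nat. \<phi> n \<in> Cc_infinity \<Omega>"
    and l1: "(\<lambda>n. \<integral>x. \<bar>\<phi> n x\<bar> powr p \<partial>lborel) \<longlonglongrightarrow> (LINT x|lebesgue_on \<Omega>. \<bar>u x\<bar> powr p)"
    and l2: "(\<lambda>n. \<integral>x. norm (grad (\<phi> n) x) powr p \<partial>lborel) \<longlonglongrightarrow> (LINT x|lebesgue_on \<Omega>. norm (G x) powr p)"
    and "(\<lambda>n. \<integral>x. \<bar>\<phi> n x\<bar> \<partial>lborel) \<longlonglongrightarrow> (LINT x|lebesgue_on \<Omega>. \<bar>u x\<bar>)"
    by (rule W1p_0_approx[OF uG \<Omega> p])
  show ?thesis
    by (rule LIMSEQ_le[OF tendsto_mult[OF tendsto_const l1] l2]) (use A \<phi> in auto)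
qed

lemma W1p_0_torsion_bound:
  assumes uG: "(u, G) \<in> W1p_0 p \<Omega>" and \<Omega>: "open \<Omega>" "bounded \<Omega>" "\<Omega> \<noteq> {}" and p: "1 < p"
    and C: "\<And>\<phi>. \<phi> \<in> Cc_infinity \<Omega> \<Longrightarrow> (\<integral>x. \<bar>\<phi> x\<bar> \<partial>lborel) powr p \<le> C * (\<integral>x. norm (grad \<phi> x) powr p \<partial>lborel)"
  shows "(LINT x|lebesgue_on \<Omega>. \<bar>u x\<bar>) powr p \<le> C * (LINT x|lebesgue_on \<Omega>. norm (G x) powr p)"
proof -
  obtain \<phi> where \<phi>: "\<forall>n::nat. \<phi> n \<in> Cc_infinity \<Omega>"
    and "(\<lambda>n. \<integral>x. \<bar>\<phi> n x\<bar> powr p \<partial>lborel) \<longlonglongrightarrow> (LINT x|lebesgue_on \<Omega>. \<bar>u x\<bar> powr p)"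
    and l2: "(\<lambda>n. \<integral>x. norm (grad (\<phi> n) x) powr p \<partial>lborel) \<longlonglongrightarrow> (LINT x|lebesgue_on \<Omega>. norm (G x) powr p)"
    and l3: "(\<lambda>n. \<integral>x. \<bar>\<phi> n x\<bar> \<partial>lborel) \<longlonglongrightarrow> (LINT x|lebesgue_on \<Omega>. \<bar>u x\<bar>)"
    by (rule W1p_0_approx[OF uG \<Omega> p])
  have "(\<lambda>n. (\<integral>x. \<bar>\<phi> n x\<bar> \<partial>lborel) powr p) \<longlonglongrightarrow> (LINT x|lebesgue_on \<Omega>. \<bar>u x\<bar>) powr p"
    using p by (intro tendsto_powr' l3 tendsto_const) auto
  then show ?thesis
    by (rule LIMSEQ_le[OF _ tendsto_mult[OF tendsto_const l2]]) (use C \<phi> in auto)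
qed

lemma W1p_0_nonzero_pos:
  assumes "(u, G) \<in> W1p_0_nonzero p \<Omega>"
  shows "0 < (LINT x|lebesgue_on \<Omega>. \<bar>u x\<bar> powr p)"
proof -
  have u: "integrable (lebesgue_on \<Omega>) (\<lambda>x. \<bar>u x\<bar> powr p)" and nz: "\<not> (AE x in lebesgue_on \<Omega>. u x = 0)"
    using assms by (auto simp: W1p_0_nonzero_def W1p_0_def Lp_def)
  have "(LINT x|lebesgue_on \<Omega>. \<bar>u x\<bar> powr p) \<noteq> 0"
    using nz integral_nonneg_eq_0_iff_AE[OF u] by simp
  then show ?thesis by (simp add: less_le)
qed

lemma lambda_p_ge:
  fixes \<Omega> :: "'a::euclidean_space set"
  assumes \<Omega>: "open \<Omega>" "bounded \<Omega>" "\<Omega> \<noteq> {}" and p: "1 < p"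
    and A: "\<And>\<phi>. \<phi> \<in> Cc_infinity \<Omega> \<Longrightarrow> A * (\<integral>x. \<bar>\<phi> x\<bar> powr p \<partial>lborel) \<le> (\<integral>x. norm (grad \<phi> x) powr p \<partial>lborel)"
  shows "ereal A \<le> lambda_p p \<Omega>"
  unfolding lambda_p_def
proof (rule INF_greatest, clarify)
  fix u G assume uG: "(u, G) \<in> W1p_0_nonzero p \<Omega>"
  then have "(u, G) \<in> W1p_0 p \<Omega>" by (simp add: W1p_0_nonzero_def)
  from W1p_0_eigenvalue_bound[OF this \<Omega> p A] W1p_0_nonzero_pos[OF uG]
  show "ereal A \<le> ereal ((LINT x|lebesgue_on \<Omega>. norm (G x) powr p) / (LINT x|lebesgue_on \<Omega>. \<bar>u x\<bar> powr p))"
    by (simp add: le_divide_eq)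
qed

lemma lambda_p_le:
  assumes "ereal l \<le> lambda_p p \<Omega>" and uG: "(u, G) \<in> W1p_0_nonzero p \<Omega>"
  shows "l * (LINT x|lebesgue_on \<Omega>. \<bar>u x\<bar> powr p) \<le> (LINT x|lebesgue_on \<Omega>. norm (G x) powr p)"
proof -
  have "ereal l \<le> ereal ((LINT x|lebesgue_on \<Omega>. norm (G x) powr p) / (LINT x|lebesgue_on \<Omega>. \<bar>u x\<bar> powr p))"
    by (rule order_trans[OF assms(1)]) (unfold lambda_p_def, rule INF_lower2[OF uG], simp)
  then show ?thesis using W1p_0_nonzero_pos[OF uG] by (simp add: le_divide_eq)
qed

lemma lambda_p_le_Cc_infinity:
  assumes l: "ereal l \<le> lambda_p p \<Omega>" and \<phi>: "\<phi> \<in> Cc_infinity \<Omega>" and \<Omega>: "open \<Omega>" and p: "0 < p"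
  shows "l * (\<integral>x. \<bar>\<phi> x\<bar> powr p \<partial>lborel) \<le> (\<integral>x. norm (grad \<phi> x) powr p \<partial>lborel)"
proof (cases "AE x in lebesgue_on \<Omega>. \<phi> x = 0")
  case True
  then have "(LINT x|lebesgue_on \<Omega>. \<bar>\<phi> x\<bar> powr p) = 0"
    using p by (intro integral_eq_zero_AE) auto
  then show ?thesis using Cc_infinity_lebesgue_on(3)[OF \<phi> \<Omega> p] by simp
next
  case False
  then have "(\<phi>, grad \<phi>) \<in> W1p_0_nonzero p \<Omega>"
    using Cc_infinity_W1p_0[OF \<phi> \<Omega> p] by (simp add: W1p_0_nonzero_def)
  from lambda_p_le[OF l this] show ?thesis
    using Cc_infinity_lebesgue_on[OF \<phi> \<Omega> p] by simp
qed

section \<open>Scaling to the unit ball\<close>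

lemma GDERIV_affine:
  assumes "\<And>x. GDERIV \<phi> x :> g x"
  shows "GDERIV (\<lambda>x. \<phi> (a + s *\<^sub>R x)) x :> s *\<^sub>R g (a + s *\<^sub>R x)"
proof -
  have "((\<lambda>x. \<phi> (a + s *\<^sub>R x)) has_derivative (\<lambda>h. (s *\<^sub>R h) \<bullet> g (a + s *\<^sub>R x))) (at x)"
  proof (rule has_derivative_compose[of "\<lambda>x. a + s *\<^sub>R x" "\<lambda>h. s *\<^sub>R h" x UNIV \<phi>])
    show "((\<lambda>x. a + s *\<^sub>R x) has_derivative (\<lambda>h. s *\<^sub>R h)) (at x)"
      by (auto intro!: derivative_eq_intros)
    show "(\<phi> has_derivative (\<lambda>t. t \<bullet> g (a + s *\<^sub>R x))) (at (a + s *\<^sub>R x))"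
      using assms by (simp add: gderiv_def)
  qed
  then show ?thesis by (simp add: gderiv_def)
qed

lemma C_k_affine: "C_k k \<phi> \<Longrightarrow> C_k k (\<lambda>x. \<phi> (a + s *\<^sub>R x))"
proof (induction k arbitrary: \<phi>)
  case 0
  then show ?case by (auto intro!: continuous_on_compose2[of UNIV \<phi>] continuous_intros)
next
  case (Suc k)
  then obtain g where g: "\<And>x. GDERIV \<phi> x :> g x" "\<forall>b\<in>Basis. C_k k (\<lambda>x. g x \<bullet> b)" by auto
  have "GDERIV (\<lambda>x. \<phi> (a + s *\<^sub>R x)) x :> s *\<^sub>R g (a + s *\<^sub>R x)" for x
    by (rule GDERIV_affine[OF g(1)])
  moreover have "\<forall>b\<in>Basis. C_k k (\<lambda>x. (s *\<^sub>R g (a + s *\<^sub>R x)) \<bullet> b)"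
    using Suc.IH[of "\<lambda>x. g x \<bullet> b" for b] g(2) by (auto intro!: C_k_mult C_k_const)
  ultimately show ?case by (auto intro!: exI[of _ "\<lambda>x. s *\<^sub>R g (a + s *\<^sub>R x)"])
qed

text \<open>A test function of the unit ball is transplanted to \<open>ball x0 \<rho>\<close> and is
  then a test function of \<Omega>. Both integrals pick up the same volume factor, and the gradient
  contributes the power of \<rho>.\<close>

lemma lambda_p_ball_scaling:
  fixes \<Omega> :: "'a::euclidean_space set"
  assumes l: "ereal l \<le> lambda_p p \<Omega>" and \<Omega>: "open \<Omega>" and \<rho>: "0 < \<rho>" "ball x0 \<rho> \<subseteq> \<Omega>" and p: "1 < p"
  shows "ereal (l * \<rho> powr p) \<le> lambda_p p (ball (0::'a) 1)"
proof (rule lambda_p_ge)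
  fix \<phi> :: "'a \<Rightarrow> real" assume \<phi>: "\<phi> \<in> Cc_infinity (ball 0 1)"
  \<comment> \<open>\<open>a + s *\<^sub>R x\<close> is (x - x0) / \<rho>, the map from
    \<open>ball x0 \<rho>\<close> onto the unit ball.\<close>
  define a s where "a = - (x0 /\<^sub>R \<rho>)" and "s = 1 / \<rho>"
  define \<psi> where "\<psi> = (\<lambda>x. \<phi> (a + s *\<^sub>R x))"
  interpret C1_compact_support \<phi> "grad \<phi>" "closure {x. \<phi> x \<noteq> 0}" by (rule Cc_infinity_C1_closure[OF \<phi>])
  have p0: "0 < p" using p by simp
  have s: "0 < s" using \<rho> by (simp add: s_def)
  have forth: "\<rho> *\<^sub>R (a + s *\<^sub>R x) + x0 = x" for x
    using \<rho> by (simp add: a_def s_def scaleR_right_diff_distrib scaleR_add_right)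
  let ?S = "closure {x. \<phi> x \<noteq> 0}"
  have S: "compact ?S" "?S \<subseteq> ball 0 1" using \<phi> by (auto simp: Cc_infinity_def)
  have \<psi>: "\<psi> \<in> Cc_infinity \<Omega>"
  proof (rule Cc_infinityI[where S = "(\<lambda>y. \<rho> *\<^sub>R y + x0) ` ?S"])
    show "C_k k \<psi>" for k
      unfolding \<psi>_def using \<phi> by (intro C_k_affine) (simp add: Cc_infinity_def)
    show "compact ((\<lambda>y. \<rho> *\<^sub>R y + x0) ` ?S)" using S(1) by (intro compact_continuous_image continuous_intros) auto
    have "\<rho> *\<^sub>R y + x0 \<in> ball x0 \<rho>" if "y \<in> ball 0 1" for y
      using that \<rho> by (simp add: dist_norm)
    then show "(\<lambda>y. \<rho> *\<^sub>R y + x0) ` ?S \<subseteq> \<Omega>" using S(2) \<rho>(2) by blast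
    show "\<psi> x = 0" if x: "x \<notin> (\<lambda>y. \<rho> *\<^sub>R y + x0) ` ?S" for x
    proof -
      have "a + s *\<^sub>R x \<notin> ?S" using x forth[of x] by (metis image_eqI)
      then show ?thesis unfolding \<psi>_def by (rule zero(1))
    qed
  qed
  have g\<psi>: "grad \<psi> x = s *\<^sub>R grad \<phi> (a + s *\<^sub>R x)" for x
    unfolding \<psi>_def by (intro grad_eq GDERIV_affine deriv)
  have "(\<integral>x. \<bar>\<phi> x\<bar> powr p \<partial>lborel) = s ^ DIM('a) * (\<integral>x. \<bar>\<psi> x\<bar> powr p \<partial>lborel)"
    unfolding \<psi>_def using s by (subst lborel_integral_affine[of _ s a]) auto
  moreover have "(\<integral>x. norm (grad \<psi> x) powr p \<partial>lborel) = s powr p * (\<integral>x. norm (grad \<phi> (a + s *\<^sub>R x)) powr p \<partial>lborel)"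
    unfolding g\<psi> using s by (simp add: powr_mult)
  moreover have "(\<integral>x. norm (grad \<phi> x) powr p \<partial>lborel) = s ^ DIM('a) * (\<integral>x. norm (grad \<phi> (a + s *\<^sub>R x)) powr p \<partial>lborel)"
    using s by (subst lborel_integral_affine[of _ s a]) auto
  moreover have "l * (\<integral>x. \<bar>\<psi> x\<bar> powr p \<partial>lborel) \<le> (\<integral>x. norm (grad \<psi> x) powr p \<partial>lborel)"
    by (rule lambda_p_le_Cc_infinity[OF l \<psi> \<Omega> p0])
  moreover have "s powr p * \<rho> powr p = 1" using \<rho> by (simp add: s_def powr_divide)
  ultimately show "l * \<rho> powr p * (\<integral>x. \<bar>\<phi> x\<bar> powr p \<partial>lborel) \<le> (\<integral>x. norm (grad \<phi> x) powr p \<partial>lborel)"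
  proof -
    define X Y Z where "X = (\<integral>x. \<bar>\<psi> x\<bar> powr p \<partial>lborel)" and "Y = (\<integral>x. norm (grad \<phi> (a + s *\<^sub>R x)) powr p \<partial>lborel)"
      and "Z = s ^ DIM('a) * \<rho> powr p"
    assume *: "(\<integral>x. \<bar>\<phi> x\<bar> powr p \<partial>lborel) = s ^ DIM('a) * (\<integral>x. \<bar>\<psi> x\<bar> powr p \<partial>lborel)"
      "(\<integral>x. norm (grad \<psi> x) powr p \<partial>lborel) = s powr p * (\<integral>x. norm (grad \<phi> (a + s *\<^sub>R x)) powr p \<partial>lborel)"
      "(\<integral>x. norm (grad \<phi> x) powr p \<partial>lborel) = s ^ DIM('a) * (\<integral>x. norm (grad \<phi> (a + s *\<^sub>R x)) powr p \<partial>lborel)"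
      "l * (\<integral>x. \<bar>\<psi> x\<bar> powr p \<partial>lborel) \<le> (\<integral>x. norm (grad \<psi> x) powr p \<partial>lborel)"
      "s powr p * \<rho> powr p = 1"
    have "Z * (l * X) \<le> Z * (s powr p * Y)"
      using * s unfolding X_def Y_def Z_def by (intro mult_left_mono) auto
    also have "\<dots> = s ^ DIM('a) * (s powr p * \<rho> powr p) * Y" by (simp add: Z_def)
    finally have "Z * (l * X) \<le> s ^ DIM('a) * Y" unfolding *(5) by simp
    then show ?thesis unfolding *(1,3) X_def Y_def Z_def by (simp add: mult_ac)
  qed
qed (use p in auto)

text \<open>The first three bounds share one inradius, the last is Jensen's. That both quantities
  are real numbers belongs to the conclusion, so that the final computation can leave
  \<open>ereal\<close>.\<close>

lemma convex_domain_bounds: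
  fixes \<Omega> :: "'a::euclidean_space set" and p q :: real
  assumes \<Omega>: "\<Omega> \<in> convex_domains" and p: "1 < p"
  defines "q \<equiv> p / (p - 1)" and "V \<equiv> measure lborel \<Omega>"
  obtains \<rho> x0 l T where "0 < \<rho>" "ball x0 \<rho> \<subseteq> \<Omega>" "lambda_p p \<Omega> = ereal l" "T_p p \<Omega> = ereal T"
    "(pi_p p / 2 / \<rho>) powr p \<le> l" "\<rho> powr p * V powr (p - 1) / (DIM('a) * (DIM('a) + q) powr (p - 1)) \<le> T"
    "T \<le> (\<rho> powr q * V / (q + 1)) powr (p - 1)" "T \<le> V powr (p - 1) / l"
proof -
  have o: "open \<Omega>" and c: "convex \<Omega>" and b: "bounded \<Omega>" and ne: "\<Omega> \<noteq> {}"
    using \<Omega> by (auto simp: convex_domains_def)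
  have p0: "0 < p" using p by simp
  have V: "0 < V" unfolding V_def by (rule measure_open_pos[OF o b ne])
  have q: "1 < q" using p by (simp add: q_def field_simps)
  obtain x0 \<rho> where \<rho>: "0 < \<rho>" "ball x0 \<rho> \<subseteq> \<Omega>" "\<forall>x r. 0 < r \<and> ball x r \<subseteq> \<Omega> \<longrightarrow> r \<le> \<rho>"
    using inradius_attained[OF o b ne] by metis
  define L where "L = (pi_p p / 2 / \<rho>) powr p"
  have L: "0 < L" using pi_p_pos[OF p] \<rho>(1) by (simp add: L_def)
  have lam: "ereal L \<le> lambda_p p \<Omega>"
    unfolding L_def by (intro lambda_p_ge[OF o b ne p] eigenvalue_lower_bound[OF _ o c b ne \<rho>(1,3) p])
  define U where "U = (\<rho> powr q * V / (q + 1)) powr (p - 1)"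
  have quot: "(LINT x|lebesgue_on \<Omega>. \<bar>u x\<bar>) powr p / (LINT x|lebesgue_on \<Omega>. norm (G x) powr p) \<le> U"
    if uG: "(u, G) \<in> W1p_0_nonzero p \<Omega>" for u G
  proof -
    have "(LINT x|lebesgue_on \<Omega>. \<bar>u x\<bar>) powr p \<le> U * (LINT x|lebesgue_on \<Omega>. norm (G x) powr p)"
      unfolding U_def V_def q_def
      by (intro W1p_0_torsion_bound[OF _ o b ne p] torsion_upper_bound[OF _ o c b ne \<rho>(1,3) p])
        (use uG in \<open>simp add: W1p_0_nonzero_def\<close>)
    \<comment> \<open>A quotient by 0 is 0 in HOL, so the bound on the quotient needs a positive
      gradient integral; the lower bound on \<lambda> supplies it.\<close>
    moreover have "0 < (LINT x|lebesgue_on \<Omega>. norm (G x) powr p)"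
      using lambda_p_le[OF lam uG] mult_pos_pos[OF L W1p_0_nonzero_pos[OF uG]] by linarith
    ultimately show ?thesis by (simp add: divide_le_eq)
  qed
  have upper: "T_p p \<Omega> \<le> ereal U"
    unfolding T_p_def by (rule SUP_least) (use quot in auto)
  define R where "R = \<rho> powr p * V powr (p - 1) / (DIM('a) * (DIM('a) + q) powr (p - 1))"
  have den: "0 < DIM('a) * (DIM('a) + q) powr (p - 1)" using q by simp
  have R: "0 < R" unfolding R_def using \<rho>(1) V den by simp
  have test: "\<exists>u G. (u, G) \<in> W1p_0_nonzero p \<Omega> \<and>
      C \<le> (LINT x|lebesgue_on \<Omega>. \<bar>u x\<bar>) powr p / (LINT x|lebesgue_on \<Omega>. norm (G x) powr p)"
    if C: "0 \<le> C" "C < R" for C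
  proof -
    have "C * (DIM('a) * (DIM('a) + p / (p - 1)) powr (p - 1)) < \<rho> powr p * measure lborel \<Omega> powr (p - 1)"
      using C(2) den by (simp add: R_def pos_less_divide_eq V_def q_def)
    then obtain \<phi> where \<phi>: "\<phi> \<in> Cc_infinity \<Omega>"
      "C * (\<integral>x. norm (grad \<phi> x) powr p \<partial>lborel) < (\<integral>x. \<bar>\<phi> x\<bar> \<partial>lborel) powr p"
      by (rule torsion_lower_bound[OF o c b \<rho>(1,2) p C(1)])
    note on = Cc_infinity_lebesgue_on[OF \<phi>(1) o p0]
    have X0: "0 \<le> (\<integral>x. norm (grad \<phi> x) powr p \<partial>lborel)" by simp
    then have "(LINT x|lebesgue_on \<Omega>. \<bar>\<phi> x\<bar>) \<noteq> 0"
      using \<phi>(2) mult_nonneg_nonneg[OF C(1) X0] unfolding on(5) by auto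
    then have "\<not> (AE x in lebesgue_on \<Omega>. \<phi> x = 0)"
      using integral_eq_zero_AE[of "\<lambda>x. \<bar>\<phi> x\<bar>" "lebesgue_on \<Omega>"] by auto
    then have nz: "(\<phi>, grad \<phi>) \<in> W1p_0_nonzero p \<Omega>"
      using Cc_infinity_W1p_0[OF \<phi>(1) o p0] by (simp add: W1p_0_nonzero_def)
    have "0 < (LINT x|lebesgue_on \<Omega>. norm (grad \<phi> x) powr p)"
      using lambda_p_le[OF lam nz] mult_pos_pos[OF L W1p_0_nonzero_pos[OF nz]] by linarith
    then have "C \<le> (LINT x|lebesgue_on \<Omega>. \<bar>\<phi> x\<bar>) powr p / (LINT x|lebesgue_on \<Omega>. norm (grad \<phi> x) powr p)"
      using \<phi>(2) unfolding on by (simp add: le_divide_eq)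
    with nz show ?thesis by blast
  qed
  have lower: "ereal C \<le> T_p p \<Omega>" if C: "0 \<le> C" "C < R" for C
  proof -
    obtain u G where uG: "(u, G) \<in> W1p_0_nonzero p \<Omega>"
      "C \<le> (LINT x|lebesgue_on \<Omega>. \<bar>u x\<bar>) powr p / (LINT x|lebesgue_on \<Omega>. norm (G x) powr p)"
      using test[OF C] by blast
    show ?thesis
      unfolding T_p_def by (rule SUP_upper2[OF uG(1)]) (use uG(2) in simp)
  qed
  \<comment> \<open>One nonzero element excludes that \<lambda> is the infimum of the empty set,
    which is \<infinity>.\<close>
  obtain u0 G0 where nz: "(u0, G0) \<in> W1p_0_nonzero p \<Omega>" using test[of 0] R by auto
  have "lambda_p p \<Omega> \<le> ereal ((LINT x|lebesgue_on \<Omega>. norm (G0 x) powr p) / (LINT x|lebesgue_on \<Omega>. \<bar>u0 x\<bar> powr p))"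
    unfolding lambda_p_def by (rule INF_lower2[OF nz]) simp
  with lam obtain l where l: "lambda_p p \<Omega> = ereal l" by (cases "lambda_p p \<Omega>") auto
  have "ereal 0 \<le> T_p p \<Omega>" using lower[of 0] R by simp
  with upper obtain T where T: "T_p p \<Omega> = ereal T" by (cases "T_p p \<Omega>") auto
  have lL: "L \<le> l" using lam l by simp
  have RT: "R \<le> T"
    by (rule dense_le_bounded[OF R]) (use lower T in auto)
  have "T_p p \<Omega> \<le> ereal (V powr (p - 1) / l)"
    unfolding T_p_def
  proof (rule SUP_least, clarify)
    fix u G assume uG: "(u, G) \<in> W1p_0_nonzero p \<Omega>"
    define X Y where "X = (LINT x|lebesgue_on \<Omega>. norm (G x) powr p)" and "Y = (LINT x|lebesgue_on \<Omega>. \<bar>u x\<bar> powr p)"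
    have lXY: "l * Y \<le> X" unfolding X_def Y_def by (rule lambda_p_le[OF _ uG]) (simp add: l)
    have Y: "0 < Y" unfolding Y_def by (rule W1p_0_nonzero_pos[OF uG])
    have X: "0 < X" using lXY mult_pos_pos[of l Y] Y L lL by linarith
    have em: "emeasure (lebesgue_on \<Omega>) (space (lebesgue_on \<Omega>)) = emeasure lborel \<Omega>"
      using o by (simp add: emeasure_restrict_space space_restrict_space)
    have u: "u \<in> borel_measurable (lebesgue_on \<Omega>)" "integrable (lebesgue_on \<Omega>) (\<lambda>x. \<bar>u x\<bar> powr p)"
      using uG by (auto simp: W1p_0_nonzero_def W1p_0_def Lp_def)
    have "(LINT x|lebesgue_on \<Omega>. \<bar>u x\<bar>) powr p
        \<le> measure (lebesgue_on \<Omega>) (space (lebesgue_on \<Omega>)) powr (p - 1) * Y"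
      unfolding Y_def
    proof (rule integral_abs_powr_le(2)[OF p u])
      show "emeasure (lebesgue_on \<Omega>) (space (lebesgue_on \<Omega>)) < \<infinity>"
        unfolding em using b by (rule emeasure_bounded_finite)
      show "0 < measure (lebesgue_on \<Omega>) (space (lebesgue_on \<Omega>))"
        using V em by (simp add: measure_def V_def)
    qed
    also have "measure (lebesgue_on \<Omega>) (space (lebesgue_on \<Omega>)) = V"
      using em by (simp add: measure_def V_def)
    also have "V powr (p - 1) * Y \<le> V powr (p - 1) * (X / l)"
      using lXY L lL by (intro mult_left_mono) (auto simp: le_divide_eq mult.commute)
    finally show "ereal ((LINT x|lebesgue_on \<Omega>. \<bar>u x\<bar>) powr p / (LINT x|lebesgue_on \<Omega>. norm (G x) powr p))
        \<le> ereal (V powr (p - 1) / l)"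
      using X unfolding X_def[symmetric] by (simp add: divide_le_eq)
  qed
  then have "T \<le> V powr (p - 1) / l" by (simp add: T)
  moreover have "T \<le> U" using upper T by simp
  ultimately show ?thesis
    using that[OF \<rho>(1,2) l T] lL RT unfolding L_def R_def U_def by blast
qed

theorem proposition3p2:
  fixes p p' :: real
  assumes "1 < p" and "p' = p / (p - 1)"
  shows "m_p1 TYPE('a::euclidean_space) p \<ge>
           ereal (1 / real DIM('a) * (pi_p p / 2) powr p * (1 / (real DIM('a) + p')) powr (p - 1))
       \<and> M_p1 TYPE('a) p \<le>
           min 1 (ereal ((1 / (p' + 1)) powr (p - 1)) * lambda_p p (ball (0::'a) 1))"
proof -
  have p': "1 < p'" using assms(1) unfolding assms(2) by (simp add: field_simps)
  \<comment> \<open>The unit ball is itself one of the domains, so its eigenvalue is a real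
    number.\<close>
  have "ball (0::'a) 1 \<in> convex_domains" by (simp add: convex_domains_def)
  then obtain b where b: "lambda_p p (ball (0::'a) 1) = ereal b"
    using convex_domain_bounds[OF _ assms(1)] by metis
  have main: "ereal (1 / real DIM('a) * (pi_p p / 2) powr p * (1 / (real DIM('a) + p')) powr (p - 1)) \<le> F_p1 p \<Omega>
      \<and> F_p1 p \<Omega> \<le> 1 \<and> F_p1 p \<Omega> \<le> ereal ((1 / (p' + 1)) powr (p - 1) * b)"
    if \<Omega>: "\<Omega> \<in> convex_domains" for \<Omega> :: "'a set"
  proof -
    define V where "V = measure lborel \<Omega>"
    have o: "open \<Omega>" and bd: "bounded \<Omega>" and ne: "\<Omega> \<noteq> {}"
      using \<Omega> by (auto simp: convex_domains_def)
    have V: "0 < V" unfolding V_def by (rule measure_open_pos[OF o bd ne])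
    obtain \<rho> x0 l T where \<rho>: "0 < \<rho>" "ball x0 \<rho> \<subseteq> \<Omega>" and l: "lambda_p p \<Omega> = ereal l" and T: "T_p p \<Omega> = ereal T"
      and bounds: "(pi_p p / 2 / \<rho>) powr p \<le> l"
        "\<rho> powr p * V powr (p - 1) / (DIM('a) * (DIM('a) + p') powr (p - 1)) \<le> T"
        "T \<le> (\<rho> powr p' * V / (p' + 1)) powr (p - 1)" "T \<le> V powr (p - 1) / l"
      using convex_domain_bounds[OF \<Omega> assms(1)] unfolding V_def assms(2) by metis
    have pp: "0 < pi_p p" by (rule pi_p_pos[OF assms(1)])
    have l0: "0 < l" using bounds(1) pp \<rho>(1) by (intro less_le_trans[OF _ bounds(1)]) simp
    have V1: "0 < V powr (p - 1)" using V by simp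
    have F: "F_p1 p \<Omega> = ereal (l * T / V powr (p - 1))"
      using o V by (simp add: F_p1_def l T V_def measure_completion)
    \<comment> \<open>\<rho>^p from the torsion cancels against \<rho>^(-p) from the eigenvalue, and
      V^(p-1) against the normalisation of \<open>F_p1\<close>.\<close>
    have "1 / real DIM('a) * (pi_p p / 2) powr p * (1 / (real DIM('a) + p')) powr (p - 1)
        = (pi_p p / 2 / \<rho>) powr p * (\<rho> powr p * V powr (p - 1) / (DIM('a) * (DIM('a) + p') powr (p - 1))) / V powr (p - 1)"
    proof -
      have *: "(pi_p p / 2 / \<rho>) powr p = (pi_p p / 2) powr p / \<rho> powr p"
        using \<rho>(1) pp by (subst powr_divide) auto
      show ?thesis unfolding * using \<rho>(1) V p' by (simp add: powr_divide)
    qed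
    also have "\<dots> \<le> l * T / V powr (p - 1)"
      using bounds(1,2) l0 p' by (intro divide_right_mono mult_mono) auto
    finally have 1: "1 / real DIM('a) * (pi_p p / 2) powr p * (1 / (real DIM('a) + p')) powr (p - 1) \<le> l * T / V powr (p - 1)" .
    have 2: "l * T / V powr (p - 1) \<le> 1" using bounds(4) l0 V1 by (simp add: field_simps)
    have lb: "l * \<rho> powr p \<le> b"
      using lambda_p_ball_scaling[OF _ o \<rho> assms(1), of l] l b by simp
    \<comment> \<open>Here \<rho>^p, which arises since p' (p - 1) = p, is absorbed by comparing
      \<lambda> with the eigenvalue of the unit ball.\<close>
    have "l * T / V powr (p - 1) \<le> l * (\<rho> powr p' * V / (p' + 1)) powr (p - 1) / V powr (p - 1)"
      using bounds(3) l0 by (intro divide_right_mono mult_left_mono) auto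
    also have "\<dots> = (l * \<rho> powr p) * (1 / (p' + 1)) powr (p - 1)"
    proof -
      have "(\<rho> powr p' * V / (p' + 1)) powr (p - 1) = \<rho> powr p * V powr (p - 1) * (1 / (p' + 1)) powr (p - 1)"
      proof -
        have "p' * (p - 1) = p" using assms by simp
        then show ?thesis using \<rho>(1) V p' by (simp add: powr_mult powr_divide powr_powr)
      qed
      then show ?thesis using V by simp
    qed
    also have "\<dots> \<le> b * (1 / (p' + 1)) powr (p - 1)" using lb by (intro mult_right_mono) auto
    finally show ?thesis using 1 2 unfolding F by (simp add: mult.commute)
  qed
  show ?thesis
  proof
    show "m_p1 TYPE('a) p \<ge>
           ereal (1 / real DIM('a) * (pi_p p / 2) powr p * (1 / (real DIM('a) + p')) powr (p - 1))"
      unfolding m_p1_def by (rule INF_greatest) (use main in blast)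
    show "M_p1 TYPE('a) p \<le> min 1 (ereal ((1 / (p' + 1)) powr (p - 1)) * lambda_p p (ball (0::'a) 1))"
      unfolding M_p1_def b by (rule SUP_least) (use main in simp)
  qed
qed

end
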